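(* There are constants $C_l,C_g>0$, independent of $h$ and $p$ (and of $w$), such that for every integer $p\ge1$ and every weight vector $w=(w_1,\dots,w_p)$ with positive entries, the condition number of the stabilized mass matrix $\mathcal{M}$ satisfies $$\kappa(\mathcal{M})\le C_M(w)\,\kappa(\mathcal{M}^* ),\qquad C_M(w)=C_l\,L(w)^{N_J}\bigl(1+C_g\,G(w)\bigr),$$ where $$L(w)=C_1(p)+\sum_{k=1}^p\frac1{w_k},\qquad G(w)=\sum_{k=1}^pw_k\frac{p^{4k+2}}{(2k+1)(k!)^2}.$$
   Context: $\Omega\subset\mathbb{R}^d$ is a bounded domain immersed in a finite mesh $\mathcal{T}$ of closed axis-aligned hypercubes of side length $h>0$ from a uniform Cartesian grid; $\mathcal{T}$ covers $\Omega$ and every $T\in\mathcal{T}$ satisfies $T\cap\Omega\ne\emptyset$. Set $\Omega_{\mathcal{T}}=\bigcup_{T\in\mathcal{T}}T$, $\mathcal{T}_\Gamma=\{T\in\mathcal{T}:T\cap\partial\Omega\neq\emptyset\}$, and let $\mathcal{F}_\Gamma$ be the set of common $(d-1)$-dimensional faces $F=T_1\cap T_2$ of distinct $T_1,T_2\in\mathcal{T}$ with $T_1\in\mathcal{T}_\Gamma$ or $T_2\in\mathcal{T}_\Gamma$. $Q_p(T)$ is the space of tensor-product polynomials of degree at most $p$ in each variable, and $V_h^p=\{v\in C^0(\Omega_{\mathcal{T}}): v|_T\in Q_p(T)\ \forall T\in\mathcal{T}\}$, with the nodal Lagrange basis $\{\phi_i\}_{i=1}^N$ for tensor-product Gauss–Lobatto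 nodes. $(\cdot,\cdot)_X$ and $\langle\cdot,\cdot\rangle_Y$ are $L_2$ inner products over $d$- and $(d-1)$-dimensional sets, and $\|\cdot\|_Z$ is the $L_2$-norm. For a face $F$ whose unit normal $n$ has $n_j=\pm1$ as its only nonzero component, $\partial_n^kv=n_j^k\,\partial^kv/\partial x_j^k$; $[v]=v|_{F_+}-v|_{F_-}$ is the jump over $F$. For fixed $\gamma_M>0$ (independent of $h,p$) and weights $w_k>0$, $$M(u,v)=(u,v)_\Omega+\gamma_M\,j(u,v),\qquad j(u,v)=\sum_{F\in\mathcal{F}_\Gamma}\sum_{k=1}^p w_k\frac{h^{2k+1}}{(2k+1)(k!)^2}\langle[\partial_n^ku],[\partial_n^kv]\rangle_F.$$ The matrices are $\mathcal{M}_{ij}=M(\phi_i,\phi_j)$ and $\mathcal{M}^*_{ij}=(\phi_i,\phi_j)_{\Omega_{\mathcal{T}}}$ (the mass matrix on the whole background mesh), and $\kappa=\lambda_{\max}/\lambda_{\min}$ is the spectral condition number of a symmetric positive definite matrix. $C_1(p)$ is a constant depending on $p$ but not on $h$ such that for any two hypercubes $T_1,T_2$ of side $h$ sharing a face, every $q\in Q_p$ (regarded as a polynomial on $T_1\cup T_2$) satisfies $\|q\|_{T_1}^2\le C_1(p)\|q\|_{T_2}^2$. Standing assumption (the geometry is well resolved by the mesh) and meaning of $N_J$: $N_J\ge1$ is an integer, independent of $h$ and $p$, such that for each $T_0\in\mathcal{T}_\Gamma$ there are $1\le N\le N_J$ and elements $T_1,\dots,T_{N-1}\in\mathcal{T}_\Gamma$,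 $T_N\in\mathcal{T}\setminus\mathcal{T}_\Gamma$ such that $T_{i-1}$ and $T_i$ share a face for $i=1,\dots,N$. The constants $C_l,C_g$ may depend on $d$, $N_J$ and $\gamma_M$. *)

theory Defs
  imports
    "HOL-Analysis.Analysis"
    "HOL-Computational_Algebra.Polynomial"
    "Jordan_Normal_Form.Char_Poly"
begin

text \<open>
  The ambient space is an arbitrary Euclidean space of dimension \<open>d = DIM('a)\<close>; the elements of
  \<open>Basis\<close> are the coordinate directions.
\<close>

section \<open>Background mesh\<close>

definition hypercube :: "real \<Rightarrow> 'a::euclidean_space \<Rightarrow> 'a set" where
  "hypercube h a = cbox a (a + h *\<^sub>R One)"

definition cartesian_grid :: "real \<Rightarrow> 'a::euclidean_space \<Rightarrow> 'a set set" where
  "cartesian_grid h a =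
     {hypercube h (a + (\<Sum>b\<in>Basis. (h * of_int (z b)) *\<^sub>R b)) | z :: 'a \<Rightarrow> int. True}"

definition share_face :: "'a::euclidean_space set \<Rightarrow> 'a set \<Rightarrow> bool" where
  "share_face S T \<longleftrightarrow> (S \<inter> T) facet_of S \<and> (S \<inter> T) facet_of T"

definition bounded_domain :: "'a::euclidean_space set \<Rightarrow> bool" where
  "bounded_domain \<Omega> \<longleftrightarrow> open \<Omega> \<and> connected \<Omega> \<and> \<Omega> \<noteq> {} \<and> bounded \<Omega>"

definition background_mesh :: "'a::euclidean_space set \<Rightarrow> real \<Rightarrow> 'a set set \<Rightarrow> bool" where
  "background_mesh \<Omega> h \<T> \<longleftrightarrow>
     finite \<T> \<and> (\<exists>a. \<T> \<subseteq> cartesian_grid h a) \<and> \<Omega> \<subseteq> \<Union>\<T> \<and> (\<forall>T\<in>\<T>. T \<inter> \<Omega> \<noteq> {})"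

definition cut_elements :: "'a::euclidean_space set \<Rightarrow> 'a set set \<Rightarrow> 'a set set" where
  "cut_elements \<Omega> \<T> = {T\<in>\<T>. T \<inter> frontier \<Omega> \<noteq> {}}"

definition stab_faces :: "'a::euclidean_space set \<Rightarrow> 'a set set \<Rightarrow> 'a set set" where
  "stab_faces \<Omega> \<T> =
     {T1 \<inter> T2 | T1 T2. T1 \<in> \<T> \<and> T2 \<in> \<T> \<and> T1 \<noteq> T2 \<and> share_face T1 T2 \<and>
        (T1 \<in> cut_elements \<Omega> \<T> \<or> T2 \<in> cut_elements \<Omega> \<T>)}"

definition well_resolved :: "nat \<Rightarrow> 'a::euclidean_space set \<Rightarrow> 'a set set \<Rightarrow> bool" where
  "well_resolved N_J \<Omega> \<T> \<longleftrightarrow>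
     (\<forall>T\<^sub>0\<in>cut_elements \<Omega> \<T>. \<exists>N T. 1 \<le> N \<and> N \<le> N_J \<and> T 0 = T\<^sub>0 \<and>
        (\<forall>i\<in>{1..<N}. T i \<in> cut_elements \<Omega> \<T>) \<and>
        T N \<in> \<T> - cut_elements \<Omega> \<T> \<and>
        (\<forall>i\<in>{1..N}. share_face (T (i - 1)) (T i)))"


section \<open>Finite element space and nodal basis\<close>

definition Q_poly :: "nat \<Rightarrow> ('a::euclidean_space \<Rightarrow> real) set" where
  "Q_poly p = {\<lambda>x. \<Sum>\<alpha>\<in>Basis \<rightarrow>\<^sub>E {..p}. c \<alpha> * (\<Prod>b\<in>Basis. (x \<bullet> b) ^ \<alpha> b) | c. True}"

text \<open>
  Members of the following space are only determined on \<open>\<Union>\<T>\<close>; their values elsewhere are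
  irrelevant for every quantity defined below.
\<close>

definition fe_space :: "nat \<Rightarrow> 'a::euclidean_space set set \<Rightarrow> ('a \<Rightarrow> real) set" where
  "fe_space p \<T> = {v. continuous_on (\<Union>\<T>) v \<and> (\<forall>T\<in>\<T>. \<exists>q\<in>Q_poly p. \<forall>x\<in>T. v x = q x)}"

text \<open>Legendre polynomials by Rodrigues' formula.\<close>

definition legendre :: "nat \<Rightarrow> real poly" where
  "legendre p = Polynomial.smult (1 / (2 ^ p * fact p)) ((pderiv ^^ p) ([:-1, 0, 1:] ^ p))"

text \<open>The \<open>p + 1\<close> Gauss--Lobatto nodes on \<open>[-1, 1]\<close>, for \<open>p \<ge> 1\<close>.\<close>

definition gauss_lobatto :: "nat \<Rightarrow> real set" where
  "gauss_lobatto p = {-1, 1} \<union> {s. -1 < s \<and> s < 1 \<and> poly (pderiv (legendre p)) s = 0}"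

definition element_nodes :: "nat \<Rightarrow> real \<Rightarrow> 'a::euclidean_space set \<Rightarrow> 'a set" where
  "element_nodes p h T =
     {a + (\<Sum>b\<in>Basis. (h * (1 + s b) / 2) *\<^sub>R b) | a s.
        T = hypercube h a \<and> (\<forall>b\<in>Basis. s b \<in> gauss_lobatto p)}"

definition mesh_nodes :: "nat \<Rightarrow> real \<Rightarrow> 'a::euclidean_space set set \<Rightarrow> 'a set" where
  "mesh_nodes p h \<T> = (\<Union>T\<in>\<T>. element_nodes p h T)"

definition nodal_basis ::
  "nat \<Rightarrow> real \<Rightarrow> 'a::euclidean_space set set \<Rightarrow> nat \<Rightarrow> (nat \<Rightarrow> 'a \<Rightarrow> real) \<Rightarrow> bool" where
  "nodal_basis p h \<T> N \<phi> \<longleftrightarrow>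
     (\<exists>x. bij_betw x {..<N} (mesh_nodes p h \<T>) \<and>
        (\<forall>i<N. \<phi> i \<in> fe_space p \<T> \<and> (\<forall>j<N. \<phi> i (x j) = (if i = j then 1 else 0))))"


section \<open>Inner products\<close>

definition l2_inner :: "'a::euclidean_space set \<Rightarrow> ('a \<Rightarrow> real) \<Rightarrow> ('a \<Rightarrow> real) \<Rightarrow> real" where
  "l2_inner X u v = (LINT x:X|lborel. u x * v x)"

definition l2_norm :: "'a::euclidean_space set \<Rightarrow> ('a \<Rightarrow> real) \<Rightarrow> real" where
  "l2_norm X v = sqrt (l2_inner X v v)"

text \<open>
  Each face lies in a unique hyperplane \<open>{x. n \<bullet> x = c}\<close> with \<open>n \<in> Basis\<close>.  This fixes the unit
  normal to point in the positive coordinate direction; replacing \<open>n\<close> by \<open>-n\<close> multiplies the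
  jump of the \<open>k\<close>-th normal derivative by \<open>(-1) ^ (k + 1)\<close> and hence leaves products of two such
  jumps unchanged.
\<close>

definition face_normal :: "'a::euclidean_space set \<Rightarrow> 'a" where
  "face_normal F = (THE n. n \<in> Basis \<and> (\<exists>c. F \<subseteq> {x. n \<bullet> x = c}))"

definition face_offset :: "'a::euclidean_space set \<Rightarrow> real" where
  "face_offset F = (THE c. F \<subseteq> {x. face_normal F \<bullet> x = c})"

text \<open>
  The \<open>(d - 1)\<close>-dimensional Lebesgue measure on the hyperplane \<open>{x. n \<bullet> x = c}\<close>, \<open>n \<in> Basis\<close>
  (the unit point mass if \<open>d = 1\<close>).
\<close>

definition hyperplane_measure :: "'a::euclidean_space \<Rightarrow> real \<Rightarrow> 'a measure" where
  "hyperplane_measure n c =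
     distr (\<Pi>\<^sub>M b\<in>Basis - {n}. lborel) borel (\<lambda>y. c *\<^sub>R n + (\<Sum>b\<in>Basis - {n}. y b *\<^sub>R b))"

definition face_inner :: "'a::euclidean_space set \<Rightarrow> ('a \<Rightarrow> real) \<Rightarrow> ('a \<Rightarrow> real) \<Rightarrow> real" where
  "face_inner F u v = (LINT x:F|hyperplane_measure (face_normal F) (face_offset F). u x * v x)"


section \<open>Stabilized mass form\<close>

definition normal_deriv ::
  "'a::euclidean_space \<Rightarrow> nat \<Rightarrow> ('a \<Rightarrow> real) \<Rightarrow> 'a \<Rightarrow> real" where
  "normal_deriv n k v x = (deriv ^^ k) (\<lambda>t. v (x + t *\<^sub>R n)) 0"

definition one_sided_trace :: "'a::euclidean_space \<Rightarrow> ('a \<Rightarrow> real) \<Rightarrow> 'a \<Rightarrow> real" where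
  "one_sided_trace n v x = Lim (at_right 0) (\<lambda>s. v (x + s *\<^sub>R n))"

definition jump :: "'a::euclidean_space \<Rightarrow> ('a \<Rightarrow> real) \<Rightarrow> 'a \<Rightarrow> real" where
  "jump n v x = one_sided_trace n v x - one_sided_trace (- n) v x"

definition stab_form ::
  "'a::euclidean_space set \<Rightarrow> real \<Rightarrow> 'a set set \<Rightarrow> nat \<Rightarrow> (nat \<Rightarrow> real) \<Rightarrow>
   ('a \<Rightarrow> real) \<Rightarrow> ('a \<Rightarrow> real) \<Rightarrow> real" where
  "stab_form \<Omega> h \<T> p w u v =
     (\<Sum>F\<in>stab_faces \<Omega> \<T>. \<Sum>k = 1..p.
        w k * (h ^ (2 * k + 1) / (real (2 * k + 1) * (fact k)\<^sup>2)) *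
        face_inner F
          (jump (face_normal F) (normal_deriv (face_normal F) k u))
          (jump (face_normal F) (normal_deriv (face_normal F) k v)))"

definition stab_mass_form ::
  "'a::euclidean_space set \<Rightarrow> real \<Rightarrow> 'a set set \<Rightarrow> real \<Rightarrow> nat \<Rightarrow> (nat \<Rightarrow> real) \<Rightarrow>
   ('a \<Rightarrow> real) \<Rightarrow> ('a \<Rightarrow> real) \<Rightarrow> real" where
  "stab_mass_form \<Omega> h \<T> \<gamma> p w u v = l2_inner \<Omega> u v + \<gamma> * stab_form \<Omega> h \<T> p w u v"


section \<open>Matrices and condition numbers\<close>

definition stab_mass_matrix ::
  "'a::euclidean_space set \<Rightarrow> real \<Rightarrow> 'a set set \<Rightarrow> real \<Rightarrow> nat \<Rightarrow> (nat \<Rightarrow> real) \<Rightarrow>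
   nat \<Rightarrow> (nat \<Rightarrow> 'a \<Rightarrow> real) \<Rightarrow> real Matrix.mat" where
  "stab_mass_matrix \<Omega> h \<T> \<gamma> p w N \<phi> =
     Matrix.mat N N (\<lambda>(i, j). stab_mass_form \<Omega> h \<T> \<gamma> p w (\<phi> i) (\<phi> j))"

definition background_mass_matrix ::
  "'a::euclidean_space set set \<Rightarrow> nat \<Rightarrow> (nat \<Rightarrow> 'a \<Rightarrow> real) \<Rightarrow> real Matrix.mat" where
  "background_mass_matrix \<T> N \<phi> = Matrix.mat N N (\<lambda>(i, j). l2_inner (\<Union>\<T>) (\<phi> i) (\<phi> j))"

text \<open>To be used for symmetric positive definite matrices only.\<close>

definition spectral_cond :: "real Matrix.mat \<Rightarrow> real" where
  "spectral_cond A = Max {l. eigenvalue A l} / Min {l. eigenvalue A l}"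


section \<open>Constants\<close>

text \<open>\<open>C\<close> bounds the growth of \<open>Q_poly p\<close> across a face, uniformly in the side length.\<close>

definition neighbour_const :: "'a::euclidean_space itself \<Rightarrow> nat \<Rightarrow> real \<Rightarrow> bool" where
  "neighbour_const _ p C \<longleftrightarrow>
     (\<forall>h>0. \<forall>a1 a2 :: 'a. share_face (hypercube h a1) (hypercube h a2) \<longrightarrow>
        (\<forall>q\<in>Q_poly p. (l2_norm (hypercube h a1) q)\<^sup>2 \<le> C * (l2_norm (hypercube h a2) q)\<^sup>2))"

definition L_weight :: "(nat \<Rightarrow> real) \<Rightarrow> nat \<Rightarrow> (nat \<Rightarrow> real) \<Rightarrow> real" where
  "L_weight C\<^sub>1 p w = C\<^sub>1 p + (\<Sum>k = 1..p. 1 / w k)"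

definition G_weight :: "nat \<Rightarrow> (nat \<Rightarrow> real) \<Rightarrow> real" where
  "G_weight p w = (\<Sum>k = 1..p. w k * (real p ^ (4 * k + 2) / (real (2 * k + 1) * (fact k)\<^sup>2)))"

end

theory Submission
  imports Defs "Jordan_Normal_Form.Spectral_Radius"
begin

text \<open>
  The bound is a comparison of quadratic forms on the span of the nodal basis: the stabilized form
  is at most \<open>1 + C\<^sub>g * G w\<close> times the background mass, and the background mass is at most
  \<open>C\<^sub>l * L w ^ N_J\<close> times the stabilized form; Rayleigh quotients turn this into eigenvalue bounds.

  Upper bound: expanding in shifted Legendre polynomials, whose derivatives at an endpoint are
  explicit, gives the inverse inequality
  \<open>h ^ (2 * k + 1) * (q\<^sup>(\<^sup>k\<^sup>) 0)\<^sup>2 \<le> 16 * p ^ (4 * k + 2) * \<integral> q\<^sup>2\<close> on \<open>[0, h]\<close> with a constant independent of \<open>k\<close> and \<open>p\<close>.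

  Lower bound: across a face the polynomials of the two neighbours differ by the Taylor sum of the
  normal derivative jumps, so by a weighted Cauchy--Schwarz inequality the mass of an element is
  bounded by \<open>2 * L w\<close> times the mass of its neighbour plus the face penalty. Walking at most
  \<open>N_J\<close> faces reaches an uncut element, which lies inside \<open>\<Omega>\<close>. All overlaps are controlled by the
  fact that a grid cube meets at most \<open>3 ^ d\<close> grid cubes, so no disjointness up to null sets is needed.
\<close>

text \<open>The factor \<open>h ^ (2 * k + 1) / (real (2 * k + 1) * (fact k)\<^sup>2)\<close> of the
  penalty is the integral of (t^k / k!)^2 over [0, h], the mass of one Taylor monomial across an
  element. Cauchy-Schwarz with weights w k therefore loses only the sum of the 1 / w k. The inverse
  inequality must be uniform in k: iterating a first-order estimate would also multiply its constant
  k times. Explicit end point derivatives give the power p^(4k) in one stroke, and the Legendre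
  norms contribute the remaining p^2. The walk is organized in layers instead of one path per
  element, because paths of different elements may run through the same cubes. A layer step needs
  only local multiplicities, and keeping the whole penalty on both sides lets it be iterated. Each
  step absorbs the old layer into the new bound, which uses L w >= 1, hence C_1(p) >= 1. This is not
  assumed: it follows by testing \<open>neighbour_const\<close> with a constant function on two
  elements sharing a face, and these exist because a bounded domain has a cut element.\<close>

no_notation Matrix.scalar_prod (infix "\<bullet>" 70)

section \<open>A one-dimensional inverse inequality\<close>

definition unit_integral :: "real poly \<Rightarrow> real" where
  "unit_integral P = integral {0..1} (poly P)"

lemma poly_integrable_on [simp]: "poly (P :: real poly) integrable_on {a..b}"
  by (intro integrable_continuous_real continuous_intros)

lemma unit_integral_add: "unit_integral (P + Q) = unit_integral P + unit_integral Q"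
  unfolding unit_integral_def poly_add by (rule integral_add) auto

lemma unit_integral_smult: "unit_integral (Polynomial.smult c P) = c * unit_integral P"
  unfolding unit_integral_def poly_smult by simp

lemma unit_integral_0 [simp]: "unit_integral 0 = 0"
  by (simp add: unit_integral_def poly_0[abs_def])

lemma unit_integral_sum: "unit_integral (\<Sum>i\<in>I. f i) = (\<Sum>i\<in>I. unit_integral (f i))"
  by (induction I rule: infinite_finite_induct) (auto simp: unit_integral_add)

lemma unit_integral_pderiv: "unit_integral (pderiv P) = poly P 1 - poly P 0"
proof -
  have "(poly (pderiv P) has_integral (poly P 1 - poly P 0)) {0..1}"
    by (rule fundamental_theorem_of_calculus)
      (auto simp flip: has_real_derivative_iff_has_vector_derivative intro: poly_DERIV DERIV_subset)
  then show ?thesis unfolding unit_integral_def by (rule integral_unique)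
qed

lemma unit_integral_by_parts:
  "unit_integral (P * pderiv Q) = poly (P * Q) 1 - poly (P * Q) 0 - unit_integral (pderiv P * Q)"
  using unit_integral_pderiv[of "P * Q"]
  by (simp add: pderiv_mult unit_integral_add algebra_simps)

section \<open>Shifted Legendre polynomials: Rodrigues' formula, orthogonality, norm and
  expansion\<close>

lemma power_dvd_pderiv:
  fixes r P :: "real poly"
  assumes "r ^ Suc n dvd P" shows "r ^ n dvd pderiv P"
proof -
  obtain s where s: "P = r ^ Suc n * s" using assms by (auto simp: dvd_def)
  have "pderiv P = r ^ n * (Polynomial.smult (of_nat (Suc n)) (pderiv r * s) + r * pderiv s)"
    unfolding s pderiv_mult pderiv_power_Suc by (simp add: algebra_simps)
  then show ?thesis by simp
qed

lemma power_dvd_higher_pderiv: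
  fixes r P :: "real poly"
  assumes "r ^ (n + i) dvd P" shows "r ^ n dvd (pderiv ^^ i) P"
  using assms
proof (induction i arbitrary: n)
  case (Suc i)
  then have "r ^ (Suc n + i) dvd P" by simp
  then have "r ^ Suc n dvd (pderiv ^^ i) P" by (rule Suc.IH)
  then show ?case by (simp add: power_dvd_pderiv del: power_Suc)
qed simp

text \<open>Rodrigues' formula for the Legendre polynomial composed with 2 X - 1;
  \<open>[:0, -1, 1:]\<close> is X^2 - X. On [0, 1] the relevant end point is 0, so derivatives
  there are coefficients up to a factorial.\<close>

definition shifted_legendre :: "nat \<Rightarrow> real poly" where
  "shifted_legendre m = Polynomial.smult (1 / fact m) ((pderiv ^^ m) ([:0, -1, 1:] ^ m))"

text \<open>Both 0 and 1 are roots of multiplicity m of (X^2 - X)^m, and each derivative lowers the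
  multiplicity by at most one. These values are the boundary terms of the integrations by parts
  below.\<close>

lemma higher_pderiv_vanishes:
  assumes "i < m" "x = 0 \<or> x = 1"
  shows "poly ((pderiv ^^ i) ([:0, -1, 1:] ^ m)) x = (0::real)"
proof -
  have "[:-x, 1:] dvd [:0, -1, 1::real:]"
    using assms(2) by (auto simp: poly_eq_0_iff_dvd[symmetric])
  then have "[:-x, 1:] ^ m dvd [:0, -1, 1:] ^ m" by (rule dvd_power_same)
  moreover have "m = Suc (m - i - 1) + i" using assms by simp
  ultimately have "[:-x, 1:] ^ Suc (m - i - 1) dvd (pderiv ^^ i) ([:0, -1, 1:] ^ m)"
    by (metis power_dvd_higher_pderiv)
  then have "[:-x, 1:] dvd (pderiv ^^ i) ([:0, -1, 1:] ^ m)"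
    by (metis dvd_trans dvd_triv_left power_Suc)
  then show ?thesis by (simp add: poly_eq_0_iff_dvd)
qed

lemma unit_integral_rodrigues:
  assumes "i \<le> m"
  shows "unit_integral (f * (pderiv ^^ m) ([:0, -1, 1:] ^ m)) =
    (-1) ^ i * unit_integral ((pderiv ^^ i) f * (pderiv ^^ (m - i)) ([:0, -1, 1:] ^ m))"
  using assms
proof (induction i)
  case (Suc i)
  have *: "m - i = Suc (m - Suc i)" using Suc by simp
  show ?case using Suc
    by (simp add: * unit_integral_by_parts higher_pderiv_vanishes)
qed simp

lemma higher_pderiv_eq_0:
  assumes "degree (f :: real poly) < m" shows "(pderiv ^^ m) f = 0"
  by (rule poly_eqI) (use assms in \<open>simp add: coeff_higher_pderiv coeff_eq_0\<close>)

lemma shifted_legendre_orthogonal_low_degree: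
  assumes "degree f < m" shows "unit_integral (f * shifted_legendre m) = 0"
  using unit_integral_rodrigues[of m m f] assms
  by (simp add: shifted_legendre_def higher_pderiv_eq_0 unit_integral_smult)

text \<open>Since (X^2 - X)^m = X^m (X - 1)^m, the coefficient of X^(m + k) is a binomial
  coefficient of (X - 1)^m, and differentiating m times multiplies it by (m + k)! / k!.\<close>

lemma coeff_shifted_legendre:
  assumes "k \<le> m"
  shows "coeff (shifted_legendre m) k = (-1) ^ (m - k) * fact (m + k) / ((fact k)\<^sup>2 * fact (m - k))"
proof -
  have e: "[:0, -1, 1:] ^ m = Polynomial.monom (1::real) m * [:-1, 1:] ^ m"
    unfolding monom_altdef smult_1_left power_mult_distrib[symmetric] by simp
  have "coeff ([:-1, 1::real:] ^ m) k = of_nat (m choose k) * (-1) ^ (m - k)"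
    using coeff_linear_poly_power[of k m "-1" "1::real"] assms by simp
  moreover have "pochhammer (of_nat (Suc k)) m = (fact (m + k) / fact k :: real)"
    using pochhammer_product'[of "1::real" k m]
    by (simp add: add.commute[of m] flip: pochhammer_fact)
  ultimately show ?thesis using assms
    by (simp add: shifted_legendre_def coeff_higher_pderiv e coeff_monom_mult binomial_fact
        power2_eq_square mult_ac)
qed

lemma degree_shifted_legendre_le: "degree (shifted_legendre m) \<le> m"
proof -
  have "degree ([:0, -1, 1::real:] ^ m) \<le> 2 * m"
    using degree_power_le[of "[:0, -1, 1::real:]" m] by simp
  then show ?thesis
    by (intro degree_le) (auto simp: shifted_legendre_def coeff_higher_pderiv coeff_eq_0)
qed

lemma coeff_shifted_legendre_top: "coeff (shifted_legendre m) m \<noteq> 0"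
  by (simp add: coeff_shifted_legendre)

text \<open>
  Integrating \<open>((X - 1) * P\<^sup>2)'\<close> determines the norm of \<open>P = shifted_legendre m\<close>, because
  \<open>(X - 1) * P'\<close> equals \<open>m * P\<close> up to terms of lower degree.
\<close>

lemma shifted_legendre_norm:
  "unit_integral (shifted_legendre m * shifted_legendre m) = 1 / real (2 * m + 1)"
proof -
  define P where "P = shifted_legendre m"
  define R where "R = [:-1, 1:] * pderiv P - Polynomial.smult (real m) P"
  have dP: "degree P \<le> m" unfolding P_def by (rule degree_shifted_legendre_le)
  have "coeff R k = 0" if "k \<ge> m" for k
    using that dP by (cases k) (auto simp: R_def coeff_pderiv coeff_eq_0 algebra_simps le_Suc_eq)
  then have R: "R = 0 \<or> degree R < m"
    by (metis leading_coeff_0_iff not_le)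
  have RP: "unit_integral (R * P) = 0"
    using R shifted_legendre_orthogonal_low_degree unfolding P_def by fastforce
  have "[:-1, 1:] * pderiv P * P = R * P + Polynomial.smult (real m) (P * P)"
    by (simp add: R_def algebra_simps)
  then have m: "unit_integral ([:-1, 1:] * pderiv P * P) = real m * unit_integral (P * P)"
    using RP by (simp only: unit_integral_add unit_integral_smult)
  have "pderiv (A * (P * P)) = P * P + (A * pderiv P * P + A * pderiv P * P)" if "pderiv A = 1" for A
    using that by (simp add: pderiv_mult algebra_simps)
  then have "pderiv ([:-1, 1:] * (P * P)) = P * P + ([:-1, 1:] * pderiv P * P + [:-1, 1:] * pderiv P * P)"
    by (simp only: pderiv_pCons pderiv_0 pCons_0_0 add_0_right one_pCons)
  \<comment> \<open>The boundary term at 1 vanishes through the factor X - 1; the one at 0 leaves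
    P(0)^2, and P(0) is 1 or -1.\<close>
  then have "unit_integral (P * P) + 2 * (real m * unit_integral (P * P)) = (coeff P 0)\<^sup>2"
    using unit_integral_pderiv[of "[:-1, 1:] * (P * P)"]
    by (simp only: unit_integral_add m) (simp add: poly_0_coeff_0[symmetric] power2_eq_square)
  moreover have "(coeff P 0)\<^sup>2 = 1"
    by (simp add: P_def coeff_shifted_legendre power_mult_distrib[symmetric] flip: power_mult)
  ultimately show ?thesis by (simp add: P_def field_simps)
qed

lemma shifted_legendre_orthogonal:
  "unit_integral (shifted_legendre i * shifted_legendre j) = (if i = j then 1 / real (2 * i + 1) else 0)"
proof (cases i j rule: linorder_cases)
  case less
  then show ?thesis
    using shifted_legendre_orthogonal_low_degree[of "shifted_legendre i" j] degree_shifted_legendre_le[of i]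
    by simp
next
  case greater
  then show ?thesis
    using shifted_legendre_orthogonal_low_degree[of "shifted_legendre j" i] degree_shifted_legendre_le[of j]
    by (simp add: mult.commute)
qed (simp add: shifted_legendre_norm)

lemma shifted_legendre_expansion:
  assumes "degree P \<le> p"
  shows "\<exists>c. P = (\<Sum>m\<le>p. Polynomial.smult (c m) (shifted_legendre m))"
  using assms
proof (induction p arbitrary: P)
  case 0
  then obtain a where a: "P = [:a:]" using degree_eq_zeroE by blast
  have "shifted_legendre 0 = 1" by (simp add: shifted_legendre_def)
  then show ?case by (intro exI[of _ "\<lambda>_. a"]) (simp add: a)
next
  case (Suc p)
  define a where "a = coeff P (Suc p) / coeff (shifted_legendre (Suc p)) (Suc p)"
  define R where "R = P - Polynomial.smult a (shifted_legendre (Suc p))"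
  have "coeff R k = 0" if "k > p" for k
  proof (cases "k = Suc p")
    case True
    then show ?thesis using coeff_shifted_legendre_top[of "Suc p"] by (simp add: R_def a_def)
  next
    case False
    then have "k > Suc p" using that by simp
    then show ?thesis using Suc.prems degree_shifted_legendre_le[of "Suc p"]
      by (simp add: R_def coeff_eq_0)
  qed
  then have "degree R \<le> p" by (intro degree_le) auto
  from Suc.IH[OF this] obtain c where c: "R = (\<Sum>m\<le>p. Polynomial.smult (c m) (shifted_legendre m))" by blast
  have "P = (\<Sum>m\<le>Suc p. Polynomial.smult ((c(Suc p := a)) m) (shifted_legendre m))"
    using c by (simp add: R_def diff_eq_eq)
  then show ?case by blast
qed

text \<open>The left side is (m + k) times the product of m^2 - j^2 over j < k, obtained by pairing
  the factors m + j and m - j. The extra factor m completes the pair for j = 0, so that the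
  induction can start at k = 0. As k <= m, the leading m + k is at most 2 m.\<close>

lemma fact_add_div_fact_diff_le:
  assumes "k \<le> m"
  shows "fact (m + k) / fact (m - k) * real m \<le> (real m + real k) * real m ^ (2 * k)"
  using assms
proof (induction k)
  case (Suc k)
  define r where "r = m - Suc k"
  have m: "m = r + Suc k" using Suc.prems by (simp add: r_def)
  have mk: "m - k = Suc r" "m - Suc k = r" using m by auto
  have "fact (m + Suc k) / fact (m - Suc k) * real m
      = (real m + real (Suc k)) * (real m - real k) * (fact (m + k) / fact (m - k) * real m)"
  proof -
    have r: "real m - real k = real r + 1" using m by simp
    have *: "fact (Suc r) = (real r + 1) * fact r" by simp
    have "real r + 1 \<noteq> 0" by linarith
    moreover have "u * a * x / f * y = a * v * (x / (v * f) * y)" if "u = 1" "v \<noteq> 0" for u a x f y v :: real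
      using that by simp
    moreover have "fact (m + Suc k) = (real m + real (Suc k)) * fact (m + k)" by simp
    ultimately show ?thesis unfolding mk r * by (metis mult_1)
  qed
  also have "\<dots> \<le> (real m + real (Suc k)) * (real m - real k) * ((real m + real k) * real m ^ (2 * k))"
    using Suc by (intro mult_left_mono) auto
  also have "\<dots> = (real m + real (Suc k)) * (((real m)\<^sup>2 - (real k)\<^sup>2) * real m ^ (2 * k))"
    by (simp add: algebra_simps power2_eq_square)
  also have "\<dots> \<le> (real m + real (Suc k)) * ((real m)\<^sup>2 * real m ^ (2 * k))"
    by (intro mult_left_mono mult_right_mono) auto
  finally show ?case by (simp add: power_add power2_eq_square mult_ac)
qed simp

lemma shifted_legendre_deriv_at_0_bound:
  assumes "m \<le> p" "1 \<le> k"
  shows "(fact k * coeff (shifted_legendre m) k)\<^sup>2 \<le> 4 * real p ^ (4 * k)"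
proof (cases "k \<le> m")
  case True
  then have m: "m \<ge> 1" using assms by simp
  have "\<bar>fact k * coeff (shifted_legendre m) k\<bar> = fact (m + k) / fact (m - k) / fact k"
    using True by (simp add: coeff_shifted_legendre abs_mult power2_eq_square)
  \<comment> \<open>Discarding \<open>1 / fact k\<close> leaves a bound whose constant does not
    depend on k.\<close>
  also have "\<dots> \<le> fact (m + k) / fact (m - k)"
    by (simp add: divide_le_eq mult_left_le fact_ge_1 mult_le_cancel_left1)
  also have "\<dots> \<le> 2 * real m ^ (2 * k)"
  proof -
    have "fact (m + k) / fact (m - k) * real m \<le> (real m + real k) * real m ^ (2 * k)"
      by (rule fact_add_div_fact_diff_le[OF True])
    also have "\<dots> \<le> (2 * real m) * real m ^ (2 * k)"
      using True by (intro mult_right_mono) auto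
    finally have "fact (m + k) / fact (m - k) * real m \<le> (2 * real m ^ (2 * k)) * real m"
      by (simp add: mult_ac)
    then show ?thesis by (rule mult_right_le_imp_le) (use m in simp)
  qed
  also have "\<dots> \<le> 2 * real p ^ (2 * k)" using assms by (simp add: power_mono)
  finally have "\<bar>fact k * coeff (shifted_legendre m) k\<bar>\<^sup>2 \<le> (2 * real p ^ (2 * k))\<^sup>2"
    by (rule power_mono) simp
  then show ?thesis by (simp add: power_mult_distrib mult.commute flip: power_mult)
next
  case False
  then show ?thesis using degree_shifted_legendre_le[of m] by (simp add: coeff_eq_0)
qed

text \<open>\<open>fact k * coeff P k\<close> is the k-th derivative of P at 0. Orthogonality makes
  the squared norm the sum of (c m)^2 / (2 m + 1), so Cauchy-Schwarz is applied with the factors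
  sqrt (2 m + 1). Their squares sum to (p + 1)^2 <= 4 p^2; with the bound 4 p^(4k) on the squared
  derivatives this yields 16 p^(4k + 2).\<close>

lemma inverse_inequality_unit:
  assumes "degree P \<le> p" "1 \<le> p" "1 \<le> k"
  shows "(fact k * coeff P k)\<^sup>2 \<le> 16 * real p ^ (4 * k + 2) * unit_integral (P * P)"
proof -
  obtain c where c: "P = (\<Sum>m\<le>p. Polynomial.smult (c m) (shifted_legendre m))"
    using shifted_legendre_expansion[OF assms(1)] by blast
  have norm: "unit_integral (P * P) = (\<Sum>m\<le>p. (c m)\<^sup>2 / real (2 * m + 1))"
    unfolding c
    by (simp add: sum_product unit_integral_sum unit_integral_smult shifted_legendre_orthogonal
        if_distrib power2_eq_square cong: if_cong)
  let ?D = "\<lambda>m. fact k * coeff (shifted_legendre m) k"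
  have "(\<Sum>m\<le>p. (sqrt (real (2 * m + 1)) * ?D m)\<^sup>2) \<le> (\<Sum>m\<le>p. real (2 * m + 1) * (4 * real p ^ (4 * k)))"
  proof (rule sum_mono)
    fix m assume "m \<in> {..p}"
    then show "(sqrt (real (2 * m + 1)) * ?D m)\<^sup>2 \<le> real (2 * m + 1) * (4 * real p ^ (4 * k))"
      using shifted_legendre_deriv_at_0_bound[of m p k] assms
      by (subst power_mult_distrib) (simp add: mult_left_mono)
  qed
  also have "\<dots> = (real p + 1)\<^sup>2 * (4 * real p ^ (4 * k))"
  proof -
    have "(\<Sum>m\<le>p. real (2 * m + 1)) = (real p + 1)\<^sup>2"
      by (induction p) (auto simp: power2_eq_square algebra_simps)
    then show ?thesis by (simp only: sum_distrib_right[symmetric])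
  qed
  also have "\<dots> \<le> (2 * real p)\<^sup>2 * (4 * real p ^ (4 * k))"
    using assms by (intro mult_right_mono power_mono) auto
  also have "\<dots> = 16 * real p ^ (4 * k + 2)" by (simp add: power_add power2_eq_square mult_ac)
  finally have D: "(\<Sum>m\<le>p. (sqrt (real (2 * m + 1)) * ?D m)\<^sup>2) \<le> 16 * real p ^ (4 * k + 2)" .
  have "fact k * coeff P k = (\<Sum>m\<le>p. (c m / sqrt (real (2 * m + 1))) * (sqrt (real (2 * m + 1)) * ?D m))"
    unfolding c by (simp add: coeff_sum sum_distrib_left mult_ac)
  then have "(fact k * coeff P k)\<^sup>2
      \<le> (\<Sum>m\<le>p. (sqrt (real (2 * m + 1)) * ?D m)\<^sup>2) * (\<Sum>m\<le>p. (c m / sqrt (real (2 * m + 1)))\<^sup>2)"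
    by (subst mult.commute) (simp only: Cauchy_Schwarz_ineq_sum)
  also have "(\<Sum>m\<le>p. (c m / sqrt (real (2 * m + 1)))\<^sup>2) = unit_integral (P * P)"
    unfolding norm by (intro sum.cong) (auto simp: power_divide)
  finally show ?thesis
    using mult_right_mono[OF D, of "unit_integral (P * P)"] by (simp add: norm sum_nonneg)
qed

text \<open>Rescaling [0, h] to [0, 1] multiplies the k-th derivative by h^k and the integral by 1 /
  h; after squaring, the two effects combine to h^(2k + 1).\<close>

lemma inverse_inequality:
  assumes "1 \<le> p" "1 \<le> k" "k \<le> p" "0 < h"
  shows "h ^ (2 * k + 1) * (fact k * e k)\<^sup>2
    \<le> 16 * real p ^ (4 * k + 2) * integral {0..h} (\<lambda>t. (\<Sum>j\<le>p. e j * t ^ j)\<^sup>2)"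
proof -
  define P where "P = (\<Sum>j\<le>p. Polynomial.monom (e j * h ^ j) j)"
  have cP: "coeff P j = (if j \<le> p then e j * h ^ j else 0)" for j
    by (simp add: P_def coeff_sum)
  then have "degree P \<le> p" by (intro degree_le) auto
  then have *: "(fact k * coeff P k)\<^sup>2 \<le> 16 * real p ^ (4 * k + 2) * unit_integral (P * P)"
    using assms by (intro inverse_inequality_unit)
  have P: "poly P t = (\<Sum>j\<le>p. e j * (h * t) ^ j)" for t
    by (simp add: P_def poly_sum poly_monom power_mult_distrib mult_ac)
  let ?g = "\<lambda>t. (\<Sum>j\<le>p. e j * t ^ j)\<^sup>2"
  have "(?g has_integral (integral {0..h} ?g)) {0..h}"
    by (intro integrable_integral integrable_continuous_real continuous_intros)
  then have "((\<lambda>t. ?g (h * t)) has_integral (1 / h) * integral {0..h} ?g) {0..1}"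
    using has_integral_affinity'[of ?g "integral {0..h} ?g" 0 h h 0] assms
    by (simp add: divide_inverse)
  then have "unit_integral (P * P) = (1 / h) * integral {0..h} ?g"
    unfolding unit_integral_def by (intro integral_unique) (simp add: P poly_mult[abs_def] power2_eq_square)
  with * have "h * (fact k * (e k * h ^ k))\<^sup>2 \<le> h * (16 * real p ^ (4 * k + 2) * ((1 / h) * integral {0..h} ?g))"
    using assms by (intro mult_left_mono) (auto simp: cP)
  also have "h * (fact k * (e k * h ^ k))\<^sup>2 = h ^ (2 * k + 1) * (fact k * e k)\<^sup>2"
    by (simp add: power_mult_distrib mult_ac flip: power_mult)
  finally show ?thesis using assms by simp
qed

section \<open>Rayleigh quotients of real symmetric matrices\<close>

text \<open>Vectors are functions on the naturals, of which only the entries below n count. This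
  makes the product topology available for the compactness argument on the unit sphere.\<close>

definition quad_form :: "real Matrix.mat \<Rightarrow> nat \<Rightarrow> (nat \<Rightarrow> real) \<Rightarrow> real" where
  "quad_form A n x = (\<Sum>i<n. \<Sum>j<n. A $$ (i, j) * x i * x j)"

definition sq_norm :: "nat \<Rightarrow> (nat \<Rightarrow> real) \<Rightarrow> real" where
  "sq_norm n x = (\<Sum>i<n. (x i)\<^sup>2)"

text \<open>A closed subset of a product of compact intervals. Pinning the entries from n on to 0 is
  essential: infinitely many free coordinates would destroy compactness.\<close>

lemma compact_unit_sphere_fun:
  "compact {x :: nat \<Rightarrow> real. (\<forall>i\<ge>n. x i = 0) \<and> sq_norm n x = 1}"
proof -
  let ?B = "\<lambda>i. if i < n then {-1..1} else {0::real}"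
  let ?S = "{x :: nat \<Rightarrow> real. (\<forall>i\<ge>n. x i = 0) \<and> sq_norm n x = 1}"
  have "compactin (product_topology (\<lambda>i. euclidean) UNIV) (Pi\<^sub>E UNIV ?B)"
    by (subst compactin_PiE) auto
  then have 1: "compact (Pi\<^sub>E UNIV ?B)" by (simp add: euclidean_product_topology)
  have "closed {x :: nat \<Rightarrow> real. sq_norm n x = 1}"
    unfolding sq_norm_def by (intro closed_Collect_eq continuous_intros) auto
  then have 2: "compact (Pi\<^sub>E UNIV ?B \<inter> {x. sq_norm n x = 1})" using 1 by (rule compact_Int_closed[rotated])
  have "\<bar>x i\<bar> \<le> 1" if "sq_norm n x = 1" "i < n" for x i
  proof -
    have "(x i)\<^sup>2 \<le> sq_norm n x" unfolding sq_norm_def using that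
      by (intro member_le_sum) auto
    then show ?thesis using that by (simp add: abs_square_le_1)
  qed
  then have "?S = Pi\<^sub>E UNIV ?B \<inter> {x. sq_norm n x = 1}"
    by (auto simp: PiE_def Pi_def abs_le_iff split: if_splits)
  with 2 show ?thesis by simp
qed

lemma quad_form_scale: "quad_form A n (\<lambda>i. c * x i) = c\<^sup>2 * quad_form A n x"
  by (simp add: quad_form_def sum_distrib_left power2_eq_square mult_ac)

lemma sq_norm_scale: "sq_norm n (\<lambda>i. c * x i) = c\<^sup>2 * sq_norm n x"
  by (simp add: sq_norm_def sum_distrib_left power_mult_distrib)

lemma sq_norm_nonneg: "0 \<le> sq_norm n x"
  by (simp add: sq_norm_def sum_nonneg)

lemma sq_norm_pos: "0 < sq_norm n x \<longleftrightarrow> (\<exists>i<n. x i \<noteq> 0)"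
proof -
  have "sq_norm n x = 0 \<longleftrightarrow> (\<forall>i<n. x i = 0)"
    unfolding sq_norm_def by (subst sum_nonneg_eq_0_iff) auto
  then show ?thesis using sq_norm_nonneg[of n x] by (metis less_le)
qed

lemma eigenvalue_iff_fun:
  assumes "A \<in> carrier_mat n n"
  shows "eigenvalue A l \<longleftrightarrow> (\<exists>x. (\<exists>i<n. x i \<noteq> 0) \<and> (\<forall>i<n. (\<Sum>j<n. A $$ (i, j) * x j) = l * x i))"
proof
  assume "eigenvalue A l"
  then obtain v where v: "v \<in> carrier_vec n" "v \<noteq> 0\<^sub>v n" "A *\<^sub>v v = l \<cdot>\<^sub>v v"
    using assms by (auto simp: eigenvalue_def eigenvector_def)
  have "\<exists>i<n. vec_index v i \<noteq> 0" using v by (auto intro: eq_vecI)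
  moreover have "(\<Sum>j<n. A $$ (i, j) * (vec_index v j)) = l * (vec_index v i)" if "i < n" for i
  proof -
    have "vec_index (A *\<^sub>v v) i = (\<Sum>j<n. A $$ (i, j) * (vec_index v j))"
      using assms v(1) that by (simp add: scalar_prod_def lessThan_atLeast0)
    then show ?thesis using v(1) that unfolding v(3) by simp
  qed
  ultimately show "\<exists>x. (\<exists>i<n. x i \<noteq> 0) \<and> (\<forall>i<n. (\<Sum>j<n. A $$ (i, j) * x j) = l * x i)" by blast
next
  assume "\<exists>x. (\<exists>i<n. x i \<noteq> 0) \<and> (\<forall>i<n. (\<Sum>j<n. A $$ (i, j) * x j) = l * x i)"
  then obtain x where x: "\<exists>i<n. x i \<noteq> 0" "\<forall>i<n. (\<Sum>j<n. A $$ (i, j) * x j) = l * x i" by blast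
  have "Matrix.vec n x \<noteq> 0\<^sub>v n" using x(1) by (metis index_vec index_zero_vec(1))
  moreover have "A *\<^sub>v Matrix.vec n x = l \<cdot>\<^sub>v Matrix.vec n x"
    using x assms by (intro eq_vecI) (auto simp: scalar_prod_def lessThan_atLeast0)
  ultimately show "eigenvalue A l"
    using assms by (auto simp: eigenvalue_def eigenvector_def intro!: exI[of _ "Matrix.vec n x"])
qed

lemma eigenvalue_quad_form:
  assumes "A \<in> carrier_mat n n" "eigenvalue A l"
  shows "\<exists>x. sq_norm n x > 0 \<and> quad_form A n x = l * sq_norm n x"
proof -
  obtain x where x: "\<exists>i<n. x i \<noteq> 0" "\<forall>i<n. (\<Sum>j<n. A $$ (i, j) * x j) = l * x i"
    using assms eigenvalue_iff_fun by blast
  have "quad_form A n x = (\<Sum>i<n. x i * (\<Sum>j<n. A $$ (i, j) * x j))"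
    by (simp add: quad_form_def sum_distrib_left mult_ac)
  also have "\<dots> = l * sq_norm n x"
    using x by (simp add: sq_norm_def sum_distrib_left power2_eq_square mult_ac)
  finally show ?thesis using x sq_norm_pos by blast
qed

text \<open>
  A maximizer \<open>x\<close> of the quadratic form on the sphere is an eigenvector: otherwise the form would
  grow when moving from \<open>x\<close> in the direction of the residual \<open>r = A x - l x\<close>.
\<close>

lemma symmetric_max_eigenvalue:
  assumes A: "A \<in> carrier_mat n n" and sym: "\<And>i j. i < n \<Longrightarrow> j < n \<Longrightarrow> A $$ (i, j) = A $$ (j, i)"
    and n: "n \<ge> 1"
  obtains l where "eigenvalue A l" "\<And>x. quad_form A n x \<le> l * sq_norm n x"
proof -
  let ?S = "{x :: nat \<Rightarrow> real. (\<forall>i\<ge>n. x i = 0) \<and> sq_norm n x = 1}"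
  have "sq_norm n (\<lambda>i. if i = 0 then 1 else 0) = 1"
    using n by (simp add: sq_norm_def if_distribR if_distrib[of "\<lambda>x. x ^ 2"] cong: if_cong)
  then have "(\<lambda>i. if i = 0 then 1 else 0) \<in> ?S" using n by simp
  then have "?S \<noteq> {}" by (intro notI) (simp only: empty_iff)
  moreover have "continuous_on ?S (quad_form A n)"
    unfolding quad_form_def[abs_def]
    by (intro continuous_intros continuous_on_subset[OF continuous_on_product_coordinates]) auto
  ultimately obtain x where x: "x \<in> ?S" "\<And>y. y \<in> ?S \<Longrightarrow> quad_form A n y \<le> quad_form A n x"
    using continuous_attains_sup[OF compact_unit_sphere_fun, of n "quad_form A n"] by auto
  define l where "l = quad_form A n x"
  \<comment> \<open>Both sides are homogeneous of degree two, so y is normalized; cutting it off at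
    n puts the result \<open>z\<close> into the compact set.\<close>
  have le: "quad_form A n y \<le> l * sq_norm n y" for y
  proof (cases "sq_norm n y > 0")
    case True
    define r where "r = sqrt (sq_norm n y)"
    have r: "r > 0" "r\<^sup>2 = sq_norm n y" using True by (auto simp: r_def)
    define z where "z = (\<lambda>i. if i < n then (1 / r) * y i else 0)"
    have qz: "quad_form A n z = (1 / r)\<^sup>2 * quad_form A n y"
      unfolding quad_form_scale[symmetric] by (simp add: quad_form_def z_def)
    have "sq_norm n z = (1 / r)\<^sup>2 * sq_norm n y"
      unfolding sq_norm_scale[symmetric] by (simp add: sq_norm_def z_def)
    then have "sq_norm n z = 1" using r True by (simp add: power_divide)
    then have "quad_form A n z \<le> l" using x(2)[of z] by (auto simp: z_def l_def)
    then show ?thesis using r True unfolding qz by (simp add: power_divide field_simps)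
  next
    case False
    then have "\<forall>i<n. y i = 0" using sq_norm_pos by blast
    then show ?thesis by (simp add: quad_form_def sq_norm_def)
  qed
  define r where "r = (\<lambda>i. (\<Sum>j<n. A $$ (i, j) * x j) - l * x i)"
  \<comment> \<open>The constant term vanishes because the value at the unit vector x is l. By
    symmetry the mixed terms agree, and the linear coefficient is twice the product of r with A x -
    l x = r.\<close>
  have expand: "quad_form A n (\<lambda>i. x i + t * r i) - l * sq_norm n (\<lambda>i. x i + t * r i)
      = 2 * t * sq_norm n r + t\<^sup>2 * (quad_form A n r - l * sq_norm n r)" for t
  proof -
    have *: "(\<Sum>i<n. \<Sum>j<n. A $$ (i, j) * x i * r j) = (\<Sum>i<n. \<Sum>j<n. A $$ (i, j) * r i * x j)"
      by (subst sum.swap) (auto intro!: sum.cong simp: sym mult_ac)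
    have q: "quad_form A n (\<lambda>i. x i + t * r i)
      = quad_form A n x + 2 * t * (\<Sum>i<n. \<Sum>j<n. A $$ (i, j) * r i * x j) + t\<^sup>2 * quad_form A n r"
    proof -
      have "quad_form A n (\<lambda>i. x i + t * r i) = (\<Sum>i<n. \<Sum>j<n. A $$ (i, j) * x i * x j
        + t * (A $$ (i, j) * x i * r j) + t * (A $$ (i, j) * r i * x j) + t\<^sup>2 * (A $$ (i, j) * r i * r j))"
        unfolding quad_form_def by (intro sum.cong refl) (simp add: algebra_simps power2_eq_square)
      then show ?thesis unfolding quad_form_def * by (simp add: sum.distrib sum_distrib_left[symmetric] *)
    qed
    have s: "sq_norm n (\<lambda>i. x i + t * r i) = sq_norm n x + 2 * t * (\<Sum>i<n. r i * x i) + t\<^sup>2 * sq_norm n r"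
    proof -
      have "sq_norm n (\<lambda>i. x i + t * r i) = (\<Sum>i<n. (x i)\<^sup>2 + 2 * t * (r i * x i) + t\<^sup>2 * (r i)\<^sup>2)"
        unfolding sq_norm_def by (intro sum.cong refl) (simp add: algebra_simps power2_eq_square)
      then show ?thesis by (simp add: sq_norm_def sum.distrib sum_distrib_left[symmetric])
    qed
    have rr: "(\<Sum>i<n. \<Sum>j<n. A $$ (i, j) * r i * x j) - l * (\<Sum>i<n. r i * x i) = sq_norm n r"
    proof -
      have "(\<Sum>j<n. A $$ (i, j) * r i * x j) - l * (r i * x i) = (r i)\<^sup>2" for i
      proof -
        have "(\<Sum>j<n. A $$ (i, j) * r i * x j) = r i * (r i + l * x i)"
        proof -
          have "(\<Sum>j<n. A $$ (i, j) * r i * x j) = r i * (\<Sum>j<n. A $$ (i, j) * x j)"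
            by (simp add: sum_distrib_left mult_ac)
          then show ?thesis by (simp add: r_def)
        qed
        then show ?thesis by (simp add: power2_eq_square algebra_simps)
      qed
      then show ?thesis
        by (simp add: sq_norm_def sum_distrib_left flip: sum_subtractf)
    qed
    have "quad_form A n x - l * sq_norm n x = 0" using x by (simp add: l_def)
    then show ?thesis unfolding q s rr[symmetric] by (simp add: algebra_simps)
  qed
  have "sq_norm n r = 0"
  proof (rule ccontr)
    assume "sq_norm n r \<noteq> 0"
    then have pos: "sq_norm n r > 0" using sq_norm_nonneg[of n r] by simp
    define c where "c = l * sq_norm n r - quad_form A n r"
    have c: "c \<ge> 0" using le[of r] by (simp add: c_def)
    \<comment> \<open>With this step length the quadratic loss t^2 c is at most t times
      \<open>sq_norm n r\<close>, half of the linear gain. The summand 1 keeps the denominator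
      positive when c = 0.\<close>
    define t where "t = sq_norm n r / (c + 1)"
    have t: "t > 0" using pos c by (simp add: t_def)
    have "2 * t * sq_norm n r - t\<^sup>2 * c \<le> 0"
      using expand[of t] le[of "\<lambda>i. x i + t * r i"] by (simp add: c_def algebra_simps)
    then have "t * (2 * sq_norm n r - t * c) \<le> 0" by (simp add: power2_eq_square algebra_simps)
    then have "2 * sq_norm n r \<le> t * c" using t by (simp add: mult_le_0_iff)
    also have "t * c \<le> t * (c + 1)" using t by simp
    also have "\<dots> = sq_norm n r" using c by (simp add: t_def)
    finally show False using pos by simp
  qed
  then have "\<forall>i<n. r i = 0" using sq_norm_pos[of n r] by auto
  then have "\<forall>i<n. (\<Sum>j<n. A $$ (i, j) * x j) = l * x i" by (simp add: r_def)
  moreover have "\<exists>i<n. x i \<noteq> 0" using x sq_norm_pos[of n x] by simp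
  ultimately have "eigenvalue A l" using eigenvalue_iff_fun[OF A] by blast
  then show thesis using le that by blast
qed

lemma symmetric_min_eigenvalue:
  assumes A: "A \<in> carrier_mat n n" and sym: "\<And>i j. i < n \<Longrightarrow> j < n \<Longrightarrow> A $$ (i, j) = A $$ (j, i)"
    and n: "n \<ge> 1"
  obtains l where "eigenvalue A l" "\<And>x. l * sq_norm n x \<le> quad_form A n x"
proof -
  have B: "- A \<in> carrier_mat n n" using A by simp
  have q: "quad_form (- A) n x = - quad_form A n x" for x
    using A by (simp add: quad_form_def sum_negf)
  obtain l where l: "eigenvalue (- A) l" "\<And>x. quad_form (- A) n x \<le> l * sq_norm n x"
    using symmetric_max_eigenvalue[OF B _ n] sym A by auto
  obtain x where x: "\<exists>i<n. x i \<noteq> 0" "\<forall>i<n. (\<Sum>j<n. (- A) $$ (i, j) * x j) = l * x i"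
    using l(1) eigenvalue_iff_fun[OF B] by blast
  have "\<forall>i<n. (\<Sum>j<n. A $$ (i, j) * x j) = (- l) * x i"
    using x(2) A by (simp add: sum_negf) (metis add.inverse_inverse)
  then have "eigenvalue A (- l)" using x(1) eigenvalue_iff_fun[OF A] by blast
  moreover have "(- l) * sq_norm n x \<le> quad_form A n x" for x using l(2)[of x] q[of x] by simp
  ultimately show thesis using that by blast
qed

text \<open>Each extreme eigenvalue of A is the Rayleigh quotient of an eigenvector, where the form
  inequalities compare it with the extreme eigenvalues of B: max A <= b max B and min B <= a min A.
  Definiteness is assumed for B alone; the second inequality carries it over to A.\<close>

lemma spectral_cond_le:
  assumes A: "A \<in> carrier_mat n n" and symA: "\<And>i j. i < n \<Longrightarrow> j < n \<Longrightarrow> A $$ (i, j) = A $$ (j, i)"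
    and B: "B \<in> carrier_mat n n" and symB: "\<And>i j. i < n \<Longrightarrow> j < n \<Longrightarrow> B $$ (i, j) = B $$ (j, i)"
    and n: "n \<ge> 1"
    and posB: "\<And>x. sq_norm n x > 0 \<Longrightarrow> quad_form B n x > 0"
    and lower: "\<And>x. quad_form B n x \<le> a * quad_form A n x"
    and upper: "\<And>x. quad_form A n x \<le> b * quad_form B n x"
    and a: "a > 0" and b: "b \<ge> 0"
  shows "spectral_cond A \<le> a * b * spectral_cond B"
proof -
  have fin: "finite {l. eigenvalue M l}" if "M \<in> carrier_mat n n" for M :: "real mat"
    using card_finite_spectrum[OF that] by (simp add: spectrum_def)
  define maxA where "maxA = Max {l. eigenvalue A l}"
  define minA where "minA = Min {l. eigenvalue A l}"
  define maxB where "maxB = Max {l. eigenvalue B l}"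
  define minB where "minB = Min {l. eigenvalue B l}"
  obtain lA where lA: "eigenvalue A lA" using symmetric_max_eigenvalue[OF A symA n] by blast
  have eA: "eigenvalue A maxA" "eigenvalue A minA"
    using Max_in[OF fin[OF A]] Min_in[OF fin[OF A]] lA by (auto simp: maxA_def minA_def)
  obtain lB where lB: "eigenvalue B lB" "\<And>x. quad_form B n x \<le> lB * sq_norm n x"
    using symmetric_max_eigenvalue[OF B symB n] by blast
  obtain mB where mB: "eigenvalue B mB" "\<And>x. mB * sq_norm n x \<le> quad_form B n x"
    using symmetric_min_eigenvalue[OF B symB n] by blast
  have eB: "eigenvalue B minB" using Min_in[OF fin[OF B]] lB by (auto simp: minB_def)
  have "lB \<le> maxB" "minB \<le> mB" using lB(1) mB(1) fin[OF B] by (auto simp: maxB_def minB_def)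
  then have maxB: "quad_form B n x \<le> maxB * sq_norm n x" and minB: "minB * sq_norm n x \<le> quad_form B n x" for x
    using lB(2)[of x] mB(2)[of x] sq_norm_nonneg[of n x]
    by (meson mult_right_mono order_trans)+
  obtain x where x: "sq_norm n x > 0" "quad_form B n x = minB * sq_norm n x"
    using eigenvalue_quad_form[OF B eB] by blast
  have minB_pos: "minB > 0" using posB[OF x(1)] x by (simp add: zero_less_mult_iff)
  obtain y where y: "sq_norm n y > 0" "quad_form A n y = maxA * sq_norm n y"
    using eigenvalue_quad_form[OF A eA(1)] by blast
  have "maxA * sq_norm n y \<le> b * (maxB * sq_norm n y)"
    using upper[of y] maxB[of y] b y by (metis mult_left_mono order_trans)
  then have 1: "maxA \<le> b * maxB" using y by simp
  obtain z where z: "sq_norm n z > 0" "quad_form A n z = minA * sq_norm n z"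
    using eigenvalue_quad_form[OF A eA(2)] by blast
  have "minB * sq_norm n z \<le> a * (minA * sq_norm n z)"
    using lower[of z] minB[of z] unfolding z(2) by (rule order_trans[rotated])
  then have "minB * sq_norm n z \<le> (a * minA) * sq_norm n z" by (simp only: mult.assoc)
  then have 2: "minB \<le> a * minA" using z(1) by (rule mult_right_le_imp_le)
  then have minA: "minA > 0" using minB_pos a by (smt (verit) mult_nonneg_nonpos)
  have maxB_nonneg: "maxB \<ge> 0"
    using maxB[of x] posB[OF x(1)] x(1) by (smt (verit) mult_nonpos_nonneg)
  have "maxA / minA \<le> (b * maxB) / minA" using 1 minA by (simp add: divide_right_mono)
  also have "\<dots> \<le> (b * maxB) / (minB / a)"
    using 2 minA minB_pos a b maxB_nonneg by (intro divide_left_mono) (auto simp: field_simps)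
  also have "\<dots> = a * b * (maxB / minB)" by simp
  finally show ?thesis
    unfolding spectral_cond_def maxA_def minA_def maxB_def minB_def .
qed

section \<open>Integration along a coordinate direction\<close>

text \<open>Fubini, after writing \<open>lborel\<close> as the image of a product measure and
  splitting off the factor n. Translation invariance of the inner integral allows the base points to
  lie at an arbitrary offset c, later that of the face.\<close>

lemma lborel_integral_hyperplane:
  fixes f :: "'a::euclidean_space \<Rightarrow> real"
  assumes n: "n \<in> Basis" and f: "integrable lborel f"
  shows "(LINT x|lborel. f x) = (LINT y|hyperplane_measure n c. LINT t|lborel. f (y + t *\<^sub>R n))"
proof -
  let ?I = "Basis - {n}"
  let ?P = "\<Pi>\<^sub>M b\<in>?I. (lborel :: real measure)"
  have B: "insert n ?I = (Basis :: 'a set)" using n by auto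
  interpret product_sigma_finite "\<lambda>_ :: 'a. lborel :: real measure"
    by (intro product_sigma_finite.intro) (rule sigma_finite_lborel)
  let ?S = "\<lambda>x :: 'a \<Rightarrow> real. \<Sum>b\<in>Basis. x b *\<^sub>R b"
  have f': "f \<in> borel_measurable borel" using f by auto
  have S: "?S \<in> measurable (\<Pi>\<^sub>M b\<in>Basis. (lborel :: real measure)) borel" by measurable
  have "(LINT x|lborel. f x) = (LINT x|(\<Pi>\<^sub>M b\<in>Basis. lborel). f (?S x))"
    by (subst lborel_eq) (rule integral_distr[OF S f'])
  also have "\<dots> = (LINT x|(\<Pi>\<^sub>M b\<in>insert n ?I. lborel). f (?S x))" by (simp only: B)
  also have "\<dots> = (LINT x|?P. LINT t|lborel. f (?S (x(n := t))))"
  proof (rule product_integral_insert)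
    show "integrable (\<Pi>\<^sub>M b\<in>insert n ?I. lborel) (\<lambda>x. f (?S x))"
      unfolding B using f by (subst (asm) lborel_eq) (simp add: integrable_distr_eq[OF S f'])
  qed auto
  also have "\<dots> = (LINT x|?P. LINT t|lborel. f (c *\<^sub>R n + (\<Sum>b\<in>?I. x b *\<^sub>R b) + t *\<^sub>R n))"
  proof (rule Bochner_Integration.integral_cong[OF refl])
    fix x :: "'a \<Rightarrow> real"
    have "?S (x(n := t)) = t *\<^sub>R n + (\<Sum>b\<in>?I. x b *\<^sub>R b)" for t
      using sum.remove[of Basis n "\<lambda>b. (x(n := t)) b *\<^sub>R b"] n by simp
    then have "(LINT t|lborel. f (?S (x(n := t)))) = (LINT t|lborel. f (t *\<^sub>R n + (\<Sum>b\<in>?I. x b *\<^sub>R b)))"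
      by simp
    also have "\<dots> = (LINT t|lborel. f ((c + 1 * t) *\<^sub>R n + (\<Sum>b\<in>?I. x b *\<^sub>R b)))"
      by (subst lborel_integral_real_affine[of 1 _ c]) auto
    also have "\<dots> = (LINT t|lborel. f (c *\<^sub>R n + (\<Sum>b\<in>?I. x b *\<^sub>R b) + t *\<^sub>R n))"
      by (simp add: algebra_simps)
    finally show "(LINT t|lborel. f (?S (x(n := t))))
      = (LINT t|lborel. f (c *\<^sub>R n + (\<Sum>b\<in>?I. x b *\<^sub>R b) + t *\<^sub>R n))" .
  qed
  also have "\<dots> = (LINT y|hyperplane_measure n c. LINT t|lborel. f (y + t *\<^sub>R n))"
  proof -
    have "(\<lambda>y. LINT t|lborel. f (y + t *\<^sub>R n)) \<in> borel_measurable borel"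
      by (intro lborel.borel_measurable_lebesgue_integral) (use f' in measurable)
    then show ?thesis unfolding hyperplane_measure_def
      by (subst integral_distr) auto
  qed
  finally show ?thesis .
qed

section \<open>The hyperplane measure and integration over slabs\<close>

lemma sets_hyperplane_measure [simp, measurable_cong]: "sets (hyperplane_measure n c) = sets borel"
  by (simp add: hyperplane_measure_def)

lemma space_hyperplane_measure [simp]: "space (hyperplane_measure n c) = UNIV"
  by (simp add: hyperplane_measure_def)

text \<open>The measure is formally one on the whole space. The condition defining
  \<open>slab\<close> speaks only of base points on the hyperplane, so identities derived from it
  are available almost everywhere.\<close>

lemma AE_hyperplane_measure:
  fixes n :: "'a::euclidean_space"
  assumes n: "n \<in> Basis"
  shows "AE y in hyperplane_measure n c. y \<bullet> n = c"
  unfolding hyperplane_measure_def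
proof (subst AE_distr_iff)
  show "AE y in \<Pi>\<^sub>M b\<in>Basis - {n}. lborel. (c *\<^sub>R n + (\<Sum>b\<in>Basis - {n}. y b *\<^sub>R b)) \<bullet> n = c"
    using n by (intro AE_I2) (auto simp: inner_add_left inner_sum_left inner_Basis)
qed (auto simp: closed_Collect_eq intro!: borel_closed continuous_intros)

text \<open>The preimage of a compact set in the tangential coordinates lies in a cube [-R, R]^(d -
  1). For d = 1 this is the empty product, of measure 1.\<close>

lemma emeasure_hyperplane_compact:
  fixes n :: "'a::euclidean_space"
  assumes n: "n \<in> Basis" and K: "compact K"
  shows "emeasure (hyperplane_measure n c) K < \<infinity>"
proof -
  let ?I = "Basis - {n}"
  let ?P = "\<Pi>\<^sub>M b\<in>?I. (lborel :: real measure)"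
  let ?g = "\<lambda>y. c *\<^sub>R n + (\<Sum>b\<in>?I. y b *\<^sub>R b)"
  interpret product_sigma_finite "\<lambda>_ :: 'a. lborel :: real measure"
    by (intro product_sigma_finite.intro) (rule sigma_finite_lborel)
  obtain R where R: "\<And>x. x \<in> K \<Longrightarrow> norm x \<le> R"
    using compact_imp_bounded[OF K] by (auto simp: bounded_iff)
  have "emeasure (hyperplane_measure n c) K = emeasure ?P (?g -` K \<inter> space ?P)"
    unfolding hyperplane_measure_def using K by (intro emeasure_distr) (auto intro: borel_closed compact_imp_closed)
  also have "\<dots> \<le> emeasure ?P (Pi\<^sub>E ?I (\<lambda>_. {-R..R}))"
  proof (rule emeasure_mono)
    have "y b \<in> {-R..R}" if "b \<in> ?I" "?g y \<in> K" for y b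
    proof -
      have "?g y \<bullet> b = y b"
        using that n by (auto simp: inner_add_left inner_sum_left inner_Basis if_distrib cong: if_cong)
      then have "\<bar>y b\<bar> \<le> norm (?g y)" using Basis_le_norm[of b "?g y"] that by simp
      also have "\<dots> \<le> R" using R that by blast
      finally show ?thesis by auto
    qed
    then show "?g -` K \<inter> space ?P \<subseteq> Pi\<^sub>E ?I (\<lambda>_. {-R..R})"
      by (auto simp: space_PiM PiE_def Pi_def)
  qed (auto intro!: sets_PiM_I_finite)
  also have "\<dots> = (\<Prod>b\<in>?I. emeasure lborel {-R..R})"
    by (intro emeasure_PiM) auto
  also have "\<dots> < \<infinity>"
    using emeasure_lborel_cbox_finite[of "- R" R] by (simp add: cbox_interval power_less_top_ennreal)
  finally show ?thesis .
qed

lemma set_integrable_hyperplane_compact: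
  fixes n :: "'a::euclidean_space" and g :: "'a \<Rightarrow> real"
  assumes n: "n \<in> Basis" and K: "compact K" and g: "continuous_on UNIV g"
  shows "set_integrable (hyperplane_measure n c) K g"
proof -
  have "bounded (g ` K)"
    using K g by (intro compact_imp_bounded compact_continuous_image) (auto intro: continuous_on_subset)
  then obtain R where R: "\<And>x. x \<in> K \<Longrightarrow> norm (g x) \<le> R" by (auto simp: bounded_iff)
  have gm: "g \<in> borel_measurable borel" using g by (rule borel_measurable_continuous_onI)
  have Km: "K \<in> sets borel" using K by (intro borel_closed compact_imp_closed)
  show ?thesis unfolding set_integrable_def
  proof (rule integrableI_bounded_set[where A = K and B = R])
    show "(\<lambda>x. indicat_real K x *\<^sub>R g x) \<in> borel_measurable (hyperplane_measure n c)"
      using gm Km by measurable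
  qed (use Km R emeasure_hyperplane_compact[OF n K] in auto)
qed

lemma set_integrable_lborel_compact:
  fixes g :: "'a::euclidean_space \<Rightarrow> real"
  assumes "compact K" "continuous_on K g"
  shows "set_integrable lborel K g"
  using borel_integrable_compact[OF assms] unfolding set_integrable_def
  by (rule back_subst[where P = "integrable lborel"]) (auto simp: indicator_def)

text \<open>
  \<open>T\<close> is the slab of thickness \<open>h\<close> over the face \<open>F \<subseteq> {y. y \<bullet> n = c}\<close>, extending from \<open>F\<close> in
  direction \<open>\<sigma> *\<^sub>R n\<close> with \<open>\<sigma> = 1\<close> or \<open>\<sigma> = -1\<close>.
\<close>

definition slab :: "'a::euclidean_space \<Rightarrow> real \<Rightarrow> real \<Rightarrow> real \<Rightarrow> 'a set \<Rightarrow> 'a set \<Rightarrow> bool" where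
  "slab n c h \<sigma> F T \<longleftrightarrow> n \<in> Basis \<and> \<bar>\<sigma>\<bar> = 1 \<and> compact F \<and> compact T \<and> (\<forall>y\<in>F. y \<bullet> n = c) \<and>
     (\<forall>y t. y \<bullet> n = c \<longrightarrow> (y + (\<sigma> * t) *\<^sub>R n \<in> T \<longleftrightarrow> y \<in> F \<and> 0 \<le> t \<and> t \<le> h))"

lemma slab_integral:
  fixes f :: "'a::euclidean_space \<Rightarrow> real"
  assumes s: "slab n c h \<sigma> F T" and f: "continuous_on UNIV f"
  shows "(LINT x:T|lborel. f x)
    = (LINT y:F|hyperplane_measure n c. integral {0..h} (\<lambda>t. f (y + (\<sigma> * t) *\<^sub>R n)))"
proof -
  have n: "n \<in> Basis" and \<sigma>: "\<bar>\<sigma>\<bar> = 1" and cF: "compact F" and cT: "compact T"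
    and T: "\<And>y t. y \<bullet> n = c \<Longrightarrow> y + (\<sigma> * t) *\<^sub>R n \<in> T \<longleftrightarrow> y \<in> F \<and> 0 \<le> t \<and> t \<le> h"
    using s by (auto simp: slab_def)
  define g where "g = (\<lambda>x. indicat_real T x *\<^sub>R f x)"
  have g: "integrable lborel g"
    using set_integrable_lborel_compact[OF cT] f by (auto simp: g_def set_integrable_def intro: continuous_on_subset)
  then have gm: "g \<in> borel_measurable borel" by auto
  have fm: "f \<in> borel_measurable borel" using f by (rule borel_measurable_continuous_onI)
  have Fm: "F \<in> sets borel" using cF by (intro borel_closed compact_imp_closed)
  have "(LINT x:T|lborel. f x) = (LINT y|hyperplane_measure n c. LINT t|lborel. g (y + t *\<^sub>R n))"
    unfolding set_lebesgue_integral_def using lborel_integral_hyperplane[OF n g] by (simp add: g_def)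
  also have "\<dots> = (LINT y|hyperplane_measure n c. indicat_real F y *\<^sub>R (LINT t:{0..h}|lborel. f (y + (\<sigma> * t) *\<^sub>R n)))"
  proof (rule integral_cong_AE)
    show "AE y in hyperplane_measure n c. (LINT t|lborel. g (y + t *\<^sub>R n))
      = indicat_real F y *\<^sub>R (LINT t:{0..h}|lborel. f (y + (\<sigma> * t) *\<^sub>R n))"
      using AE_hyperplane_measure[OF n, of c]
    proof eventually_elim
      case (elim y)
      \<comment> \<open>Substituting \<sigma> t for t, with Jacobian 1, lets the parameter run over
        [0, h] on either side of the face.\<close>
      have "(LINT t|lborel. g (y + t *\<^sub>R n)) = \<bar>\<sigma>\<bar> *\<^sub>R (LINT t|lborel. g (y + (0 + \<sigma> * t) *\<^sub>R n))"
        using \<sigma> by (intro lborel_integral_real_affine) auto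
      also have "\<dots> = (LINT t|lborel. indicat_real F y *\<^sub>R (indicator {0..h} t *\<^sub>R f (y + (\<sigma> * t) *\<^sub>R n)))"
        using \<sigma> by (simp add: g_def indicator_def T[OF elim] cong: Bochner_Integration.integral_cong)
      also have "\<dots> = indicat_real F y *\<^sub>R (LINT t:{0..h}|lborel. f (y + (\<sigma> * t) *\<^sub>R n))"
        unfolding set_lebesgue_integral_def by simp
      finally show ?case .
    qed
    show "(\<lambda>y. LINT t|lborel. g (y + t *\<^sub>R n)) \<in> borel_measurable (hyperplane_measure n c)"
      by (intro lborel.borel_measurable_lebesgue_integral) (use gm in measurable)
    have "(\<lambda>y. LINT t|lborel. indicator {0..h} t *\<^sub>R f (y + (\<sigma> * t) *\<^sub>R n)) \<in> borel_measurable (hyperplane_measure n c)"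
      by (intro lborel.borel_measurable_lebesgue_integral) (use fm in measurable)
    then show "(\<lambda>y. indicat_real F y *\<^sub>R (LINT t:{0..h}|lborel. f (y + (\<sigma> * t) *\<^sub>R n)))
      \<in> borel_measurable (hyperplane_measure n c)"
      unfolding set_lebesgue_integral_def using Fm by measurable
  qed
  also have "\<dots> = (LINT y:F|hyperplane_measure n c. integral {0..h} (\<lambda>t. f (y + (\<sigma> * t) *\<^sub>R n)))"
  proof -
    have "(LINT t:{0..h}|lborel. f (y + (\<sigma> * t) *\<^sub>R n)) = integral {0..h} (\<lambda>t. f (y + (\<sigma> * t) *\<^sub>R n))" for y
    proof (rule set_borel_integral_eq_integral(2), rule set_integrable_lborel_compact)
      have "continuous_on UNIV (f \<circ> (\<lambda>t. y + (\<sigma> * t) *\<^sub>R n))"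
        by (intro continuous_on_compose continuous_intros) (auto intro: continuous_on_subset[OF f])
      then show "continuous_on {0..h} (\<lambda>t. f (y + (\<sigma> * t) *\<^sub>R n))"
        by (auto simp: o_def intro: continuous_on_subset)
    qed simp
    then show ?thesis by (simp add: set_lebesgue_integral_def)
  qed
  finally show ?thesis .
qed

section \<open>Geometry of the Cartesian grid\<close>

lemma mem_hypercube:
  "x \<in> hypercube h a \<longleftrightarrow> (\<forall>b\<in>Basis. a \<bullet> b \<le> x \<bullet> b \<and> x \<bullet> b \<le> a \<bullet> b + h)"
  by (simp add: hypercube_def mem_box inner_add_left)

lemma compact_hypercube: "compact (hypercube h a)"
  by (simp add: hypercube_def)

lemma mem_hypercube_direction:
  assumes "n \<in> Basis"
  shows "x \<in> hypercube h a \<longleftrightarrow> (\<forall>b\<in>Basis - {n}. a \<bullet> b \<le> x \<bullet> b \<and> x \<bullet> b \<le> a \<bullet> b + h) \<and>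
    a \<bullet> n \<le> x \<bullet> n \<and> x \<bullet> n \<le> a \<bullet> n + h"
  using assms by (auto simp: mem_hypercube)

text \<open>The cube with corner \<open>a1\<close> lies beyond the other one in direction \<sigma>
  n. The common face is thus the upper side of the cube at \<open>a2\<close> for \<sigma> = 1 and
  its lower side for \<sigma> = -1, which is what c encodes.\<close>

lemma adjacent_hypercubes:
  fixes a1 a2 n :: "'a::euclidean_space"
  assumes n: "n \<in> Basis" and h: "h > 0" and \<sigma>: "\<bar>\<sigma>\<bar> = 1" and a1: "a1 = a2 + (\<sigma> * h) *\<^sub>R n"
    and c: "c = a2 \<bullet> n + (if \<sigma> = 1 then h else 0)" and F: "F = hypercube h a1 \<inter> hypercube h a2"
  shows "slab n c h \<sigma> F (hypercube h a1)" "slab n c h (- \<sigma>) F (hypercube h a2)"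
    "face_normal F = n" "face_offset F = c"
proof -
  \<comment> \<open>The tangential constraints; they coincide for both cubes and are unaffected by
    moving along n.\<close>
  define E where "E = (\<lambda>x. \<forall>b\<in>Basis - {n}. a2 \<bullet> b \<le> x \<bullet> b \<and> x \<bullet> b \<le> a2 \<bullet> b + h)"
  have \<sigma>': "\<sigma> = 1 \<or> \<sigma> = -1" using \<sigma> by linarith
  have T2: "x \<in> hypercube h a2 \<longleftrightarrow> E x \<and> a2 \<bullet> n \<le> x \<bullet> n \<and> x \<bullet> n \<le> a2 \<bullet> n + h" for x
    unfolding mem_hypercube_direction[OF n] E_def by simp
  have "a1 \<bullet> b = a2 \<bullet> b" if "b \<in> Basis - {n}" for b
    using that n by (auto simp: a1 inner_add_left inner_Basis)
  moreover have a1n: "a1 \<bullet> n = a2 \<bullet> n + \<sigma> * h" using n by (simp add: a1 inner_add_left inner_Basis)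
  ultimately have T1: "x \<in> hypercube h a1 \<longleftrightarrow> E x \<and> a2 \<bullet> n + \<sigma> * h \<le> x \<bullet> n \<and> x \<bullet> n \<le> a2 \<bullet> n + \<sigma> * h + h" for x
    unfolding mem_hypercube_direction[OF n] E_def by simp
  have Fx: "x \<in> F \<longleftrightarrow> E x \<and> x \<bullet> n = c" for x
    using \<sigma>' h by (auto simp: F T1 T2 c)
  have E: "E (y + t *\<^sub>R n) \<longleftrightarrow> E y" for y t
    using n by (auto simp: E_def inner_add_left inner_Basis)
  have yn: "(y + t *\<^sub>R n) \<bullet> n = y \<bullet> n + t" for y t using n by (simp add: inner_add_left)
  have E': "E (y - t *\<^sub>R n) \<longleftrightarrow> E y" and yn': "(y - t *\<^sub>R n) \<bullet> n = y \<bullet> n - t" for y t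
    using E[of y "- t"] yn[of y "- t"] by simp_all
  have cF: "compact F" unfolding F by (intro compact_Int compact_hypercube)
  show "slab n c h \<sigma> F (hypercube h a1)" "slab n c h (- \<sigma>) F (hypercube h a2)"
    unfolding slab_def using n \<sigma> cF \<sigma>' h by (auto simp: compact_hypercube Fx T1 T2 E yn E' yn' c)
  define x0 where "x0 = a2 + (c - a2 \<bullet> n) *\<^sub>R n"
  have "E a2" using h by (simp add: E_def)
  then have x0: "x0 \<in> F" by (simp add: Fx x0_def E yn)
  \<comment> \<open>The face has extent h in every tangential direction: moving \<open>x0\<close> by
    h along another basis vector m stays in F but changes the inner product with m.\<close>
  have uniq: "m = n" if m: "m \<in> Basis" "F \<subseteq> {x. m \<bullet> x = c'}" for m c'
  proof (rule ccontr)
    assume "m \<noteq> n"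
    have "E (a2 + h *\<^sub>R m)"
      using m h by (auto simp: E_def inner_add_left inner_Basis)
    then have "x0 + h *\<^sub>R m \<in> F"
      using n m \<open>m \<noteq> n\<close> E[of "a2 + h *\<^sub>R m" "c - a2 \<bullet> n"] yn[of a2 "c - a2 \<bullet> n"]
      by (simp add: Fx x0_def inner_add_left inner_Basis add_ac)
    then have "m \<bullet> (x0 + h *\<^sub>R m) = c'" "m \<bullet> x0 = c'" using m x0 by blast+
    then show False using h m by (simp add: inner_add_right)
  qed
  have Fn: "F \<subseteq> {x. n \<bullet> x = c}" by (auto simp: Fx inner_commute)
  show fn: "face_normal F = n"
    unfolding face_normal_def
  proof (rule the_equality)
    show "n \<in> Basis \<and> (\<exists>c. F \<subseteq> {x. n \<bullet> x = c})" using n Fn by blast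
    show "m = n" if "m \<in> Basis \<and> (\<exists>c. F \<subseteq> {x. m \<bullet> x = c})" for m using that uniq by blast
  qed
  show "face_offset F = c"
    unfolding face_offset_def fn by (rule the_equality) (use Fn x0 in blast)+
qed

lemma aff_dim_hypercube: "h > 0 \<Longrightarrow> aff_dim (hypercube h (a :: 'a::euclidean_space)) = int DIM('a)"
  unfolding hypercube_def
  by (rule aff_dim_nonempty_interior) (simp add: interior_cbox box_ne_empty inner_add_left)

lemma share_face_not_refl: "share_face S T \<Longrightarrow> S \<noteq> T"
  by (auto simp: share_face_def facet_of_def)

definition grid_corner :: "real \<Rightarrow> 'a::euclidean_space \<Rightarrow> ('a \<Rightarrow> int) \<Rightarrow> 'a" where
  "grid_corner h a z = a + (\<Sum>b\<in>Basis. (h * of_int (z b)) *\<^sub>R b)"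

lemma inner_grid_corner:
  assumes "b \<in> Basis"
  shows "grid_corner h a z \<bullet> b = a \<bullet> b + h * of_int (z b)"
  using assms by (simp add: grid_corner_def inner_add_left inner_sum_left inner_Basis if_distrib cong: if_cong)

lemma cartesian_gridE:
  assumes "T \<in> cartesian_grid h a"
  obtains z where "T = hypercube h (grid_corner h a z)"
  using assms by (auto simp: cartesian_grid_def grid_corner_def)

lemma grid_meet:
  assumes "x \<in> hypercube h (grid_corner h a z)" "x \<in> hypercube h (grid_corner h a z')" "h > 0" "b \<in> Basis"
  shows "\<bar>z' b - z b\<bar> \<le> 1"
proof -
  have "h * of_int (z b) \<le> h * of_int (z' b) + h" "h * of_int (z' b) \<le> h * of_int (z b) + h"
    using assms(1,2)[unfolded mem_hypercube, THEN bspec, OF assms(4)]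
    unfolding inner_grid_corner[OF assms(4)] by linarith+
  then have "h * of_int (z b) \<le> h * of_int (z' b + 1)" "h * of_int (z' b) \<le> h * of_int (z b + 1)"
    by (simp_all add: algebra_simps)
  then show ?thesis using assms(3) by (simp only: mult_le_cancel_left_pos of_int_le_iff)
qed

lemma grid_meet_neq:
  fixes x :: "'a::euclidean_space"
  assumes "x \<in> hypercube h (grid_corner h a z)" "x \<in> hypercube h (grid_corner h a z')" "h > 0" "b \<in> Basis"
    and "z b \<noteq> z' b"
  shows "b \<bullet> x = a \<bullet> b + h * of_int (max (z b) (z' b))"
proof -
  have z: "z' b = z b + 1 \<or> z b = z' b + 1" using grid_meet[OF assms(1-4)] assms(5) by linarith
  show ?thesis
    using assms(1,2)[unfolded mem_hypercube, THEN bspec, OF assms(4)] z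
    unfolding inner_grid_corner[OF assms(4)] inner_commute[of b]
    by (auto simp: max_def algebra_simps)
qed

lemma aff_dim_two_hyperplanes:
  fixes b b' :: "'a::euclidean_space"
  assumes "b \<in> Basis" "b' \<in> Basis" "b \<noteq> b'" "S \<subseteq> {x. b \<bullet> x = c} \<inter> {x. b' \<bullet> x = c'}"
  shows "aff_dim S \<le> int DIM('a) - 2"
proof -
  let ?H = "{x. b \<bullet> x = c}"
  have "c *\<^sub>R b + (c' + 1) *\<^sub>R b' \<in> ?H" using assms by (simp add: inner_add_right inner_Basis)
  moreover have "c *\<^sub>R b + (c' + 1) *\<^sub>R b' \<notin> {x. b' \<bullet> x = c'}" using assms by (simp add: inner_add_right inner_Basis)
  ultimately have "\<not> ?H \<subseteq> {x. b' \<bullet> x = c'}" by blast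
  moreover have "b \<noteq> 0" using assms by auto
  ultimately have "aff_dim (?H \<inter> {x. b' \<bullet> x = c'}) \<le> int DIM('a) - 2"
    using aff_dim_affine_Int_hyperplane[of ?H b' c'] aff_dim_hyperplane[of b c] affine_hyperplane[of b c]
    by (auto split: if_splits)
  then show ?thesis using aff_dim_subset[OF assms(4)] by linarith
qed

text \<open>\<open>share_face\<close> is an abstract facet condition, so its content is extracted by
  dimension. The intersection has dimension d - 1; indices differing in two directions would confine
  it to two orthogonal hyperplanes, hence to dimension d - 2, and equal indices would make the cubes
  equal. The corners therefore differ by h in exactly one direction.\<close>

lemma share_face_grid:
  fixes T1 T2 :: "'a::euclidean_space set"
  assumes "T1 \<in> cartesian_grid h a" "T2 \<in> cartesian_grid h a" and h: "h > 0" and sf: "share_face T1 T2"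
  obtains n c \<sigma> where "slab n c h \<sigma> (T1 \<inter> T2) T1" "slab n c h (- \<sigma>) (T1 \<inter> T2) T2"
    "face_normal (T1 \<inter> T2) = n" "face_offset (T1 \<inter> T2) = c"
proof -
  obtain z1 z2 where T: "T1 = hypercube h (grid_corner h a z1)" "T2 = hypercube h (grid_corner h a z2)"
    using assms cartesian_gridE by metis
  have ne: "T1 \<inter> T2 \<noteq> {}" and dim: "aff_dim (T1 \<inter> T2) = int DIM('a) - 1"
    using sf aff_dim_hypercube[OF h] by (auto simp: share_face_def facet_of_def T)
  then obtain x where x: "x \<in> T1" "x \<in> T2" by blast
  have "\<exists>n\<in>Basis. z1 n \<noteq> z2 n"
  proof (rule ccontr)
    assume "\<not> ?thesis"
    then have "T1 = T2" by (simp add: T grid_corner_def)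
    then show False using share_face_not_refl[OF sf] by blast
  qed
  then obtain n where n: "n \<in> Basis" "z1 n \<noteq> z2 n" by blast
  have eq: "z1 b = z2 b" if "b \<in> Basis" "b \<noteq> n" for b
  proof (rule ccontr)
    assume "z1 b \<noteq> z2 b"
    then have sub: "T1 \<inter> T2 \<subseteq> {x. n \<bullet> x = a \<bullet> n + h * of_int (max (z1 n) (z2 n))} \<inter>
        {x. b \<bullet> x = a \<bullet> b + h * of_int (max (z1 b) (z2 b))}"
      using grid_meet_neq n that h unfolding T by blast
    then show False using aff_dim_two_hyperplanes[OF n(1) that(1) _ sub] that(2) dim by simp
  qed
  define \<sigma> where "\<sigma> = real_of_int (z1 n - z2 n)"
  have "\<bar>z2 n - z1 n\<bar> = 1" using grid_meet[OF x[unfolded T] h n(1)] n by linarith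
  then have \<sigma>: "\<bar>\<sigma>\<bar> = 1" unfolding \<sigma>_def by linarith
  have corner: "grid_corner h a z1 = grid_corner h a z2 + (\<sigma> * h) *\<^sub>R n"
  proof (rule euclidean_eqI)
    fix b :: 'a assume b: "b \<in> Basis"
    then show "grid_corner h a z1 \<bullet> b = (grid_corner h a z2 + (\<sigma> * h) *\<^sub>R n) \<bullet> b"
      using n eq[of b] by (cases "b = n") (auto simp: inner_grid_corner inner_add_left inner_Basis \<sigma>_def algebra_simps)
  qed
  show thesis
    by (rule that) (rule adjacent_hypercubes[OF n(1) h \<sigma> corner refl refl, folded T])+
qed

text \<open>Cubes that meet T are indexed by offsets -1, 0, 1 in each direction; offset 0 throughout
  is T itself.\<close>

lemma card_grid_neighbours:
  fixes T :: "'a::euclidean_space set"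
  assumes "\<T> \<subseteq> cartesian_grid h a" "T \<in> cartesian_grid h a" "h > 0"
  shows "finite {T'\<in>\<T>. T' \<inter> T \<noteq> {}}" "card {T'\<in>\<T>. T' \<inter> T \<noteq> {}} \<le> 3 ^ DIM('a)"
proof -
  obtain z where z: "T = hypercube h (grid_corner h a z)" using cartesian_gridE[OF assms(2)] .
  let ?D = "(Basis :: 'a set) \<rightarrow>\<^sub>E {-1..1::int}"
  let ?f = "\<lambda>d. hypercube h (grid_corner h a (\<lambda>b. z b + d b))"
  have sub: "{T'\<in>\<T>. T' \<inter> T \<noteq> {}} \<subseteq> ?f ` ?D"
  proof
    fix T' assume T': "T' \<in> {T'\<in>\<T>. T' \<inter> T \<noteq> {}}"
    then obtain z' where z': "T' = hypercube h (grid_corner h a z')" using assms(1) cartesian_gridE by blast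
    obtain x where x: "x \<in> T" "x \<in> T'" using T' by blast
    let ?d = "\<lambda>b\<in>Basis. z' b - z b"
    have "\<bar>z' b - z b\<bar> \<le> 1" if "b \<in> Basis" for b
      using grid_meet[OF x[unfolded z z'] assms(3) that] .
    then have "?d \<in> ?D" by (fastforce simp: abs_le_iff)
    moreover have "T' = ?f ?d" unfolding z' grid_corner_def by (simp cong: sum.cong)
    ultimately show "T' \<in> ?f ` ?D" by blast
  qed
  have fin: "finite ?D" by (intro finite_PiE) auto
  then show "finite {T'\<in>\<T>. T' \<inter> T \<noteq> {}}" using sub finite_subset by blast
  have "card {T'\<in>\<T>. T' \<inter> T \<noteq> {}} \<le> card ?D"
    by (rule surj_card_le[OF fin sub])
  also have "\<dots> = 3 ^ DIM('a)" by (simp add: card_PiE)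
  finally show "card {T'\<in>\<T>. T' \<inter> T \<noteq> {}} \<le> 3 ^ DIM('a)" .
qed

text \<open>A connected set that meets \<Omega> but not its frontier cannot leave \<Omega>.\<close>

lemma uncut_subset:
  assumes "background_mesh \<Omega> h \<T>" "T \<in> \<T> - cut_elements \<Omega> \<T>"
  shows "T \<subseteq> \<Omega>"
proof -
  have "connected T"
    using assms by (auto simp: background_mesh_def cartesian_grid_def hypercube_def convex_connected subset_iff)
  moreover have "T \<inter> \<Omega> \<noteq> {}" "T \<inter> frontier \<Omega> = {}"
    using assms by (auto simp: background_mesh_def cut_elements_def)
  ultimately show ?thesis using connected_Int_frontier[of T \<Omega>] by blast
qed

section \<open>Jumps and face estimates\<close>

lemma has_integral_power_0:
  assumes "0 \<le> h"
  shows "((\<lambda>t::real. t ^ m) has_integral h ^ Suc m / real (Suc m)) {0..h}"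
proof -
  have "((\<lambda>t::real. t ^ m) has_integral (h ^ Suc m / real (Suc m) - 0 ^ Suc m / real (Suc m))) {0..h}"
  proof (rule fundamental_theorem_of_calculus[OF assms])
    fix t :: real
    have "((\<lambda>t. t ^ Suc m / real (Suc m)) has_field_derivative t ^ m) (at t within {0..h})"
      using DERIV_cdivide[OF DERIV_pow[of "Suc m" t "{0..h}"], of "real (Suc m)"] by simp
    then show "((\<lambda>t. t ^ Suc m / real (Suc m)) has_vector_derivative t ^ m) (at t within {0..h})"
      by (simp only: has_real_derivative_iff_has_vector_derivative)
  qed
  then show ?thesis by simp
qed

text \<open>As a quadratic form in the coefficients the integral visibly depends continuously on
  them; this gives \<open>continuous_integral_square\<close> and with it integrability over
  faces.\<close>

lemma integral_square_expansion:
  assumes "0 \<le> h"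
  shows "integral {0..h} (\<lambda>t. (\<Sum>k\<le>p. a k * t ^ k)\<^sup>2)
    = (\<Sum>i\<le>p. \<Sum>j\<le>p. a i * a j * (h ^ Suc (i + j) / real (Suc (i + j))))"
proof (rule integral_unique)
  have "((\<lambda>t. \<Sum>i\<le>p. \<Sum>j\<le>p. a i * a j * t ^ (i + j)) has_integral
    (\<Sum>i\<le>p. \<Sum>j\<le>p. a i * a j * (h ^ Suc (i + j) / real (Suc (i + j))))) {0..h}"
    by (intro has_integral_sum has_integral_mult_right has_integral_power_0 assms) auto
  moreover have "(\<Sum>k\<le>p. a k * t ^ k)\<^sup>2 = (\<Sum>i\<le>p. \<Sum>j\<le>p. a i * a j * t ^ (i + j))" for t
    by (simp add: power2_eq_square sum_product power_add mult_ac)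
  ultimately show "((\<lambda>t. (\<Sum>k\<le>p. a k * t ^ k)\<^sup>2) has_integral
    (\<Sum>i\<le>p. \<Sum>j\<le>p. a i * a j * (h ^ Suc (i + j) / real (Suc (i + j))))) {0..h}"
    by simp
qed

text \<open>Pointwise Cauchy-Schwarz with the factors sqrt (w k), followed by integration of t^(2k).
  The assumption \<open>a 0 = 0\<close> starts the sum at 1, where the weights begin; it will come
  from the continuity of the finite element function.\<close>

lemma integral_square_weighted_bound:
  assumes h: "0 \<le> h" and w: "\<And>k. k \<in> {1..p} \<Longrightarrow> 0 < w k" and a0: "a 0 = 0"
  shows "integral {0..h} (\<lambda>t. (\<Sum>k\<le>p. a k * t ^ k)\<^sup>2)
    \<le> (\<Sum>k=1..p. 1 / w k) * (\<Sum>k=1..p. w k * (h ^ (2 * k + 1) / real (2 * k + 1)) * (a k)\<^sup>2)"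
proof -
  have "((\<lambda>t. \<Sum>k=1..p. w k * (a k)\<^sup>2 * t ^ (2 * k)) has_integral
    (\<Sum>k=1..p. w k * (a k)\<^sup>2 * (h ^ Suc (2 * k) / real (Suc (2 * k))))) {0..h}"
    by (intro has_integral_sum has_integral_mult_right has_integral_power_0 h) auto
  then have I: "((\<lambda>t. (\<Sum>k=1..p. 1 / w k) * (\<Sum>k=1..p. w k * (a k)\<^sup>2 * t ^ (2 * k))) has_integral
    (\<Sum>k=1..p. 1 / w k) * (\<Sum>k=1..p. w k * (h ^ (2 * k + 1) / real (2 * k + 1)) * (a k)\<^sup>2)) {0..h}"
    by (intro has_integral_mult_right) (simp add: mult_ac)
  have "(\<Sum>k\<le>p. a k * t ^ k)\<^sup>2 \<le> (\<Sum>k=1..p. 1 / w k) * (\<Sum>k=1..p. w k * (a k)\<^sup>2 * t ^ (2 * k))" for t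
  proof -
    have "(\<Sum>k\<le>p. a k * t ^ k) = (\<Sum>k=1..p. a k * t ^ k)"
      by (rule sum.mono_neutral_right) (auto simp: a0 not_less_eq_eq)
    also have "\<dots> = (\<Sum>k=1..p. (1 / sqrt (w k)) * (sqrt (w k) * a k * t ^ k))"
    proof (rule sum.cong[OF refl])
      fix k assume "k \<in> {1..p}"
      then have "sqrt (w k) \<noteq> 0" using w[of k] by simp
      then show "a k * t ^ k = (1 / sqrt (w k)) * (sqrt (w k) * a k * t ^ k)" by simp
    qed
    finally have "(\<Sum>k\<le>p. a k * t ^ k)\<^sup>2
      \<le> (\<Sum>k=1..p. (1 / sqrt (w k))\<^sup>2) * (\<Sum>k=1..p. (sqrt (w k) * a k * t ^ k)\<^sup>2)"
      by (simp only: Cauchy_Schwarz_ineq_sum)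
    also have "(\<Sum>k=1..p. (1 / sqrt (w k))\<^sup>2) = (\<Sum>k=1..p. 1 / w k)"
      by (rule sum.cong) (use w in \<open>auto simp: power_divide less_imp_le\<close>)
    also have "(\<Sum>k=1..p. (sqrt (w k) * a k * t ^ k)\<^sup>2) = (\<Sum>k=1..p. w k * (a k)\<^sup>2 * t ^ (2 * k))"
      by (rule sum.cong) (use w in \<open>auto simp: power_mult_distrib less_imp_le power_mult[symmetric] mult.commute\<close>)
    finally show ?thesis .
  qed
  moreover have "(\<lambda>t. (\<Sum>k\<le>p. a k * t ^ k)\<^sup>2) integrable_on {0..h}"
    by (intro integrable_continuous_real continuous_intros)
  ultimately show ?thesis
    using I by (intro has_integral_le[OF integrable_integral I]) auto
qed

section \<open>Polynomials along a coordinate direction, one-sided traces and jumps\<close>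

lemma Q_poly_lincomb:
  assumes "\<And>i. i \<in> I \<Longrightarrow> f i \<in> Q_poly p"
  shows "(\<lambda>x. \<Sum>i\<in>I. s i * f i x) \<in> (Q_poly p :: ('a::euclidean_space \<Rightarrow> real) set)"
proof -
  let ?m = "\<lambda>\<alpha> x. \<Prod>b\<in>Basis. ((x::'a) \<bullet> b) ^ \<alpha> b"
  let ?A = "(Basis :: 'a set) \<rightarrow>\<^sub>E {..p}"
  have "\<exists>c. \<forall>i\<in>I. f i = (\<lambda>x. \<Sum>\<alpha>\<in>?A. c i \<alpha> * ?m \<alpha> x)"
    using assms by (intro bchoice) (fastforce simp: Q_poly_def)
  then obtain c where c: "\<And>i. i \<in> I \<Longrightarrow> f i = (\<lambda>x. \<Sum>\<alpha>\<in>?A. c i \<alpha> * ?m \<alpha> x)" by blast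
  have "(\<Sum>i\<in>I. s i * f i x) = (\<Sum>\<alpha>\<in>?A. (\<Sum>i\<in>I. s i * c i \<alpha>) * ?m \<alpha> x)" for x
  proof -
    have "(\<Sum>i\<in>I. s i * f i x) = (\<Sum>i\<in>I. \<Sum>\<alpha>\<in>?A. s i * c i \<alpha> * ?m \<alpha> x)"
      by (simp add: c sum_distrib_left mult.assoc)
    then show ?thesis by (simp only: sum.swap[of _ I] sum_distrib_right)
  qed
  then show ?thesis unfolding Q_poly_def by (intro CollectI exI[of _ "\<lambda>\<alpha>. \<Sum>i\<in>I. s i * c i \<alpha>"]) auto
qed

lemma continuous_Q_poly: "q \<in> Q_poly p \<Longrightarrow> continuous_on S q"
  by (auto simp: Q_poly_def intro!: continuous_intros)

text \<open>The binomial theorem is applied to the one factor of each monomial that involves n. The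
  exponents are bounded by p per direction, so p + 1 coefficients suffice, and these are polynomials
  in x.\<close>

lemma Q_poly_directional_expansion:
  fixes q :: "'a::euclidean_space \<Rightarrow> real"
  assumes q: "q \<in> Q_poly p" and n: "n \<in> Basis"
  obtains e where "\<And>k. continuous_on UNIV (e k)" "\<And>x t. q (x + t *\<^sub>R n) = (\<Sum>k\<le>p. e k x * t ^ k)"
proof -
  let ?A = "(Basis :: 'a set) \<rightarrow>\<^sub>E {..p}"
  obtain c where c: "q = (\<lambda>x. \<Sum>\<alpha>\<in>?A. c \<alpha> * (\<Prod>b\<in>Basis. (x \<bullet> b) ^ \<alpha> b))"
    using q by (auto simp: Q_poly_def)
  define e where "e = (\<lambda>k x. \<Sum>\<alpha>\<in>?A. c \<alpha> * (of_nat (\<alpha> n choose k) * (x \<bullet> n) ^ (\<alpha> n - k)) *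
    (\<Prod>b\<in>Basis - {n}. (x \<bullet> b) ^ \<alpha> b))"
  have "continuous_on UNIV (e k)" for k unfolding e_def by (intro continuous_intros)
  moreover have "q (x + t *\<^sub>R n) = (\<Sum>k\<le>p. e k x * t ^ k)" for x t
  proof -
    have m: "(\<Prod>b\<in>Basis. ((x + t *\<^sub>R n) \<bullet> b) ^ \<alpha> b)
      = (\<Sum>k\<le>p. of_nat (\<alpha> n choose k) * (x \<bullet> n) ^ (\<alpha> n - k) * (\<Prod>b\<in>Basis - {n}. (x \<bullet> b) ^ \<alpha> b) * t ^ k)"
      if "\<alpha> \<in> ?A" for \<alpha>
    proof -
      have le: "\<alpha> n \<le> p" using that n by auto
      have "(\<Prod>b\<in>Basis. ((x + t *\<^sub>R n) \<bullet> b) ^ \<alpha> b)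
        = ((x + t *\<^sub>R n) \<bullet> n) ^ \<alpha> n * (\<Prod>b\<in>Basis - {n}. ((x + t *\<^sub>R n) \<bullet> b) ^ \<alpha> b)"
        using n by (intro prod.remove) auto
      also have "(\<Prod>b\<in>Basis - {n}. ((x + t *\<^sub>R n) \<bullet> b) ^ \<alpha> b) = (\<Prod>b\<in>Basis - {n}. (x \<bullet> b) ^ \<alpha> b)"
        using n by (intro prod.cong) (auto simp: inner_add_left inner_Basis)
      also have "(x + t *\<^sub>R n) \<bullet> n = t + x \<bullet> n" using n by (simp add: inner_add_left)
      also have "(t + x \<bullet> n) ^ \<alpha> n = (\<Sum>k\<le>p. of_nat (\<alpha> n choose k) * t ^ k * (x \<bullet> n) ^ (\<alpha> n - k))"
        unfolding binomial_ring by (rule sum.mono_neutral_left) (use le in auto)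
      finally show ?thesis by (simp add: sum_distrib_left sum_distrib_right mult_ac)
    qed
    have "q (x + t *\<^sub>R n) = (\<Sum>\<alpha>\<in>?A. \<Sum>k\<le>p. c \<alpha> * (of_nat (\<alpha> n choose k) * (x \<bullet> n) ^ (\<alpha> n - k)) *
        (\<Prod>b\<in>Basis - {n}. (x \<bullet> b) ^ \<alpha> b) * t ^ k)"
      unfolding c by (rule sum.cong[OF refl]) (simp only: m sum_distrib_left mult.assoc)
    also have "\<dots> = (\<Sum>k\<le>p. e k x * t ^ k)"
      unfolding e_def sum_distrib_right by (rule sum.swap)
    finally show ?thesis .
  qed
  ultimately show thesis by (rule that)
qed

lemma higher_deriv_eq_poly:
  fixes f :: "real \<Rightarrow> real"
  assumes S: "open S" and f: "\<And>t. t \<in> S \<Longrightarrow> f t = poly P t" and "t \<in> S"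
  shows "(deriv ^^ k) f t = poly ((pderiv ^^ k) P) t"
  using \<open>t \<in> S\<close>
proof (induction k arbitrary: t)
  case (Suc k)
  have "((deriv ^^ k) f has_field_derivative poly (pderiv ((pderiv ^^ k) P)) t) (at t)"
    by (rule has_field_derivative_transform_within_open[OF poly_DERIV S Suc.prems]) (simp add: Suc.IH)
  then show ?case by (simp add: DERIV_imp_deriv)
qed (simp add: f)

lemma higher_pderiv_shift: "(pderiv ^^ k) (pcompose P [:s, 1:]) = pcompose ((pderiv ^^ k) P) [:s, 1::real:]"
  by (induction k) (simp_all add: pderiv_pcompose pderiv_pCons)

text \<open>Iterated \<open>deriv\<close> is local, so agreement with a polynomial on an open piece
  of the line determines it. Recentring at s is composition with X + s.\<close>

lemma normal_deriv_on_segment: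
  assumes v: "\<And>t. l < t \<Longrightarrow> t < u \<Longrightarrow> v (x + t *\<^sub>R n) = poly P t" and s: "l < s" "s < u"
  shows "normal_deriv n k v (x + s *\<^sub>R n) = poly ((pderiv ^^ k) P) s"
proof -
  let ?f = "\<lambda>t. v (x + s *\<^sub>R n + t *\<^sub>R n)"
  have "?f t = poly (pcompose P [:s, 1:]) t" if "t \<in> {l - s<..<u - s}" for t
    using v[of "s + t"] that by (simp add: poly_pcompose algebra_simps)
  then have "(deriv ^^ k) ?f 0 = poly ((pderiv ^^ k) (pcompose P [:s, 1:])) 0"
    using s by (intro higher_deriv_eq_poly[of "{l - s<..<u - s}"]) auto
  then show ?thesis by (simp add: normal_deriv_def higher_pderiv_shift poly_pcompose)
qed

lemma one_sided_trace_normal_deriv: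
  assumes h: "h > 0" and v: "\<And>t. 0 < t \<Longrightarrow> t < h \<Longrightarrow> v (x + t *\<^sub>R n) = poly P t"
  shows "one_sided_trace n (normal_deriv n k v) x = poly ((pderiv ^^ k) P) 0"
proof -
  have "((\<lambda>s. poly ((pderiv ^^ k) P) s) \<longlongrightarrow> poly ((pderiv ^^ k) P) 0) (at_right 0)"
    by (intro tendsto_intros)
  moreover have "\<forall>\<^sub>F s in at_right 0. poly ((pderiv ^^ k) P) s = normal_deriv n k v (x + s *\<^sub>R n)"
    using eventually_at_right_less[of 0] eventually_at_right_real[OF h]
    by eventually_elim (use normal_deriv_on_segment[of 0 h v x n P] v in auto)
  ultimately have "((\<lambda>s. normal_deriv n k v (x + s *\<^sub>R n)) \<longlongrightarrow> poly ((pderiv ^^ k) P) 0) (at_right 0)"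
    by (rule Lim_transform_eventually)
  then show ?thesis unfolding one_sided_trace_def by (intro tendsto_Lim) auto
qed

text \<open>The trace is approached along -n while the derivative is still taken along n. The
  polynomial derivative is therefore evaluated at -s, and no sign (-1)^k appears.\<close>

lemma one_sided_trace_normal_deriv_minus:
  assumes h: "h > 0" and v: "\<And>t. - h < t \<Longrightarrow> t < 0 \<Longrightarrow> v (x + t *\<^sub>R n) = poly P t"
  shows "one_sided_trace (- n) (normal_deriv n k v) x = poly ((pderiv ^^ k) P) 0"
proof -
  have "((\<lambda>s. poly ((pderiv ^^ k) P) (- s)) \<longlongrightarrow> poly ((pderiv ^^ k) P) (- 0)) (at_right 0)"
    by (intro tendsto_intros)
  moreover have "\<forall>\<^sub>F s in at_right 0. poly ((pderiv ^^ k) P) (- s) = normal_deriv n k v (x + s *\<^sub>R - n)"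
    using eventually_at_right_real[OF h]
  proof eventually_elim
    case (elim s)
    then show ?case using normal_deriv_on_segment[of "- h" 0 v x n P "- s" k] v by simp
  qed
  ultimately have "((\<lambda>s. normal_deriv n k v (x + s *\<^sub>R - n)) \<longlongrightarrow> poly ((pderiv ^^ k) P) (- 0)) (at_right 0)"
    by (rule Lim_transform_eventually)
  then show ?thesis unfolding one_sided_trace_def by (intro tendsto_Lim) auto
qed

lemma jump_normal_deriv:
  assumes h: "h > 0" and k: "k \<le> p"
    and a: "\<And>t. 0 \<le> t \<Longrightarrow> t \<le> h \<Longrightarrow> v (x + t *\<^sub>R n) = (\<Sum>j\<le>p. a j * t ^ j)"
    and b: "\<And>t. - h \<le> t \<Longrightarrow> t \<le> 0 \<Longrightarrow> v (x + t *\<^sub>R n) = (\<Sum>j\<le>p. b j * t ^ j)"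
  shows "jump n (normal_deriv n k v) x = fact k * (a k - b k)"
proof -
  define P where "P = (\<lambda>c :: nat \<Rightarrow> real. \<Sum>j\<le>p. Polynomial.monom (c j) j)"
  have P: "poly (P c) t = (\<Sum>j\<le>p. c j * t ^ j)" for c t
    by (simp add: P_def poly_sum poly_monom)
  have D: "poly ((pderiv ^^ k) (P c)) 0 = fact k * c k" for c
  proof -
    have "coeff (P c) k = c k" using k by (simp add: P_def coeff_sum)
    then show ?thesis by (simp add: poly_0_coeff_0 coeff_higher_pderiv pochhammer_fact)
  qed
  have "one_sided_trace n (normal_deriv n k v) x = fact k * a k"
    using one_sided_trace_normal_deriv[OF h, of v x n "P a" k] a by (simp add: P D)
  moreover have "one_sided_trace (- n) (normal_deriv n k v) x = fact k * b k"
    using one_sided_trace_normal_deriv_minus[OF h, of v x n "P b" k] b by (simp add: P D)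
  ultimately show ?thesis by (simp add: jump_def algebra_simps)
qed

text \<open>
  On \<open>T\<close> the function \<open>v\<close> agrees with \<open>q\<close>; \<open>e k x\<close> is the \<open>k\<close>-th Taylor coefficient of \<open>q\<close> at \<open>x\<close>
  in direction \<open>n\<close>.
\<close>

definition element_expansion ::
  "'a::euclidean_space \<Rightarrow> nat \<Rightarrow> ('a \<Rightarrow> real) \<Rightarrow> 'a set \<Rightarrow> ('a \<Rightarrow> real) \<Rightarrow> (nat \<Rightarrow> 'a \<Rightarrow> real) \<Rightarrow> bool" where
  "element_expansion n p v T q e \<longleftrightarrow> q \<in> Q_poly p \<and> (\<forall>x\<in>T. v x = q x) \<and> (\<forall>k. continuous_on UNIV (e k)) \<and>
     (\<forall>x t. q (x + t *\<^sub>R n) = (\<Sum>k\<le>p. e k x * t ^ k))"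

lemma fe_space_element_expansion:
  assumes "v \<in> fe_space p \<T>" "T \<in> \<T>" "n \<in> Basis"
  obtains q e where "element_expansion n p v T q e"
proof -
  obtain q where q: "q \<in> Q_poly p" "\<forall>x\<in>T. v x = q x" using assms by (auto simp: fe_space_def)
  obtain e where e: "\<And>k. continuous_on UNIV (e k)" "\<And>x t. q (x + t *\<^sub>R n) = (\<Sum>k\<le>p. e k x * t ^ k)"
    using Q_poly_directional_expansion[OF q(1) assms(3)] by blast
  show thesis by (rule that[of q e]) (use q e in \<open>simp add: element_expansion_def\<close>)
qed

lemma element_expansion_coeff_0:
  assumes "element_expansion n p v T q e"
  shows "e 0 y = q y"
proof -
  have "q (y + 0 *\<^sub>R n) = (\<Sum>k\<le>p. e k y * 0 ^ k)"
    using assms unfolding element_expansion_def by blast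
  moreover have "(\<Sum>k\<le>p. a k * (0::real) ^ k) = a 0" for a by (induction p) auto
  ultimately show ?thesis by (simp only: scaleR_zero_left add_0_right)
qed

lemma slab_direction_sign: "slab n c h \<sigma> F T \<Longrightarrow> \<sigma> = 1 \<or> \<sigma> = - 1"
  by (auto simp: slab_def abs_if split: if_splits)

lemma slab_mem:
  assumes "slab n c h \<sigma> F T" "y \<in> F" "0 \<le> t" "t \<le> h"
  shows "y + (\<sigma> * t) *\<^sub>R n \<in> T"
  using assms by (auto simp: slab_def)

text \<open>
  Normal lines through \<open>y \<in> F\<close> stay inside the closed elements even if \<open>y\<close> is on the relative
  boundary of \<open>F\<close>, so the formula holds at every point of the face.
\<close>

lemma jump_between_slabs:
  assumes T1: "slab n c h \<sigma> F T1" and T2: "slab n c h (- \<sigma>) F T2" and h: "h > 0"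
    and e1: "element_expansion n p v T1 q1 e1" and e2: "element_expansion n p v T2 q2 e2"
    and y: "y \<in> F" and k: "k \<le> p"
  shows "jump n (normal_deriv n k v) y = \<sigma> * (fact k * (e1 k y - e2 k y))"
proof -
  have one: "v (y + (\<sigma> * t) *\<^sub>R n) = (\<Sum>j\<le>p. e1 j y * (\<sigma> * t) ^ j)" if "0 \<le> t" "t \<le> h" for t
  proof -
    have "v (y + (\<sigma> * t) *\<^sub>R n) = q1 (y + (\<sigma> * t) *\<^sub>R n)"
      using slab_mem[OF T1 y that] e1 by (auto simp only: element_expansion_def)
    then show ?thesis using e1 by (simp only: element_expansion_def)
  qed
  have two: "v (y + (- \<sigma> * t) *\<^sub>R n) = (\<Sum>j\<le>p. e2 j y * (- \<sigma> * t) ^ j)" if "0 \<le> t" "t \<le> h" for t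
  proof -
    have "v (y + (- \<sigma> * t) *\<^sub>R n) = q2 (y + (- \<sigma> * t) *\<^sub>R n)"
      using slab_mem[OF T2 y that] e2 by (auto simp only: element_expansion_def)
    then show ?thesis using e2 by (simp only: element_expansion_def)
  qed
  consider "\<sigma> = 1" | "\<sigma> = - 1" using slab_direction_sign[OF T1] by blast
  then show ?thesis
  proof cases
    case [simp]: 1
    have "jump n (normal_deriv n k v) y = fact k * (e1 k y - e2 k y)"
    proof (rule jump_normal_deriv[OF h k])
      show "v (y + t *\<^sub>R n) = (\<Sum>j\<le>p. e1 j y * t ^ j)" if "0 \<le> t" "t \<le> h" for t
        using one[of t] that by simp
      show "v (y + t *\<^sub>R n) = (\<Sum>j\<le>p. e2 j y * t ^ j)" if "- h \<le> t" "t \<le> 0" for t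
        using two[of "- t"] that by simp
    qed
    then show ?thesis by simp
  next
    case [simp]: 2
    have "jump n (normal_deriv n k v) y = fact k * (e2 k y - e1 k y)"
    proof (rule jump_normal_deriv[OF h k])
      show "v (y + t *\<^sub>R n) = (\<Sum>j\<le>p. e2 j y * t ^ j)" if "0 \<le> t" "t \<le> h" for t
        using two[of t] that by simp
      show "v (y + t *\<^sub>R n) = (\<Sum>j\<le>p. e1 j y * t ^ j)" if "- h \<le> t" "t \<le> 0" for t
        using one[of "- t"] that by simp
    qed
    then show ?thesis by (simp add: algebra_simps)
  qed
qed

text \<open>Traversing a slab in direction -n changes the k-th coefficient by \<sigma>^k. Absorbing
  this sign treats both sides of a face alike, and squares of single coefficients do not see
  it.\<close>

lemma slab_integral_square:
  assumes s: "slab n c h \<sigma> F T" and q: "continuous_on UNIV q"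
    and e: "\<And>x t. q (x + t *\<^sub>R n) = (\<Sum>k\<le>p. e k x * t ^ k)"
  shows "(LINT x:T|lborel. (q x)\<^sup>2) = (LINT y:F|hyperplane_measure n c.
    integral {0..h} (\<lambda>t. (\<Sum>k\<le>p. (\<sigma> ^ k * e k y) * t ^ k)\<^sup>2))"
proof -
  have "(q (y + (\<sigma> * t) *\<^sub>R n))\<^sup>2 = (\<Sum>k\<le>p. (\<sigma> ^ k * e k y) * t ^ k)\<^sup>2" for y t
    by (simp add: e power_mult_distrib mult_ac)
  then show ?thesis
    using slab_integral[OF s, of "\<lambda>x. (q x)\<^sup>2"] q by (simp add: continuous_on_power)
qed

lemma continuous_integral_square:
  fixes e :: "nat \<Rightarrow> 'a::euclidean_space \<Rightarrow> real" and h :: real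
  assumes "\<And>k. continuous_on UNIV (e k)" "0 \<le> h"
  shows "continuous_on UNIV (\<lambda>y. integral {0..h} (\<lambda>t. (\<Sum>k\<le>p. (\<sigma> ^ k * e k y) * t ^ k)\<^sup>2))"
  unfolding integral_square_expansion[OF assms(2)] by (intro continuous_intros assms)

lemma l2_inner_expansion:
  assumes T: "T \<in> sets lborel" and e: "element_expansion n p v T q e"
  shows "l2_inner T v v = (LINT x:T|lborel. (q x)\<^sup>2)"
  unfolding l2_inner_def
  by (rule set_lebesgue_integral_cong[OF T]) (use e in \<open>auto simp: element_expansion_def power2_eq_square\<close>)

lemma slab_sets: "slab n c h \<sigma> F T \<Longrightarrow> T \<in> sets lborel" "slab n c h \<sigma> F T \<Longrightarrow> F \<in> sets borel"
  by (auto simp: slab_def intro: borel_closed compact_imp_closed)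

lemma element_expansion_continuous:
  "element_expansion n p v T q e \<Longrightarrow> continuous_on UNIV (e k)"
  "element_expansion n p v T q e \<Longrightarrow> continuous_on UNIV q"
  by (auto simp: element_expansion_def continuous_Q_poly)

lemma l2_inner_slab:
  assumes s: "slab n c h \<sigma> F T" and e: "element_expansion n p v T q e"
  shows "l2_inner T v v = (LINT y:F|hyperplane_measure n c.
    integral {0..h} (\<lambda>t. (\<Sum>k\<le>p. (\<sigma> ^ k * e k y) * t ^ k)\<^sup>2))"
  unfolding l2_inner_expansion[OF slab_sets(1)[OF s] e]
  by (rule slab_integral_square[OF s element_expansion_continuous(2)[OF e]])
    (use e in \<open>auto simp: element_expansion_def\<close>)

section \<open>Estimates on a single face\<close>

lemma set_integrable_slab_face:
  fixes g :: "'a::euclidean_space \<Rightarrow> real"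
  shows
  "slab n c h \<sigma> F T \<Longrightarrow> continuous_on UNIV g \<Longrightarrow> set_integrable (hyperplane_measure n c) F g"
  by (simp add: slab_def set_integrable_hyperplane_compact)

text \<open>The one-dimensional inverse inequality is applied on each normal line and integrated
  over the face; by Fubini the right side becomes the mass of the element.\<close>

lemma trace_inequality:
  assumes s: "slab n c h \<sigma> F T" and e: "element_expansion n p v T q e"
    and h: "h > 0" and k: "1 \<le> k" "k \<le> p"
  shows "h ^ (2 * k + 1) * (LINT y:F|hyperplane_measure n c. (fact k * e k y)\<^sup>2)
    \<le> 16 * real p ^ (4 * k + 2) * l2_inner T v v"
proof -
  let ?I = "\<lambda>y. integral {0..h} (\<lambda>t. (\<Sum>k\<le>p. (\<sigma> ^ k * e k y) * t ^ k)\<^sup>2)"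
  note cont = element_expansion_continuous(1)[OF e]
  have \<sigma>: "(\<sigma> ^ k)\<^sup>2 = 1"
    using slab_direction_sign[OF s] by (auto simp: power_even_eq[symmetric])
  have "(LINT y:F|hyperplane_measure n c. h ^ (2 * k + 1) * (fact k * e k y)\<^sup>2)
      \<le> (LINT y:F|hyperplane_measure n c. 16 * real p ^ (4 * k + 2) * ?I y)"
  proof (rule set_integral_mono)
    show "set_integrable (hyperplane_measure n c) F (\<lambda>y. h ^ (2 * k + 1) * (fact k * e k y)\<^sup>2)"
      by (rule set_integrable_slab_face[OF s]) (intro continuous_intros cont)
    show "set_integrable (hyperplane_measure n c) F (\<lambda>y. 16 * real p ^ (4 * k + 2) * ?I y)"
      by (rule set_integrable_slab_face[OF s])
        (intro continuous_intros continuous_integral_square cont, use h in simp)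
    fix y
    have "h ^ (2 * k + 1) * (fact k * (\<sigma> ^ k * e k y))\<^sup>2 \<le> 16 * real p ^ (4 * k + 2) * ?I y"
      by (rule inverse_inequality) (use k h in auto)
    then show "h ^ (2 * k + 1) * (fact k * e k y)\<^sup>2 \<le> 16 * real p ^ (4 * k + 2) * ?I y"
      by (simp add: power_mult_distrib \<sigma>)
  qed
  then show ?thesis by (simp add: l2_inner_slab[OF s e])
qed

definition face_stab_form ::
  "real \<Rightarrow> nat \<Rightarrow> (nat \<Rightarrow> real) \<Rightarrow> 'a::euclidean_space set \<Rightarrow> ('a \<Rightarrow> real) \<Rightarrow> real" where
  "face_stab_form h p w F v = (\<Sum>k = 1..p. w k * (h ^ (2 * k + 1) / (real (2 * k + 1) * (fact k)\<^sup>2)) *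
     face_inner F (jump (face_normal F) (normal_deriv (face_normal F) k v))
       (jump (face_normal F) (normal_deriv (face_normal F) k v)))"

lemma face_inner_self_nonneg: "0 \<le> face_inner F u u"
  unfolding face_inner_def set_lebesgue_integral_def by (intro integral_nonneg_AE) auto

lemma l2_inner_self_nonneg: "0 \<le> l2_inner X u u"
  unfolding l2_inner_def set_lebesgue_integral_def by (intro integral_nonneg_AE) auto

lemma face_stab_form_nonneg:
  assumes "\<And>k. k \<in> {1..p} \<Longrightarrow> 0 < w k" "h > 0"
  shows "0 \<le> face_stab_form h p w F v"
  unfolding face_stab_form_def
  by (intro sum_nonneg mult_nonneg_nonneg face_inner_self_nonneg) (use assms in \<open>auto intro: less_imp_le\<close>)

lemma face_inner_jump:
  assumes s1: "slab n c h \<sigma> F T1" and s2: "slab n c h (- \<sigma>) F T2" and h: "h > 0"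
    and e1: "element_expansion n p v T1 q1 e1" and e2: "element_expansion n p v T2 q2 e2"
    and F: "face_normal F = n" "face_offset F = c" and k: "k \<le> p"
  shows "face_inner F (jump n (normal_deriv n k v)) (jump n (normal_deriv n k v))
    = (LINT y:F|hyperplane_measure n c. (fact k * (e1 k y - e2 k y))\<^sup>2)"
  unfolding face_inner_def F
proof (rule set_lebesgue_integral_cong)
  show "F \<in> sets (hyperplane_measure n c)" using slab_sets(2)[OF s1] by simp
  have "\<sigma> * \<sigma> = 1" using slab_direction_sign[OF s1] by auto
  then show "\<forall>y. y \<in> F \<longrightarrow> jump n (normal_deriv n k v) y * jump n (normal_deriv n k v) y
      = (fact k * (e1 k y - e2 k y))\<^sup>2"
    by (simp add: jump_between_slabs[OF s1 s2 h e1 e2 _ k] power2_eq_square)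
qed

text \<open>The constant 32 is 16 from the trace inequality times 2 from (a - b)^2 <= 2 a^2 + 2
  b^2.\<close>

lemma face_inner_jump_le:
  assumes s1: "slab n c h \<sigma> F T1" and s2: "slab n c h (- \<sigma>) F T2" and h: "h > 0"
    and e1: "element_expansion n p v T1 q1 e1" and e2: "element_expansion n p v T2 q2 e2"
    and F: "face_normal F = n" "face_offset F = c" and k: "1 \<le> k" "k \<le> p"
  shows "h ^ (2 * k + 1) * face_inner F (jump n (normal_deriv n k v)) (jump n (normal_deriv n k v))
    \<le> 32 * real p ^ (4 * k + 2) * (l2_inner T1 v v + l2_inner T2 v v)"
proof -
  note cont = element_expansion_continuous(1)[OF e1] element_expansion_continuous(1)[OF e2]
  let ?H = "hyperplane_measure n c"
  have int: "set_integrable ?H F g" if "continuous_on UNIV g" for g :: "_ \<Rightarrow> real"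
    using that by (rule set_integrable_slab_face[OF s1])
  have "(LINT y:F|?H. (fact k * (e1 k y - e2 k y))\<^sup>2)
      \<le> (LINT y:F|?H. 2 * (fact k * e1 k y)\<^sup>2 + 2 * (fact k * e2 k y)\<^sup>2)"
  proof (rule set_integral_mono)
    fix y
    have "0 \<le> (fact k * e1 k y + fact k * e2 k y)\<^sup>2" by simp
    then show "(fact k * (e1 k y - e2 k y))\<^sup>2 \<le> 2 * (fact k * e1 k y)\<^sup>2 + 2 * (fact k * e2 k y)\<^sup>2"
      by (simp add: power2_eq_square algebra_simps)
  qed (intro int continuous_intros cont)+
  also have "\<dots> = 2 * (LINT y:F|?H. (fact k * e1 k y)\<^sup>2) + 2 * (LINT y:F|?H. (fact k * e2 k y)\<^sup>2)"
    by (subst set_integral_add(2)) (simp_all, (intro int continuous_intros cont)+)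
  finally have "h ^ (2 * k + 1) * (LINT y:F|?H. (fact k * (e1 k y - e2 k y))\<^sup>2)
      \<le> h ^ (2 * k + 1) * (2 * (LINT y:F|?H. (fact k * e1 k y)\<^sup>2) + 2 * (LINT y:F|?H. (fact k * e2 k y)\<^sup>2))"
    using h by (intro mult_left_mono) auto
  also have "\<dots> \<le> 32 * real p ^ (4 * k + 2) * (l2_inner T1 v v + l2_inner T2 v v)"
    using trace_inequality[OF s1 e1 h k] trace_inequality[OF s2 e2 h k]
    unfolding distrib_left by linarith
  finally show ?thesis unfolding face_inner_jump[OF s1 s2 h e1 e2 F k(2)] .
qed

lemma face_stab_form_le:
  assumes T: "T1 \<in> \<T>" "T2 \<in> \<T>" "\<T> \<subseteq> cartesian_grid h a" and sf: "share_face T1 T2" and h: "h > 0"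
    and w: "\<And>k. k \<in> {1..p} \<Longrightarrow> 0 < w k" and v: "v \<in> fe_space p \<T>"
  shows "face_stab_form h p w (T1 \<inter> T2) v \<le> 32 * G_weight p w * (l2_inner T1 v v + l2_inner T2 v v)"
proof -
  obtain n c \<sigma> where s: "slab n c h \<sigma> (T1 \<inter> T2) T1" "slab n c h (- \<sigma>) (T1 \<inter> T2) T2"
    and F: "face_normal (T1 \<inter> T2) = n" "face_offset (T1 \<inter> T2) = c"
    using share_face_grid[OF _ _ h sf] T by blast
  have n: "n \<in> Basis" using s by (simp add: slab_def)
  obtain q1 e1 where e1: "element_expansion n p v T1 q1 e1" using fe_space_element_expansion[OF v T(1) n] .
  obtain q2 e2 where e2: "element_expansion n p v T2 q2 e2" using fe_space_element_expansion[OF v T(2) n] .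
  let ?A = "l2_inner T1 v v + l2_inner T2 v v"
  have "face_stab_form h p w (T1 \<inter> T2) v
    \<le> (\<Sum>k = 1..p. w k * (real p ^ (4 * k + 2) / (real (2 * k + 1) * (fact k)\<^sup>2)) * (32 * ?A))"
    unfolding face_stab_form_def F
  proof (rule sum_mono)
    fix k assume k: "k \<in> {1..p}"
    let ?J = "jump n (normal_deriv n k v)"
    let ?d = "real (2 * k + 1) * (fact k)\<^sup>2"
    have "w k / ?d * (h ^ (2 * k + 1) * face_inner (T1 \<inter> T2) ?J ?J)
        \<le> w k / ?d * (32 * real p ^ (4 * k + 2) * ?A)"
      using face_inner_jump_le[OF s h e1 e2 F, of k] k w[OF k]
      by (intro mult_left_mono) auto
    then show "w k * (h ^ (2 * k + 1) / ?d) * face_inner (T1 \<inter> T2) ?J ?J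
        \<le> w k * (real p ^ (4 * k + 2) / ?d) * (32 * ?A)"
      by (simp only: times_divide_eq_left times_divide_eq_right mult_ac)
  qed
  also have "\<dots> = 32 * G_weight p w * ?A"
    by (simp only: G_weight_def sum_distrib_right sum_distrib_left mult_ac)
  finally show ?thesis .
qed

lemma l2_norm_sq: "(l2_norm X v)\<^sup>2 = l2_inner X v v"
  by (simp add: l2_norm_def l2_inner_self_nonneg)

text \<open>On \<open>T1\<close> the function is q1 = q2 + (q1 - q2), where q2 is the polynomial of
  \<open>T2\<close> extended across the face. The constant C controls the extended q2, the penalty
  controls the difference, and both factors 2 come from squaring the sum.\<close>

lemma l2_inner_neighbour_le:
  fixes T1 T2 :: "'a::euclidean_space set"
  assumes T: "T1 \<in> \<T>" "T2 \<in> \<T>" "\<T> \<subseteq> cartesian_grid h a" and sf: "share_face T1 T2" and h: "h > 0"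
    and w: "\<And>k. k \<in> {1..p} \<Longrightarrow> 0 < w k" and v: "v \<in> fe_space p \<T>"
    and C: "neighbour_const TYPE('a) p C"
  shows "l2_inner T1 v v \<le> 2 * C * l2_inner T2 v v
    + 2 * (\<Sum>k=1..p. 1 / w k) * face_stab_form h p w (T1 \<inter> T2) v"
proof -
  obtain n c \<sigma> where s: "slab n c h \<sigma> (T1 \<inter> T2) T1" "slab n c h (- \<sigma>) (T1 \<inter> T2) T2"
    and F: "face_normal (T1 \<inter> T2) = n" "face_offset (T1 \<inter> T2) = c"
    using share_face_grid[OF _ _ h sf] T by blast
  let ?F = "T1 \<inter> T2"
  let ?H = "hyperplane_measure n c"
  let ?W = "\<Sum>k=1..p. 1 / w k"
  have n: "n \<in> Basis" using s by (simp add: slab_def)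
  obtain q1 e1 where e1: "element_expansion n p v T1 q1 e1" using fe_space_element_expansion[OF v T(1) n] .
  obtain q2 e2 where e2: "element_expansion n p v T2 q2 e2" using fe_space_element_expansion[OF v T(2) n] .
  note q = element_expansion_continuous(2)[OF e1] element_expansion_continuous(2)[OF e2]
  note cont = element_expansion_continuous(1)[OF e1] element_expansion_continuous(1)[OF e2]
  have T1c: "compact T1" using s by (simp add: slab_def)
  have T1m: "T1 \<in> sets lborel" and T2m: "T2 \<in> sets lborel"
    using slab_sets(1)[OF s(1)] slab_sets(1)[OF s(2)] .
  have int: "set_integrable lborel T1 g" if "continuous_on UNIV g" for g :: "'a \<Rightarrow> real"
    using T1c continuous_on_subset[OF that] by (intro set_integrable_lborel_compact) auto
  have intF: "set_integrable ?H ?F g" if "continuous_on UNIV g" for g :: "_ \<Rightarrow> real"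
    using that by (rule set_integrable_slab_face[OF s(1)])
  have "l2_inner T1 v v = (LINT x:T1|lborel. (q1 x)\<^sup>2)" by (rule l2_inner_expansion[OF T1m e1])
  also have "\<dots> \<le> (LINT x:T1|lborel. 2 * (q2 x)\<^sup>2 + 2 * (q1 x - q2 x)\<^sup>2)"
  proof (rule set_integral_mono)
    fix x
    have "0 \<le> (2 * q2 x - q1 x)\<^sup>2" by simp
    then show "(q1 x)\<^sup>2 \<le> 2 * (q2 x)\<^sup>2 + 2 * (q1 x - q2 x)\<^sup>2"
      by (simp add: power2_eq_square algebra_simps)
  qed (intro int continuous_intros q)+
  also have "\<dots> = 2 * (LINT x:T1|lborel. (q2 x)\<^sup>2) + 2 * (LINT x:T1|lborel. (q1 x - q2 x)\<^sup>2)"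
    by (subst set_integral_add(2)) (simp_all, (intro int continuous_intros q)+)
  finally have split: "l2_inner T1 v v \<le> \<dots>" .
  have "(LINT x:T1|lborel. (q2 x)\<^sup>2) \<le> C * l2_inner T2 v v"
  proof -
    obtain a1 a2 where a: "T1 = hypercube h a1" "T2 = hypercube h a2"
      using T by (metis cartesian_gridE subsetD)
    have "(l2_norm T1 q2)\<^sup>2 \<le> C * (l2_norm T2 q2)\<^sup>2"
      using C h sf e2 unfolding neighbour_const_def a element_expansion_def by blast
    moreover have "l2_inner T2 q2 q2 = l2_inner T2 v v"
      unfolding l2_inner_expansion[OF T2m e2] by (simp add: l2_inner_def power2_eq_square)
    ultimately show ?thesis unfolding l2_norm_sq by (simp add: l2_inner_def power2_eq_square)
  qed
  moreover have "(LINT x:T1|lborel. (q1 x - q2 x)\<^sup>2) \<le> ?W * face_stab_form h p w ?F v"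
  proof -
    let ?d = "\<lambda>k y. e1 k y - e2 k y"
    let ?c = "\<lambda>k. w k * (h ^ (2 * k + 1) / real (2 * k + 1))"
    have \<sigma>: "(\<sigma> ^ k)\<^sup>2 = 1" for k
      using slab_direction_sign[OF s(1)] by (auto simp: power_even_eq[symmetric])
    have "(LINT x:T1|lborel. (q1 x - q2 x)\<^sup>2)
      = (LINT y:?F|?H. integral {0..h} (\<lambda>t. (\<Sum>k\<le>p. (\<sigma> ^ k * ?d k y) * t ^ k)\<^sup>2))"
    proof (rule slab_integral_square[OF s(1)])
      show "q1 (x + t *\<^sub>R n) - q2 (x + t *\<^sub>R n) = (\<Sum>k\<le>p. ?d k x * t ^ k)" for x t
        using e1 e2 by (simp add: element_expansion_def sum_subtractf left_diff_distrib)
    qed (intro continuous_intros q)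
    also have "\<dots> \<le> (LINT y:?F|?H. ?W * (\<Sum>k=1..p. ?c k * (?d k y)\<^sup>2))"
    proof (rule set_integral_mono)
      show "set_integrable ?H ?F (\<lambda>y. integral {0..h} (\<lambda>t. (\<Sum>k\<le>p. (\<sigma> ^ k * ?d k y) * t ^ k)\<^sup>2))"
        using h by (intro intF continuous_integral_square continuous_intros cont) auto
      show "set_integrable ?H ?F (\<lambda>y. ?W * (\<Sum>k=1..p. ?c k * (?d k y)\<^sup>2))"
        by (intro intF continuous_intros cont)
      fix y assume y: "y \<in> ?F"
      \<comment> \<open>The coefficients of order 0 are q1 y and q2 y, both equal to the value of v
        at the face point y, so their difference vanishes.\<close>
      note element_expansion_coeff_0[OF e1, of y] element_expansion_coeff_0[OF e2, of y]
      moreover have "q1 y = q2 y" using e1 e2 y by (auto simp: element_expansion_def)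
      ultimately have "integral {0..h} (\<lambda>t. (\<Sum>k\<le>p. (\<sigma> ^ k * ?d k y) * t ^ k)\<^sup>2)
          \<le> ?W * (\<Sum>k=1..p. ?c k * (\<sigma> ^ k * ?d k y)\<^sup>2)"
        using h w by (intro integral_square_weighted_bound) auto
      then show "integral {0..h} (\<lambda>t. (\<Sum>k\<le>p. (\<sigma> ^ k * ?d k y) * t ^ k)\<^sup>2)
          \<le> ?W * (\<Sum>k=1..p. ?c k * (?d k y)\<^sup>2)"
        by (simp only: power_mult_distrib \<sigma> mult_1)
    qed
    also have "\<dots> = ?W * (\<Sum>k=1..p. ?c k * (LINT y:?F|?H. (?d k y)\<^sup>2))"
    proof -
      have I: "set_integrable ?H ?F (\<lambda>y. ?c k * (?d k y)\<^sup>2)" for k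
        by (intro intF continuous_intros cont)
      have "(LINT y:?F|?H. (\<Sum>k=1..p. ?c k * (?d k y)\<^sup>2)) = (\<Sum>k=1..p. LINT y:?F|?H. ?c k * (?d k y)\<^sup>2)"
        using I unfolding set_lebesgue_integral_def set_integrable_def scaleR_sum_right
        by (intro Bochner_Integration.integral_sum)
      then show ?thesis by (simp only: set_integral_mult_right)
    qed
    also have "\<dots> = ?W * face_stab_form h p w ?F v"
    proof -
      have "?c k * (LINT y:?F|?H. (?d k y)\<^sup>2) = w k * (h ^ (2 * k + 1) / (real (2 * k + 1) * (fact k)\<^sup>2)) *
          face_inner ?F (jump n (normal_deriv n k v)) (jump n (normal_deriv n k v))" if "k \<in> {1..p}" for k
      proof -
        have "k \<le> p" using that by simp
        then have "face_inner ?F (jump n (normal_deriv n k v)) (jump n (normal_deriv n k v))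
            = (fact k)\<^sup>2 * (LINT y:?F|?H. (?d k y)\<^sup>2)"
          by (simp only: face_inner_jump[OF s h e1 e2 F] power_mult_distrib set_integral_mult_right)
        then show ?thesis by simp
      qed
      then show ?thesis unfolding face_stab_form_def F by (metis (no_types, lifting) sum.cong)
    qed
    finally show ?thesis .
  qed
  ultimately show ?thesis using split by simp
qed

section \<open>Comparison with the background mass\<close>

text \<open>Double counting: each value of f on B is used at most K times. All multiplicity
  arguments for faces and neighbours below go through this.\<close>

lemma sum_bounded_fibres:
  fixes f :: "'b \<Rightarrow> real"
  assumes "finite A" "finite B" "g ` A \<subseteq> B" "\<And>S. S \<in> B \<Longrightarrow> card {T\<in>A. g T = S} \<le> K"
    and f: "\<And>S. S \<in> B \<Longrightarrow> 0 \<le> f S"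
  shows "(\<Sum>T\<in>A. f (g T)) \<le> real K * (\<Sum>S\<in>B. f S)"
proof -
  have "(\<Sum>T\<in>A. f (g T)) = (\<Sum>S\<in>B. \<Sum>T\<in>{T\<in>A. g T = S}. f (g T))"
    by (rule sum.group[symmetric]) (use assms in auto)
  also have "\<dots> = (\<Sum>S\<in>B. real (card {T\<in>A. g T = S}) * f S)"
    by (intro sum.cong) auto
  also have "\<dots> \<le> (\<Sum>S\<in>B. real K * f S)"
    using assms by (intro sum_mono mult_right_mono) auto
  finally show ?thesis by (simp add: sum_distrib_left)
qed

lemma finite_stab_faces:
  assumes "finite \<T>" shows "finite (stab_faces \<Omega> \<T>)"
proof (rule finite_subset)
  show "stab_faces \<Omega> \<T> \<subseteq> (\<lambda>(S, T). S \<inter> T) ` (\<T> \<times> \<T>)" by (auto simp: stab_faces_def)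
qed (use assms in simp)

lemma stab_faceI:
  assumes "T1 \<in> cut_elements \<Omega> \<T>" "T2 \<in> \<T>" "share_face T1 T2"
  shows "T1 \<inter> T2 \<in> stab_faces \<Omega> \<T>"
  using assms share_face_not_refl[OF assms(3)] by (auto simp: stab_faces_def cut_elements_def)

lemma share_face_meet: "share_face S T \<Longrightarrow> S \<inter> T \<noteq> {}"
  by (auto simp: share_face_def facet_of_def)

lemma grid_union_compact:
  assumes "finite \<T>" "\<T> \<subseteq> cartesian_grid h a"
  shows "compact (\<Union>\<T>)"
proof (rule compact_Union[OF assms(1)])
  fix T assume "T \<in> \<T>"
  then obtain z where "T = hypercube h (grid_corner h a z)" using assms(2) by (meson cartesian_gridE subsetD)
  then show "compact T" by (simp add: compact_hypercube)
qed

lemma fe_space_set_integrable: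
  assumes "finite \<T>" "\<T> \<subseteq> cartesian_grid h a" "u \<in> fe_space p \<T>" "v \<in> fe_space p \<T>"
    and "X \<in> sets borel" "X \<subseteq> \<Union>\<T>"
  shows "set_integrable lborel X (\<lambda>x. u x * v x)"
proof (rule set_integrable_subset)
  show "set_integrable lborel (\<Union>\<T>) (\<lambda>x. u x * v x)"
    using assms by (intro set_integrable_lborel_compact grid_union_compact[of \<T> h a])
      (auto simp: fe_space_def intro!: continuous_on_mult)
qed (use assms in auto)

lemma element_sets: "T \<in> cartesian_grid h a \<Longrightarrow> T \<in> sets borel"
  by (auto elim!: cartesian_gridE intro!: borel_closed compact_imp_closed compact_hypercube)

lemma l2_inner_Union_le:
  assumes fin: "finite \<T>" and grid: "\<T> \<subseteq> cartesian_grid h a" and v: "v \<in> fe_space p \<T>"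
  shows "l2_inner (\<Union>\<T>) v v \<le> (\<Sum>T\<in>\<T>. l2_inner T v v)"
proof -
  have m: "T \<in> sets borel" if "T \<in> \<T>" for T using element_sets grid that by blast
  have U: "\<Union>\<T> \<in> sets borel" using grid_union_compact[OF fin grid] by (intro borel_closed compact_imp_closed)
  have i: "integrable lborel (\<lambda>x. indicat_real X x *\<^sub>R (v x * v x))" if "X \<in> sets borel" "X \<subseteq> \<Union>\<T>" for X
    using fe_space_set_integrable[OF fin grid v v that] unfolding set_integrable_def .
  have iT: "integrable lborel (\<lambda>x. indicat_real T x *\<^sub>R (v x * v x))" if "T \<in> \<T>" for T
    by (rule i) (use m that in auto)
  have "l2_inner (\<Union>\<T>) v v \<le> (LINT x|lborel. (\<Sum>T\<in>\<T>. indicat_real T x *\<^sub>R (v x * v x)))"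
    unfolding l2_inner_def set_lebesgue_integral_def
  proof (rule integral_mono)
    fix x
    have "indicat_real T x *\<^sub>R (v x * v x) \<le> (\<Sum>T\<in>\<T>. indicat_real T x *\<^sub>R (v x * v x))" if "T \<in> \<T>" for T
      using that fin by (intro member_le_sum) auto
    note le = this
    show "indicat_real (\<Union>\<T>) x *\<^sub>R (v x * v x) \<le> (\<Sum>T\<in>\<T>. indicat_real T x *\<^sub>R (v x * v x))"
    proof (cases "x \<in> \<Union>\<T>")
      case True
      then obtain T where "T \<in> \<T>" "x \<in> T" by blast
      then show ?thesis using le[of T] True by simp
    qed (simp add: sum_nonneg)
  next
    show "integrable lborel (\<lambda>x. \<Sum>T\<in>\<T>. indicat_real T x *\<^sub>R (v x * v x))"
      by (rule Bochner_Integration.integrable_sum) (rule iT)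
    show "integrable lborel (\<lambda>x. indicat_real (\<Union>\<T>) x *\<^sub>R (v x * v x))"
      by (rule i[OF U order_refl])
  qed
  also have "\<dots> = (\<Sum>T\<in>\<T>. l2_inner T v v)"
    unfolding l2_inner_def set_lebesgue_integral_def by (rule Bochner_Integration.integral_sum) (rule iT)
  finally show ?thesis .
qed

text \<open>All cubes containing a given point meet any one of them, so the indicators of the
  elements sum to at most 3^d at every point, shared boundaries included.\<close>

lemma sum_l2_inner_le:
  fixes \<T> :: "'a::euclidean_space set set"
  assumes fin: "finite \<T>" and grid: "\<T> \<subseteq> cartesian_grid h a" and h: "h > 0" and v: "v \<in> fe_space p \<T>"
    and S: "\<S> \<subseteq> \<T>" "\<Union>\<S> \<subseteq> X" and X: "X \<in> sets borel" "X \<subseteq> \<Union>\<T>"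
  shows "(\<Sum>T\<in>\<S>. l2_inner T v v) \<le> 3 ^ DIM('a) * l2_inner X v v"
proof -
  have finS: "finite \<S>" using fin S finite_subset by blast
  have m: "T \<in> sets borel" if "T \<in> \<T>" for T using element_sets grid that by blast
  have i: "integrable lborel (\<lambda>x. indicat_real X x *\<^sub>R (v x * v x))" if "X \<in> sets borel" "X \<subseteq> \<Union>\<T>" for X
    using fe_space_set_integrable[OF fin grid v v that] unfolding set_integrable_def .
  have iT: "integrable lborel (\<lambda>x. indicat_real T x *\<^sub>R (v x * v x))" if "T \<in> \<S>" for T
    by (rule i) (use m that S in auto)
  have "(\<Sum>T\<in>\<S>. l2_inner T v v) = (LINT x|lborel. (\<Sum>T\<in>\<S>. indicat_real T x *\<^sub>R (v x * v x)))"
    unfolding l2_inner_def set_lebesgue_integral_def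
    by (rule Bochner_Integration.integral_sum[symmetric]) (rule iT)
  also have "\<dots> \<le> (LINT x|lborel. 3 ^ DIM('a) * (indicat_real X x *\<^sub>R (v x * v x)))"
  proof (rule integral_mono)
    fix x
    have "(\<Sum>T\<in>\<S>. indicat_real T x) = real (card {T\<in>\<S>. x \<in> T})"
      using finS by (simp add: indicator_def sum.If_cases Int_def)
    also have "\<dots> \<le> 3 ^ DIM('a) * indicat_real X x"
    proof (cases "{T\<in>\<S>. x \<in> T} = {}")
      case False
      then obtain T where T: "T \<in> \<S>" "x \<in> T" by blast
      then have x: "x \<in> X" using S by blast
      have nb: "finite {T'\<in>\<T>. T' \<inter> T \<noteq> {}}" "card {T'\<in>\<T>. T' \<inter> T \<noteq> {}} \<le> 3 ^ DIM('a)"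
        using card_grid_neighbours[OF grid _ h, of T] T S grid by blast+
      have "card {T\<in>\<S>. x \<in> T} \<le> card {T'\<in>\<T>. T' \<inter> T \<noteq> {}}"
        by (rule card_mono[OF nb(1)]) (use T S in auto)
      then have "card {T\<in>\<S>. x \<in> T} \<le> 3 ^ DIM('a)" using nb(2) by linarith
      then have "real (card {T\<in>\<S>. x \<in> T}) \<le> 3 ^ DIM('a)"
        by (metis of_nat_le_iff of_nat_numeral of_nat_power)
      then show ?thesis using x by simp
    qed (simp only: card.empty, simp)
    finally have "(\<Sum>T\<in>\<S>. indicat_real T x) * (v x * v x) \<le> (3 ^ DIM('a) * indicat_real X x) * (v x * v x)"
      by (intro mult_right_mono) auto
    then show "(\<Sum>T\<in>\<S>. indicat_real T x *\<^sub>R (v x * v x)) \<le> 3 ^ DIM('a) * (indicat_real X x *\<^sub>R (v x * v x))"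
      by (simp add: sum_distrib_right mult.assoc)
  next
    show "integrable lborel (\<lambda>x. \<Sum>T\<in>\<S>. indicat_real T x *\<^sub>R (v x * v x))"
      by (rule Bochner_Integration.integrable_sum) (rule iT)
    show "integrable lborel (\<lambda>x. 3 ^ DIM('a) * (indicat_real X x *\<^sub>R (v x * v x)))"
      using i[OF X] by simp
  qed
  also have "\<dots> = 3 ^ DIM('a) * l2_inner X v v"
    unfolding l2_inner_def set_lebesgue_integral_def by simp
  finally show ?thesis .
qed

lemma stab_form_self: "stab_form \<Omega> h \<T> p w v v = (\<Sum>F\<in>stab_faces \<Omega> \<T>. face_stab_form h p w F v)"
  by (simp add: stab_form_def face_stab_form_def)

lemma G_weight_nonneg: "(\<And>k. k \<in> {1..p} \<Longrightarrow> 0 < w k) \<Longrightarrow> 0 \<le> G_weight p w"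
  unfolding G_weight_def by (intro sum_nonneg mult_nonneg_nonneg) (auto intro: less_imp_le)

text \<open>The constant 64 is 2 times 32, one share for each side of a face. One factor 3^d counts
  the faces of an element, the other one the overlap of the elements.\<close>

lemma stab_form_le:
  fixes \<T> :: "'a::euclidean_space set set"
  assumes fin: "finite \<T>" and grid: "\<T> \<subseteq> cartesian_grid h a" and h: "h > 0" and v: "v \<in> fe_space p \<T>"
    and w: "\<And>k. k \<in> {1..p} \<Longrightarrow> 0 < w k"
  shows "stab_form \<Omega> h \<T> p w v v \<le> 64 * (3 ^ DIM('a))\<^sup>2 * G_weight p w * l2_inner (\<Union>\<T>) v v"
proof -
  let ?K = "3 ^ DIM('a) :: nat"
  let ?\<F> = "stab_faces \<Omega> \<T>"
  let ?a = "\<lambda>T. l2_inner T v v"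
  \<comment> \<open>\<open>stab_faces\<close> records a face only as a set, so a generating pair of
    elements is chosen for each face.\<close>
  have "\<exists>p. fst p \<in> \<T> \<and> snd p \<in> \<T> \<and> share_face (fst p) (snd p) \<and> F = fst p \<inter> snd p" if F: "F \<in> ?\<F>" for F
  proof -
    obtain T1 T2 where "F = T1 \<inter> T2" "T1 \<in> \<T>" "T2 \<in> \<T>" "share_face T1 T2"
      using F by (auto simp: stab_faces_def)
    then show ?thesis by (intro exI[of _ "(T1, T2)"]) simp
  qed
  then have "\<forall>F\<in>?\<F>. \<exists>p. fst p \<in> \<T> \<and> snd p \<in> \<T> \<and> share_face (fst p) (snd p) \<and> F = fst p \<inter> snd p"
    by (rule ballI)
  from bchoice[OF this] obtain t where t: "\<And>F. F \<in> ?\<F> \<Longrightarrow> fst (t F) \<in> \<T> \<and> snd (t F) \<in> \<T> \<and>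
      share_face (fst (t F)) (snd (t F)) \<and> F = fst (t F) \<inter> snd (t F)"
    by blast
  \<comment> \<open>A face assigned to S has the form S \<inter> T with T meeting S, so the
    neighbours of S count such faces.\<close>
  have fibre: "card {F\<in>?\<F>. g F = S} \<le> ?K"
    if S: "S \<in> \<T>" and g: "\<And>F. F \<in> ?\<F> \<Longrightarrow> \<exists>T\<in>\<T>. F = g F \<inter> T \<and> F \<noteq> {}" for g S
  proof -
    have nb: "finite {T'\<in>\<T>. T' \<inter> S \<noteq> {}}" "card {T'\<in>\<T>. T' \<inter> S \<noteq> {}} \<le> ?K"
      using card_grid_neighbours[OF grid _ h, of S] S grid by blast+
    have "card {F\<in>?\<F>. g F = S} \<le> card {T'\<in>\<T>. T' \<inter> S \<noteq> {}}"
    proof (rule surj_card_le[OF nb(1), of _ "\<lambda>T. S \<inter> T"], rule subsetI)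
      fix F assume "F \<in> {F\<in>?\<F>. g F = S}"
      then obtain T where "T \<in> \<T>" "F = S \<inter> T" "F \<noteq> {}" using g[of F] by blast
      then show "F \<in> (\<lambda>T. S \<inter> T) ` {T'\<in>\<T>. T' \<inter> S \<noteq> {}}" by blast
    qed
    then show ?thesis using nb(2) by linarith
  qed
  have sums: "(\<Sum>F\<in>?\<F>. ?a (g F)) \<le> real ?K * (\<Sum>T\<in>\<T>. ?a T)"
    if g: "\<And>F. F \<in> ?\<F> \<Longrightarrow> g F \<in> \<T> \<and> (\<exists>T\<in>\<T>. F = g F \<inter> T \<and> F \<noteq> {})" for g
    by (rule sum_bounded_fibres) (use g fin fibre[of _ g] finite_stab_faces[OF fin, of \<Omega>] in \<open>auto simp: l2_inner_self_nonneg image_subset_iff\<close>)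
  have ne: "F \<noteq> {}" if "F \<in> ?\<F>" for F using t[OF that] share_face_meet by metis
  have 1: "(\<Sum>F\<in>?\<F>. ?a (fst (t F))) \<le> real ?K * (\<Sum>T\<in>\<T>. ?a T)"
    by (rule sums) (use t ne in metis)
  have 2: "(\<Sum>F\<in>?\<F>. ?a (snd (t F))) \<le> real ?K * (\<Sum>T\<in>\<T>. ?a T)"
    by (rule sums) (use t ne in \<open>metis Int_commute\<close>)
  have G: "0 \<le> G_weight p w" using w by (rule G_weight_nonneg)
  have "stab_form \<Omega> h \<T> p w v v \<le> (\<Sum>F\<in>?\<F>. 32 * G_weight p w * (?a (fst (t F)) + ?a (snd (t F))))"
    unfolding stab_form_self
  proof (rule sum_mono)
    fix F assume F: "F \<in> ?\<F>"
    then show "face_stab_form h p w F v \<le> 32 * G_weight p w * (?a (fst (t F)) + ?a (snd (t F)))"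
      using face_stab_form_le[OF _ _ grid _ h w v, of "fst (t F)" "snd (t F)"] t[OF F] by simp
  qed
  also have "\<dots> = 32 * G_weight p w * ((\<Sum>F\<in>?\<F>. ?a (fst (t F))) + (\<Sum>F\<in>?\<F>. ?a (snd (t F))))"
    by (simp only: sum_distrib_left[symmetric] sum.distrib)
  also have "\<dots> \<le> 32 * G_weight p w * (real ?K * (\<Sum>T\<in>\<T>. ?a T) + real ?K * (\<Sum>T\<in>\<T>. ?a T))"
    using 1 2 G by (intro mult_left_mono add_mono) auto
  also have "\<dots> = (64 * 3 ^ DIM('a) * G_weight p w) * (\<Sum>T\<in>\<T>. ?a T)" by simp
  also have "\<dots> \<le> (64 * 3 ^ DIM('a) * G_weight p w) * (3 ^ DIM('a) * l2_inner (\<Union>\<T>) v v)"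
    using G grid_union_compact[OF fin grid]
    by (intro mult_left_mono sum_l2_inner_le[OF fin grid h v]) (auto intro: borel_closed compact_imp_closed)
  finally show ?thesis by (simp add: power2_eq_square mult_ac)
qed

text \<open>The elements that reach an uncut element by crossing at most m faces, with only cut
  elements before the last one. Induction over m replaces following the individual chains of
  \<open>well_resolved\<close>.\<close>

primrec layer :: "'a::euclidean_space set \<Rightarrow> 'a set set \<Rightarrow> nat \<Rightarrow> 'a set set" where
  "layer \<Omega> \<T> 0 = \<T> - cut_elements \<Omega> \<T>"
| "layer \<Omega> \<T> (Suc m) = layer \<Omega> \<T> m \<union> {T\<in>cut_elements \<Omega> \<T>. \<exists>T'\<in>layer \<Omega> \<T> m. share_face T T'}"

lemma layer_subset: "layer \<Omega> \<T> m \<subseteq> \<T>"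
  by (induction m) (auto simp: cut_elements_def)

lemma layer_mono: "m \<le> m' \<Longrightarrow> layer \<Omega> \<T> m \<subseteq> layer \<Omega> \<T> m'"
  by (rule lift_Suc_mono_le[of "layer \<Omega> \<T>"]) auto

text \<open>The chain is read from its uncut end: the element i steps before the end belongs to
  layer i.\<close>

lemma well_resolved_layer:
  assumes "well_resolved N_J \<Omega> \<T>"
  shows "\<T> \<subseteq> layer \<Omega> \<T> N_J"
proof
  fix T0 assume T0: "T0 \<in> \<T>"
  show "T0 \<in> layer \<Omega> \<T> N_J"
  proof (cases "T0 \<in> cut_elements \<Omega> \<T>")
    case False
    then show ?thesis using T0 layer_mono[of 0 N_J \<Omega> \<T>] by auto
  next
    case True
    then obtain N T where N: "1 \<le> N" "N \<le> N_J" "T 0 = T0" "\<forall>i\<in>{1..<N}. T i \<in> cut_elements \<Omega> \<T>"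
      "T N \<in> \<T> - cut_elements \<Omega> \<T>" "\<forall>i\<in>{1..N}. share_face (T (i - 1)) (T i)"
      using assms unfolding well_resolved_def by metis
    have "T (N - i) \<in> layer \<Omega> \<T> i" if "i \<le> N" for i
      using that
    proof (induction i)
      case 0
      then show ?case using N by simp
    next
      case (Suc i)
      have "T (N - Suc i) \<in> cut_elements \<Omega> \<T>"
        using True N Suc.prems by (cases "N - Suc i = 0") auto
      moreover have "share_face (T (N - Suc i)) (T (N - i))"
        using N(6)[rule_format, of "N - i"] Suc.prems by simp
      ultimately show ?case using Suc by auto
    qed
    from this[of N] have "T0 \<in> layer \<Omega> \<T> N" using N by simp
    then show ?thesis using layer_mono[OF N(2)] by blast
  qed
qed

text \<open>Every element joining the layer picks a parent in the old one. A parent has at most 3^d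
  children and a face serves at most 3^d children, so summing the neighbour estimate costs one
  factor 3^d.\<close>

lemma layer_step:
  fixes \<T> :: "'a::euclidean_space set set"
  assumes fin: "finite \<T>" and grid: "\<T> \<subseteq> cartesian_grid h a" and h: "h > 0" and v: "v \<in> fe_space p \<T>"
    and w: "\<And>k. k \<in> {1..p} \<Longrightarrow> 0 < w k" and C: "neighbour_const TYPE('a) p (C\<^sub>1 p)" and C1: "1 \<le> C\<^sub>1 p"
  shows "(\<Sum>T\<in>layer \<Omega> \<T> (Suc m). l2_inner T v v) + stab_form \<Omega> h \<T> p w v v
    \<le> (6 * 3 ^ DIM('a) * L_weight C\<^sub>1 p w) *
      ((\<Sum>T\<in>layer \<Omega> \<T> m. l2_inner T v v) + stab_form \<Omega> h \<T> p w v v)"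
proof -
  let ?K = "3 ^ DIM('a) :: nat"
  let ?L = "L_weight C\<^sub>1 p w"
  let ?W = "\<Sum>k=1..p. 1 / w k"
  let ?a = "\<lambda>T. l2_inner T v v"
  let ?j = "\<lambda>F. face_stab_form h p w F v"
  let ?J = "stab_form \<Omega> h \<T> p w v v"
  let ?S = "layer \<Omega> \<T> m"
  \<comment> \<open>This set may overlap the old layer; masses are nonnegative, so the sum over the
    union is still at most the sum of the two sums.\<close>
  define D where "D = {T\<in>cut_elements \<Omega> \<T>. \<exists>T'\<in>?S. share_face T T'}"
  have "\<exists>g. \<forall>T\<in>D. g T \<in> ?S \<and> share_face T (g T)" by (intro bchoice) (auto simp: D_def)
  then obtain g where g: "\<And>T. T \<in> D \<Longrightarrow> g T \<in> ?S \<and> share_face T (g T)" by blast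
  have DT: "D \<subseteq> \<T>" by (auto simp: D_def cut_elements_def)
  have finD: "finite D" using fin DT finite_subset by blast
  have finS: "finite ?S" using fin layer_subset finite_subset by metis
  have W: "0 \<le> ?W" using w by (intro sum_nonneg) (auto intro: less_imp_le)
  have L: "1 \<le> ?L" using C1 W by (simp add: L_weight_def)
  have j: "0 \<le> ?j F" for F using w h by (rule face_stab_form_nonneg)
  have J: "0 \<le> ?J" unfolding stab_form_self using j by (simp add: sum_nonneg)
  have A: "0 \<le> (\<Sum>T\<in>?S. ?a T)" by (simp add: sum_nonneg l2_inner_self_nonneg)
  have K: "1 \<le> real ?K" by simp
  have nb: "finite {T'\<in>\<T>. T' \<inter> S \<noteq> {}}" "card {T'\<in>\<T>. T' \<inter> S \<noteq> {}} \<le> ?K" if "S \<in> \<T>" for S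
    using card_grid_neighbours[OF grid _ h, of S] that grid by blast+
  have step: "?a T \<le> 2 * ?L * (?a (g T) + ?j (T \<inter> g T))" if T: "T \<in> D" for T
  proof -
    have "?a T \<le> 2 * C\<^sub>1 p * ?a (g T) + 2 * ?W * ?j (T \<inter> g T)"
      using g[OF T] T DT layer_subset by (intro l2_inner_neighbour_le[OF _ _ grid _ h w v C]) blast+
    also have "\<dots> \<le> 2 * ?L * ?a (g T) + 2 * ?L * ?j (T \<inter> g T)"
      using W C1 j l2_inner_self_nonneg by (intro add_mono mult_right_mono mult_left_mono) (auto simp: L_weight_def)
    finally show ?thesis by (simp add: distrib_left)
  qed
  have 1: "(\<Sum>T\<in>D. ?a (g T)) \<le> real ?K * (\<Sum>T\<in>?S. ?a T)"
  proof (rule sum_bounded_fibres[OF finD finS])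
    show "card {T\<in>D. g T = S} \<le> ?K" if S: "S \<in> ?S" for S
    proof -
      have ST: "S \<in> \<T>" using S layer_subset by blast
      have "{T\<in>D. g T = S} \<subseteq> {T'\<in>\<T>. T' \<inter> S \<noteq> {}}" using g share_face_meet DT by blast
      then show ?thesis using card_mono[OF nb(1)[OF ST]] nb(2)[OF ST] order_trans by blast
    qed
  qed (use g in \<open>auto simp: l2_inner_self_nonneg\<close>)
  have 2: "(\<Sum>T\<in>D. ?j (T \<inter> g T)) \<le> real ?K * ?J"
    unfolding stab_form_self
  proof (rule sum_bounded_fibres[OF finD finite_stab_faces[OF fin]])
    show "(\<lambda>T. T \<inter> g T) ` D \<subseteq> stab_faces \<Omega> \<T>"
      using g layer_subset[of \<Omega> \<T> m] by (auto simp: D_def intro!: stab_faceI)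
    \<comment> \<open>All elements counted here contain the nonempty face F, hence meet the fixed
      element S.\<close>
    show "card {T\<in>D. T \<inter> g T = F} \<le> ?K" for F
    proof (cases "{T\<in>D. T \<inter> g T = F} = {}")
      case False
      then obtain S where S: "S \<in> D" "S \<inter> g S = F" by blast
      have ST: "S \<in> \<T>" using S DT by blast
      have "F \<noteq> {}" using S g share_face_meet by blast
      then have "{T\<in>D. T \<inter> g T = F} \<subseteq> {T'\<in>\<T>. T' \<inter> S \<noteq> {}}" using S DT by blast
      then show ?thesis using card_mono[OF nb(1)[OF ST]] nb(2)[OF ST] order_trans by blast
    qed (simp only: card.empty)
  qed (rule j)
  have "(\<Sum>T\<in>layer \<Omega> \<T> (Suc m). ?a T) \<le> (\<Sum>T\<in>?S. ?a T) + (\<Sum>T\<in>D. ?a T)"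
    unfolding layer.simps D_def[symmetric] using sum.union_inter[OF finS finD, of ?a]
      sum_nonneg[of "?S \<inter> D" ?a] l2_inner_self_nonneg by fastforce
  also have "(\<Sum>T\<in>D. ?a T) \<le> 2 * ?L * ((\<Sum>T\<in>D. ?a (g T)) + (\<Sum>T\<in>D. ?j (T \<inter> g T)))"
    unfolding sum.distrib[symmetric] sum_distrib_left by (rule sum_mono) (rule step)
  also have "\<dots> \<le> 2 * ?L * (real ?K * (\<Sum>T\<in>?S. ?a T) + real ?K * ?J)"
    using 1 2 L by (intro mult_left_mono add_mono) auto
  also have "\<dots> = 2 * (real ?K * ?L) * ((\<Sum>T\<in>?S. ?a T) + ?J)"
    by (simp add: algebra_simps)
  finally have "(\<Sum>T\<in>layer \<Omega> \<T> (Suc m). ?a T) + ?J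
      \<le> ((\<Sum>T\<in>?S. ?a T) + ?J) + 2 * (real ?K * ?L) * ((\<Sum>T\<in>?S. ?a T) + ?J)" by simp
  \<comment> \<open>The old layer and the penalty are absorbed using
    \<open>1 \<le> real ?K * ?L\<close>; the 4 is a generous choice that makes the final constant
    6.\<close>
  also have "\<dots> \<le> (4 * (real ?K * ?L)) * ((\<Sum>T\<in>?S. ?a T) + ?J) + 2 * (real ?K * ?L) * ((\<Sum>T\<in>?S. ?a T) + ?J)"
  proof -
    have "1 * 1 \<le> real ?K * ?L" by (rule mult_mono[OF K L]) auto
    then have "1 * ((\<Sum>T\<in>?S. ?a T) + ?J) \<le> (4 * (real ?K * ?L)) * ((\<Sum>T\<in>?S. ?a T) + ?J)"
      using A J by (intro mult_right_mono) auto
    then show ?thesis by (simp only: mult_1 add_le_cancel_right)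
  qed
  also have "\<dots> = (6 * 3 ^ DIM('a) * ?L) * ((\<Sum>T\<in>?S. ?a T) + ?J)" by (simp add: algebra_simps)
  finally show ?thesis .
qed

text \<open>Layer 0 consists of uncut elements and so lies in \<Omega>; this is where the mass on
  \<Omega> enters. Iterating \<open>layer_step\<close> up to \<open>N_J\<close> produces the power
  of L.\<close>

lemma background_mass_le:
  fixes \<T> :: "'a::euclidean_space set set"
  assumes mesh: "background_mesh \<Omega> h \<T>" and \<Omega>: "open \<Omega>" and h: "h > 0" and v: "v \<in> fe_space p \<T>"
    and w: "\<And>k. k \<in> {1..p} \<Longrightarrow> 0 < w k" and C: "neighbour_const TYPE('a) p (C\<^sub>1 p)" and C1: "1 \<le> C\<^sub>1 p"
    and res: "well_resolved N_J \<Omega> \<T>"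
  shows "l2_inner (\<Union>\<T>) v v
    \<le> (6 * 3 ^ DIM('a) * L_weight C\<^sub>1 p w) ^ N_J * 3 ^ DIM('a) * (l2_inner \<Omega> v v + stab_form \<Omega> h \<T> p w v v)"
proof -
  obtain a where fin: "finite \<T>" and grid: "\<T> \<subseteq> cartesian_grid h a" and cover: "\<Omega> \<subseteq> \<Union>\<T>"
    using mesh by (auto simp: background_mesh_def)
  let ?L = "6 * 3 ^ DIM('a) * L_weight C\<^sub>1 p w"
  let ?J = "stab_form \<Omega> h \<T> p w v v"
  let ?A = "\<lambda>m. \<Sum>T\<in>layer \<Omega> \<T> m. l2_inner T v v"
  have W: "0 \<le> (\<Sum>k=1..p. 1 / w k)" using w by (intro sum_nonneg) (auto intro: less_imp_le)
  have L: "0 \<le> ?L" using C1 W by (simp add: L_weight_def)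
  have "0 \<le> face_stab_form h p w F v" for F using w h by (rule face_stab_form_nonneg)
  then have J: "0 \<le> ?J" unfolding stab_form_self by (simp add: sum_nonneg)
  have iter: "?A m + ?J \<le> ?L ^ m * (?A 0 + ?J)" for m
  proof (induction m)
    case (Suc m)
    have "?A (Suc m) + ?J \<le> ?L * (?A m + ?J)" by (rule layer_step[where C\<^sub>1 = C\<^sub>1, OF fin grid h v w C C1])
    also have "\<dots> \<le> ?L * (?L ^ m * (?A 0 + ?J))" using Suc L by (intro mult_left_mono)
    finally show ?case by (simp only: power_Suc mult.assoc)
  qed simp
  have "\<Union>(layer \<Omega> \<T> 0) \<subseteq> \<Omega>" using uncut_subset[OF mesh] by auto
  then have A0: "?A 0 \<le> 3 ^ DIM('a) * l2_inner \<Omega> v v"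
    by (intro sum_l2_inner_le[OF fin grid h v] layer_subset cover) (use \<Omega> in auto)
  have "l2_inner (\<Union>\<T>) v v \<le> (\<Sum>T\<in>\<T>. l2_inner T v v)" by (rule l2_inner_Union_le[OF fin grid v])
  also have "\<dots> = ?A N_J"
    using well_resolved_layer[OF res] layer_subset[of \<Omega> \<T> N_J] by (intro sum.cong) auto
  also have "?A N_J \<le> ?L ^ N_J * (?A 0 + ?J)" using iter[of N_J] J by linarith
  also have "\<dots> \<le> ?L ^ N_J * (3 ^ DIM('a) * l2_inner \<Omega> v v + 3 ^ DIM('a) * ?J)"
  proof -
    have "1 * ?J \<le> 3 ^ DIM('a) * ?J" using J by (intro mult_right_mono) auto
    then show ?thesis using A0 L by (intro mult_left_mono add_mono) auto
  qed
  finally show ?thesis by (simp only: distrib_left mult.assoc)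
qed

section \<open>The condition number\<close>

lemma fe_space_lincomb:
  fixes f :: "nat \<Rightarrow> 'a::euclidean_space \<Rightarrow> real"
  assumes "\<And>i. i < N \<Longrightarrow> f i \<in> fe_space p \<T>"
  shows "(\<lambda>y. \<Sum>i<N. x i * f i y) \<in> fe_space p \<T>"
  unfolding fe_space_def
proof (intro CollectI conjI ballI)
  show "continuous_on (\<Union>\<T>) (\<lambda>y. \<Sum>i<N. x i * f i y)"
    using assms by (intro continuous_intros) (auto simp: fe_space_def)
  fix T assume T: "T \<in> \<T>"
  have "\<exists>q. \<forall>i\<in>{..<N}. q i \<in> Q_poly p \<and> (\<forall>y\<in>T. f i y = q i y)"
  proof (intro bchoice ballI)
    fix i assume "i \<in> {..<N}"
    then have "f i \<in> fe_space p \<T>" using assms by simp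
    then show "\<exists>q. q \<in> Q_poly p \<and> (\<forall>y\<in>T. f i y = q y)" using T unfolding fe_space_def by blast
  qed
  then obtain q where q: "\<And>i. i < N \<Longrightarrow> q i \<in> Q_poly p" "\<And>i y. i < N \<Longrightarrow> y \<in> T \<Longrightarrow> f i y = q i y" by auto
  show "\<exists>q\<in>Q_poly p. \<forall>y\<in>T. (\<Sum>i<N. x i * f i y) = q y"
    by (rule bexI[of _ "\<lambda>y. \<Sum>i<N. x i * q i y"]) (use q in \<open>auto intro!: Q_poly_lincomb\<close>)
qed

text \<open>\<open>deriv\<close> and \<open>Lim\<close> are not linear on arbitrary functions. On
  the finite element space jumps are differences of expansion coefficients, so linearity of the jump
  is obtained from linearity of the expansion.\<close>

lemma element_expansion_lincomb:
  assumes "\<And>i. i < N \<Longrightarrow> element_expansion n p (f i) T (q i) (e i)"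
  shows "element_expansion n p (\<lambda>y. \<Sum>i<N. x i * f i y) T (\<lambda>y. \<Sum>i<N. x i * q i y) (\<lambda>k y. \<Sum>i<N. x i * e i k y)"
  unfolding element_expansion_def
proof (intro conjI ballI allI)
  show "(\<lambda>y. \<Sum>i<N. x i * q i y) \<in> Q_poly p"
    by (rule Q_poly_lincomb) (use assms in \<open>auto simp: element_expansion_def\<close>)
  show "(\<Sum>i<N. x i * f i y) = (\<Sum>i<N. x i * q i y)" if "y \<in> T" for y
    using assms that by (intro sum.cong) (auto simp: element_expansion_def)
  show "continuous_on UNIV (\<lambda>y. \<Sum>i<N. x i * e i k y)" for k
    using assms by (intro continuous_intros) (auto simp: element_expansion_def)
  fix y t
  have "(\<Sum>i<N. x i * q i (y + t *\<^sub>R n)) = (\<Sum>i<N. \<Sum>k\<le>p. x i * e i k y * t ^ k)"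
    using assms by (intro sum.cong refl) (simp add: element_expansion_def sum_distrib_left mult.assoc)
  also have "\<dots> = (\<Sum>k\<le>p. (\<Sum>i<N. x i * e i k y) * t ^ k)"
    unfolding sum_distrib_right by (rule sum.swap)
  finally show "(\<Sum>i<N. x i * q i (y + t *\<^sub>R n)) = (\<Sum>k\<le>p. (\<Sum>i<N. x i * e i k y) * t ^ k)" .
qed

text \<open>The linear relation is asked for on X only, because jumps are known explicitly only at
  points of the face.\<close>

lemma set_integral_quadratic:
  fixes f :: "nat \<Rightarrow> 'b \<Rightarrow> real"
  assumes X: "X \<in> sets M" and g: "\<And>y. y \<in> X \<Longrightarrow> g y = (\<Sum>i<N. x i * f i y)"
    and int: "\<And>i j. i < N \<Longrightarrow> j < N \<Longrightarrow> set_integrable M X (\<lambda>y. f i y * f j y)"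
  shows "(LINT y:X|M. g y * g y) = (\<Sum>i<N. \<Sum>j<N. (LINT y:X|M. f i y * f j y) * x i * x j)"
proof -
  have I: "integrable M (\<lambda>y. x i * x j * (indicat_real X y *\<^sub>R (f i y * f j y)))" if "i < N" "j < N" for i j
    using int[OF that] unfolding set_integrable_def by simp
  have "indicat_real X y *\<^sub>R (g y * g y) = (\<Sum>i<N. \<Sum>j<N. x i * x j * (indicat_real X y *\<^sub>R (f i y * f j y)))" for y
    by (cases "y \<in> X") (simp_all add: g sum_product mult_ac)
  then have "(LINT y:X|M. g y * g y) = (\<Sum>i<N. \<Sum>j<N. LINT y|M. x i * x j * (indicat_real X y *\<^sub>R (f i y * f j y)))"
    unfolding set_lebesgue_integral_def
    by (simp only:) (subst Bochner_Integration.integral_sum, (intro Bochner_Integration.integrable_sum I; simp),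
      intro sum.cong refl Bochner_Integration.integral_sum I, simp_all)
  then show ?thesis by (simp add: set_lebesgue_integral_def mult_ac)
qed

lemma l2_inner_quadratic:
  fixes N :: nat
  assumes "finite \<T>" "\<T> \<subseteq> cartesian_grid h a" "\<And>i. i < N \<Longrightarrow> \<phi> i \<in> fe_space p \<T>"
    and "X \<in> sets borel" "X \<subseteq> \<Union>\<T>"
  shows "l2_inner X (\<lambda>y. \<Sum>i<N. x i * \<phi> i y) (\<lambda>y. \<Sum>i<N. x i * \<phi> i y)
    = (\<Sum>i<N. \<Sum>j<N. l2_inner X (\<phi> i) (\<phi> j) * x i * x j)"
  unfolding l2_inner_def
  by (rule set_integral_quadratic) (use assms in \<open>auto intro: fe_space_set_integrable\<close>)

lemma face_inner_quadratic:
  fixes \<T> :: "'a::euclidean_space set set" and N :: nat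
  assumes T: "T1 \<in> \<T>" "T2 \<in> \<T>" "\<T> \<subseteq> cartesian_grid h a" and sf: "share_face T1 T2" and h: "h > 0"
    and \<phi>: "\<And>i. i < N \<Longrightarrow> \<phi> i \<in> fe_space p \<T>" and k: "k \<le> p" and F: "F = T1 \<inter> T2"
    and J: "J = (\<lambda>v. jump (face_normal F) (normal_deriv (face_normal F) k v))"
  shows "face_inner F (J (\<lambda>y. \<Sum>i<N. x i * \<phi> i y)) (J (\<lambda>y. \<Sum>i<N. x i * \<phi> i y))
    = (\<Sum>i<N. \<Sum>j<N. face_inner F (J (\<phi> i)) (J (\<phi> j)) * x i * x j)"
proof -
  obtain n c \<sigma> where s: "slab n c h \<sigma> F T1" "slab n c h (- \<sigma>) F T2"
    and Fn: "face_normal F = n" "face_offset F = c"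
    using share_face_grid[OF _ _ h sf] T F by blast
  have n: "n \<in> Basis" using s by (simp add: slab_def)
  have "\<exists>q e. element_expansion n p (\<phi> i) T q e" if "i < N" "T \<in> \<T>" for i T
    using fe_space_element_expansion[OF \<phi>[OF that(1)] that(2) n] by blast
  then obtain q e where e: "\<And>i T. i < N \<Longrightarrow> T \<in> \<T> \<Longrightarrow> element_expansion n p (\<phi> i) T (q i T) (e i T)" by metis
  let ?v = "\<lambda>y. \<Sum>i<N. x i * \<phi> i y"
  let ?g = "\<lambda>i y. \<sigma> * (fact k * (e i T1 k y - e i T2 k y))"
  have Ji: "J (\<phi> i) y = ?g i y" if "i < N" "y \<in> F" for i y
    unfolding J Fn by (rule jump_between_slabs[OF s h e[OF that(1) T(1)] e[OF that(1) T(2)] that(2) k])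
  have Jv: "J ?v y = (\<Sum>i<N. x i * J (\<phi> i) y)" if y: "y \<in> F" for y
  proof -
    have "J ?v y = \<sigma> * (fact k * ((\<Sum>i<N. x i * e i T1 k y) - (\<Sum>i<N. x i * e i T2 k y)))"
      unfolding J Fn
      by (rule jump_between_slabs[OF s h element_expansion_lincomb element_expansion_lincomb y k])
        (use e T in auto)
    also have "\<dots> = (\<Sum>i<N. x i * ?g i y)"
      by (simp add: sum_distrib_left sum_subtractf[symmetric] algebra_simps)
    finally show ?thesis using Ji y by simp
  qed
  have Fm: "F \<in> sets (hyperplane_measure n c)" using slab_sets(2)[OF s(1)] by simp
  show ?thesis
    unfolding face_inner_def Fn
  proof (rule set_integral_quadratic[OF Fm Jv])
    fix i j assume ij: "i < N" "j < N"
    have "set_integrable (hyperplane_measure n c) F (\<lambda>y. ?g i y * ?g j y)"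
      using element_expansion_continuous(1)[OF e] ij T
      by (intro set_integrable_slab_face[OF s(1)] continuous_intros) auto
    then show "set_integrable (hyperplane_measure n c) F (\<lambda>y. J (\<phi> i) y * J (\<phi> j) y)"
      by (subst set_integrable_cong[OF refl refl, where f' = "\<lambda>y. ?g i y * ?g j y"]) (use ij Ji in auto)
  qed
qed

lemma stab_form_quadratic:
  fixes \<T> :: "'a::euclidean_space set set" and N :: nat
  assumes grid: "\<T> \<subseteq> cartesian_grid h a" and h: "h > 0"
    and \<phi>: "\<And>i. i < N \<Longrightarrow> \<phi> i \<in> fe_space p \<T>"
  shows "stab_form \<Omega> h \<T> p w (\<lambda>y. \<Sum>i<N. x i * \<phi> i y) (\<lambda>y. \<Sum>i<N. x i * \<phi> i y)
    = (\<Sum>i<N. \<Sum>j<N. stab_form \<Omega> h \<T> p w (\<phi> i) (\<phi> j) * x i * x j)"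
proof -
  let ?c = "\<lambda>k. w k * (h ^ (2 * k + 1) / (real (2 * k + 1) * (fact k)\<^sup>2))"
  let ?J = "\<lambda>F k v. jump (face_normal F) (normal_deriv (face_normal F) k v)"
  let ?v = "\<lambda>y. \<Sum>i<N. x i * \<phi> i y"
  let ?S = "stab_faces \<Omega> \<T>"
  have "stab_form \<Omega> h \<T> p w ?v ?v = (\<Sum>F\<in>?S. \<Sum>k=1..p. ?c k *
      (\<Sum>i<N. \<Sum>j<N. face_inner F (?J F k (\<phi> i)) (?J F k (\<phi> j)) * x i * x j))"
    unfolding stab_form_def
  proof (intro sum.cong refl)
    fix F k assume F: "F \<in> ?S" and k: "k \<in> {1..p}"
    obtain T1 T2 where T: "T1 \<in> \<T>" "T2 \<in> \<T>" "share_face T1 T2" "F = T1 \<inter> T2"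
      using F by (auto simp: stab_faces_def)
    show "?c k * face_inner F (?J F k ?v) (?J F k ?v)
      = ?c k * (\<Sum>i<N. \<Sum>j<N. face_inner F (?J F k (\<phi> i)) (?J F k (\<phi> j)) * x i * x j)"
      using face_inner_quadratic[OF T(1,2) grid T(3) h \<phi> _ T(4) refl, where k = k and x = x] k by simp
  qed
  also have "\<dots> = (\<Sum>i<N. \<Sum>j<N. \<Sum>F\<in>?S. \<Sum>k=1..p. ?c k * face_inner F (?J F k (\<phi> i)) (?J F k (\<phi> j)) * x i * x j)"
    by (simp only: sum_distrib_left mult.assoc sum.swap[of _ "{..<N}" "{1..p}"] sum.swap[of _ "{..<N}" ?S])
  finally show ?thesis
    by (simp only: stab_form_def sum_distrib_right)
qed

lemma quad_form_stab_mass_matrix: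
  fixes \<T> :: "'a::euclidean_space set set"
  assumes fin: "finite \<T>" and grid: "\<T> \<subseteq> cartesian_grid h a" and h: "h > 0"
    and \<phi>: "\<And>i. i < N \<Longrightarrow> \<phi> i \<in> fe_space p \<T>" and X: "\<Omega> \<in> sets borel" "\<Omega> \<subseteq> \<Union>\<T>"
  shows "quad_form (stab_mass_matrix \<Omega> h \<T> \<gamma> p w N \<phi>) N x
    = stab_mass_form \<Omega> h \<T> \<gamma> p w (\<lambda>y. \<Sum>i<N. x i * \<phi> i y) (\<lambda>y. \<Sum>i<N. x i * \<phi> i y)"
proof -
  let ?v = "\<lambda>y. \<Sum>i<N. x i * \<phi> i y"
  have "quad_form (stab_mass_matrix \<Omega> h \<T> \<gamma> p w N \<phi>) N x
    = (\<Sum>i<N. \<Sum>j<N. l2_inner \<Omega> (\<phi> i) (\<phi> j) * x i * x j + \<gamma> * (stab_form \<Omega> h \<T> p w (\<phi> i) (\<phi> j) * x i * x j))"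
    by (simp add: quad_form_def stab_mass_matrix_def stab_mass_form_def algebra_simps)
  also have "\<dots> = (\<Sum>i<N. \<Sum>j<N. l2_inner \<Omega> (\<phi> i) (\<phi> j) * x i * x j)
      + \<gamma> * (\<Sum>i<N. \<Sum>j<N. stab_form \<Omega> h \<T> p w (\<phi> i) (\<phi> j) * x i * x j)"
    by (simp only: sum.distrib sum_distrib_left[symmetric])
  also have "(\<Sum>i<N. \<Sum>j<N. l2_inner \<Omega> (\<phi> i) (\<phi> j) * x i * x j) = l2_inner \<Omega> ?v ?v"
    by (rule l2_inner_quadratic[OF fin grid \<phi> X, symmetric])
  also have "(\<Sum>i<N. \<Sum>j<N. stab_form \<Omega> h \<T> p w (\<phi> i) (\<phi> j) * x i * x j) = stab_form \<Omega> h \<T> p w ?v ?v"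
    by (rule stab_form_quadratic[OF grid h \<phi>, symmetric])
  finally show ?thesis unfolding stab_mass_form_def .
qed

lemma quad_form_background_mass_matrix:
  assumes "finite \<T>" "\<T> \<subseteq> cartesian_grid h a" "\<And>i. i < N \<Longrightarrow> \<phi> i \<in> fe_space p \<T>"
  shows "quad_form (background_mass_matrix \<T> N \<phi>) N x
    = l2_inner (\<Union>\<T>) (\<lambda>y. \<Sum>i<N. x i * \<phi> i y) (\<lambda>y. \<Sum>i<N. x i * \<phi> i y)"
proof -
  have "\<Union>\<T> \<in> sets borel"
    using grid_union_compact[OF assms(1,2)] by (intro borel_closed compact_imp_closed)
  then show ?thesis
    by (simp add: quad_form_def background_mass_matrix_def l2_inner_quadratic[OF assms _ order_refl])
qed

lemma l2_inner_commute: "l2_inner X u v = l2_inner X v u"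
  by (simp add: l2_inner_def mult.commute)

lemma stab_form_commute: "stab_form \<Omega> h \<T> p w u v = stab_form \<Omega> h \<T> p w v u"
  by (simp add: stab_form_def face_inner_def mult.commute)

section \<open>Nonemptiness of the basis and positive definiteness of the background mass
  matrix\<close>

lemma element_nodes_subset:
  assumes "h > 0" shows "element_nodes p h T \<subseteq> T"
proof
  fix x assume "x \<in> element_nodes p h T"
  then obtain a s where x: "x = a + (\<Sum>b\<in>Basis. (h * (1 + s b) / 2) *\<^sub>R b)" "T = hypercube h a"
    and s: "\<And>b. b \<in> Basis \<Longrightarrow> s b \<in> gauss_lobatto p"
    by (auto simp: element_nodes_def)
  have "a \<bullet> b \<le> x \<bullet> b \<and> x \<bullet> b \<le> a \<bullet> b + h" if b: "b \<in> Basis" for b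
  proof -
    have xb: "x \<bullet> b = a \<bullet> b + h * ((1 + s b) / 2)"
      using b by (simp add: x inner_add_left inner_sum_left inner_Basis if_distrib cong: if_cong)
    have "0 \<le> (1 + s b) / 2" "(1 + s b) / 2 \<le> 1" using s[OF b] by (auto simp: gauss_lobatto_def)
    then have "0 \<le> h * ((1 + s b) / 2)" "h * ((1 + s b) / 2) \<le> h * 1"
      using assms by (auto intro!: mult_nonneg_nonneg mult_left_mono)
    then show ?thesis unfolding xb by linarith
  qed
  then show "x \<in> T" by (simp add: x(2) mem_hypercube)
qed

lemma mesh_nodes_nonempty:
  assumes "T \<in> \<T>" "\<T> \<subseteq> cartesian_grid h a"
  shows "mesh_nodes p h \<T> \<noteq> {}"
proof -
  obtain z where "T = hypercube h (grid_corner h a z)" using assms by (meson cartesian_gridE subsetD)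
  then have "grid_corner h a z + (\<Sum>b\<in>Basis. (h * (1 + (\<lambda>_. 1) b) / 2) *\<^sub>R b) \<in> element_nodes p h T"
    unfolding element_nodes_def gauss_lobatto_def
    by (intro CollectI exI[of _ "grid_corner h a z"] exI[of _ "\<lambda>_. 1"]) auto
  then show ?thesis using assms(1) unfolding mesh_nodes_def by blast
qed

lemma l2_inner_hypercube_eq_0:
  assumes "h > 0" "continuous_on (hypercube h a) v" "l2_inner (hypercube h a) v v = 0" "x \<in> hypercube h a"
  shows "v x = 0"
proof -
  let ?T = "hypercube h a"
  have "continuous_on ?T (\<lambda>x. v x * v x)" using assms(2) by (intro continuous_intros)
  then have "set_integrable lborel ?T (\<lambda>x. v x * v x)"
    by (rule set_integrable_lborel_compact[OF compact_hypercube])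
  then have "((\<lambda>x. v x * v x) has_integral 0) ?T"
    using assms(3) has_integral_integral set_borel_integral_eq_integral unfolding l2_inner_def by metis
  moreover have "box a (a + h *\<^sub>R One) \<noteq> {}" using assms(1) by (simp add: box_ne_empty inner_add_left)
  ultimately have "v x * v x = 0"
    using has_integral_0_cbox_imp_0[of a "a + h *\<^sub>R One" "\<lambda>x. v x * v x" x] assms
    unfolding hypercube_def by (auto intro!: continuous_intros)
  then show ?thesis by simp
qed

text \<open>Zero mass would force the function to vanish on an element containing a node j with x j
  \<noteq> 0, but its value at that node is x j.\<close>

lemma background_mass_pos:
  fixes \<T> :: "'a::euclidean_space set set"
  assumes fin: "finite \<T>" and grid: "\<T> \<subseteq> cartesian_grid h a" and h: "h > 0"
    and nb: "nodal_basis p h \<T> N \<phi>" and x: "\<exists>i<N. x i \<noteq> 0"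
  shows "0 < l2_inner (\<Union>\<T>) (\<lambda>y. \<Sum>i<N. x i * \<phi> i y) (\<lambda>y. \<Sum>i<N. x i * \<phi> i y)"
proof (rule ccontr)
  let ?v = "\<lambda>y. \<Sum>i<N. x i * \<phi> i y"
  assume "\<not> ?thesis"
  then have 0: "l2_inner (\<Union>\<T>) ?v ?v = 0" using l2_inner_self_nonneg[of "\<Union>\<T>" ?v] by simp
  obtain y where y: "bij_betw y {..<N} (mesh_nodes p h \<T>)" and \<phi>: "\<And>i. i < N \<Longrightarrow> \<phi> i \<in> fe_space p \<T>"
    and \<delta>: "\<And>i j. i < N \<Longrightarrow> j < N \<Longrightarrow> \<phi> i (y j) = (if i = j then 1 else 0)"
    using nb by (auto simp: nodal_basis_def)
  have v: "?v \<in> fe_space p \<T>" using \<phi> by (rule fe_space_lincomb)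
  obtain j where j: "j < N" "x j \<noteq> 0" using x by blast
  have "y j \<in> mesh_nodes p h \<T>" using y j by (auto simp: bij_betw_def)
  then obtain T where T: "T \<in> \<T>" "y j \<in> T" using element_nodes_subset[OF h] by (auto simp: mesh_nodes_def)
  obtain z where z: "T = hypercube h (grid_corner h a z)" using T grid by (meson cartesian_gridE subsetD)
  have U: "\<Union>\<T> \<in> sets borel" using grid_union_compact[OF fin grid] by (intro borel_closed compact_imp_closed)
  have "(\<Sum>T\<in>{T}. l2_inner T ?v ?v) \<le> 3 ^ DIM('a) * l2_inner (\<Union>\<T>) ?v ?v"
    by (rule sum_l2_inner_le[OF fin grid h v _ _ U]) (use T in auto)
  then have "l2_inner T ?v ?v = 0" using 0 l2_inner_self_nonneg[of T ?v] by simp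
  moreover have "continuous_on T ?v"
    using v T by (auto simp: fe_space_def intro: continuous_on_subset)
  ultimately have "?v (y j) = 0" using l2_inner_hypercube_eq_0[OF h] T(2) unfolding z by blast
  moreover have "?v (y j) = x j"
  proof -
    have "?v (y j) = (\<Sum>i<N. if i = j then x i else 0)"
      by (intro sum.cong refl) (simp add: \<delta> j(1))
    then show ?thesis using j(1) by simp
  qed
  ultimately show False using j by simp
qed

text \<open>Without cut elements \<Omega> would be the union of finitely many closed cubes, thus
  both open and closed, thus the whole space, against boundedness.\<close>

lemma cut_elements_nonempty:
  assumes "bounded_domain \<Omega>" "background_mesh \<Omega> h \<T>"
  shows "cut_elements \<Omega> \<T> \<noteq> {}"
proof
  assume "cut_elements \<Omega> \<T> = {}"
  then have "\<Omega> = \<Union>\<T>" using uncut_subset[OF assms(2)] assms(2) by (auto simp: background_mesh_def)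
  moreover have "compact (\<Union>\<T>)" using assms(2) grid_union_compact by (auto simp: background_mesh_def)
  ultimately have "closed \<Omega>" by (simp add: compact_imp_closed)
  then show False
    using assms(1) clopen[of \<Omega>] not_bounded_UNIV by (auto simp: bounded_domain_def)
qed

text \<open>Test with the constant polynomial 1: both cubes have the volume h^d.\<close>

lemma neighbour_const_ge_1:
  fixes a1 a2 :: "'a::euclidean_space"
  assumes C: "neighbour_const TYPE('a) p C" and h: "h > 0" and sf: "share_face (hypercube h a1) (hypercube h a2)"
  shows "1 \<le> C"
proof -
  let ?one = "\<lambda>x :: 'a. 1 :: real"
  \<comment> \<open>The zero multi-index; it is restricted to \<open>Basis\<close> because
    multi-indices in \<open>Q_poly\<close> are extensional functions.\<close>
  let ?z = "\<lambda>b :: 'a\<in>Basis. 0 :: nat"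
  have "(\<Sum>\<alpha>\<in>Basis \<rightarrow>\<^sub>E {..p}. (if \<alpha> = ?z then 1 else 0) * (\<Prod>b\<in>Basis. (x \<bullet> b) ^ \<alpha> b)) = 1" for x :: 'a
  proof -
    have "(\<Sum>\<alpha>\<in>Basis \<rightarrow>\<^sub>E {..p}. (if \<alpha> = ?z then 1 else 0) * (\<Prod>b\<in>Basis. (x \<bullet> b) ^ \<alpha> b))
      = (\<Sum>\<alpha>\<in>{?z}. (if \<alpha> = ?z then 1 else 0) * (\<Prod>b\<in>Basis. (x \<bullet> b) ^ \<alpha> b))"
      by (rule sum.mono_neutral_right) (auto intro: finite_PiE)
    then show ?thesis by simp
  qed
  then have one: "?one \<in> Q_poly p"
    unfolding Q_poly_def by (intro CollectI exI[of _ "\<lambda>\<alpha>. if \<alpha> = ?z then 1 else 0"]) auto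
  have "l2_inner (hypercube h a) ?one ?one = h ^ DIM('a)" for a :: 'a
  proof -
    have "l2_inner (hypercube h a) ?one ?one = measure lborel (hypercube h a)"
      unfolding l2_inner_def hypercube_def set_lebesgue_integral_def by simp
    also have "\<dots> = h ^ DIM('a)"
      using h by (simp add: hypercube_def content_cbox_if inner_add_left inner_diff_left box_ne_empty)
    finally show ?thesis .
  qed
  moreover have "(l2_norm (hypercube h a1) ?one)\<^sup>2 \<le> C * (l2_norm (hypercube h a2) ?one)\<^sup>2"
    using C h sf one unfolding neighbour_const_def by blast
  ultimately show ?thesis using h by (simp add: l2_norm_sq)
qed

text \<open>The required pair of cubes sharing a face is taken from the mesh: the first two members
  of the chain that starts at some cut element.\<close>

lemma mesh_neighbour_const_ge_1:
  fixes \<Omega> :: "'a::euclidean_space set"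
  assumes "bounded_domain \<Omega>" "background_mesh \<Omega> h \<T>" "h > 0" "well_resolved N_J \<Omega> \<T>"
    and C: "neighbour_const TYPE('a) p C"
  shows "1 \<le> C"
proof -
  obtain a where grid: "\<T> \<subseteq> cartesian_grid h a" using assms(2) by (auto simp: background_mesh_def)
  obtain T0 where T0: "T0 \<in> cut_elements \<Omega> \<T>" using cut_elements_nonempty[OF assms(1,2)] by blast
  then obtain N T where N: "1 \<le> N" "N \<le> N_J" "T 0 = T0" "\<forall>i\<in>{1..<N}. T i \<in> cut_elements \<Omega> \<T>"
      "T N \<in> \<T> - cut_elements \<Omega> \<T>" "\<forall>i\<in>{1..N}. share_face (T (i - 1)) (T i)"
    using assms(4) unfolding well_resolved_def by metis
  have "T 1 \<in> \<T>" using N by (cases "N = 1") (auto simp: cut_elements_def)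
  moreover have "T 0 \<in> \<T>" using T0 N by (simp add: cut_elements_def)
  ultimately obtain a1 a2 where "T 0 = hypercube h a1" "T 1 = hypercube h a2"
    using grid by (metis cartesian_gridE subsetD)
  moreover have "share_face (T 0) (T 1)" using N(1) N(6)[rule_format, of 1] by simp
  ultimately show ?thesis using neighbour_const_ge_1[OF C assms(3)] by metis
qed

theorem lemma5:
  fixes N_J :: nat and \<gamma>\<^sub>M :: real
  assumes "N_J \<ge> 1" and "\<gamma>\<^sub>M > 0"
  shows "\<exists>C\<^sub>l>0. \<exists>C\<^sub>g>0.
    \<forall>(\<Omega> :: 'a::euclidean_space set) (h :: real) (\<T> :: 'a set set) (C\<^sub>1 :: nat \<Rightarrow> real)
      (p :: nat) (w :: nat \<Rightarrow> real) (N :: nat) (\<phi> :: nat \<Rightarrow> 'a \<Rightarrow> real).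
      bounded_domain \<Omega> \<longrightarrow> h > 0 \<longrightarrow> background_mesh \<Omega> h \<T> \<longrightarrow> well_resolved N_J \<Omega> \<T> \<longrightarrow>
      (\<forall>r\<ge>1. neighbour_const TYPE('a) r (C\<^sub>1 r)) \<longrightarrow>
      p \<ge> 1 \<longrightarrow> (\<forall>k\<in>{1..p}. w k > 0) \<longrightarrow>
      nodal_basis p h \<T> N \<phi> \<longrightarrow>
      spectral_cond (stab_mass_matrix \<Omega> h \<T> \<gamma>\<^sub>M p w N \<phi>)
        \<le> C\<^sub>l * L_weight C\<^sub>1 p w ^ N_J * (1 + C\<^sub>g * G_weight p w)
            * spectral_cond (background_mass_matrix \<T> N \<phi>)"
proof -
  define K :: real where "K = 3 ^ DIM('a)"
  have K: "K > 0" by (simp add: K_def)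
  \<comment> \<open>The first factors come from \<open>background_mass_le\<close>. There the penalty
    enters without \<gamma>, and 1 + 1/\<gamma> dominates both 1 and 1/\<gamma>, which trades mass
    plus penalty for mass plus \<gamma> times penalty. \<open>C\<^sub>g\<close> is the constant of
    \<open>stab_form_le\<close> times \<gamma>. Both are fixed before the domain, the mesh, p and w
    are introduced.\<close>
  define C\<^sub>l where "C\<^sub>l = (6 * K) ^ N_J * K * (1 + 1 / \<gamma>\<^sub>M)"
  define C\<^sub>g where "C\<^sub>g = 64 * K\<^sup>2 * \<gamma>\<^sub>M"
  have pos: "C\<^sub>l > 0" "C\<^sub>g > 0"
    using K assms by (auto simp: C\<^sub>l_def C\<^sub>g_def intro!: mult_pos_pos add_pos_pos)
  have "spectral_cond (stab_mass_matrix \<Omega> h \<T> \<gamma>\<^sub>M p w N \<phi>)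
        \<le> C\<^sub>l * L_weight C\<^sub>1 p w ^ N_J * (1 + C\<^sub>g * G_weight p w)
            * spectral_cond (background_mass_matrix \<T> N \<phi>)"
    if dom: "bounded_domain \<Omega>" and h: "h > 0" and mesh: "background_mesh \<Omega> h \<T>"
      and res: "well_resolved N_J \<Omega> \<T>" and C: "\<forall>r\<ge>1. neighbour_const TYPE('a) r (C\<^sub>1 r)"
      and p: "p \<ge> 1" and w': "\<forall>k\<in>{1..p}. w k > 0" and nb: "nodal_basis p h \<T> N \<phi>"
    for \<Omega> :: "'a set" and h \<T> C\<^sub>1 p w N \<phi>
  proof (rule spectral_cond_le)
    obtain a where fin: "finite \<T>" and grid: "\<T> \<subseteq> cartesian_grid h a" and cover: "\<Omega> \<subseteq> \<Union>\<T>"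
      using mesh by (auto simp: background_mesh_def)
    have w: "0 < w k" if "k \<in> {1..p}" for k using w' that by blast
    have C1: "neighbour_const TYPE('a) p (C\<^sub>1 p)" using C p by blast
    have C1_ge: "1 \<le> C\<^sub>1 p" by (rule mesh_neighbour_const_ge_1[OF dom mesh h res C1])
    have \<Omega>: "open \<Omega>" "\<Omega> \<noteq> {}" using dom by (auto simp: bounded_domain_def)
    have \<phi>: "\<And>i. i < N \<Longrightarrow> \<phi> i \<in> fe_space p \<T>" using nb by (auto simp: nodal_basis_def)
    have \<Omega>m: "\<Omega> \<in> sets borel" using \<Omega>(1) by (rule borel_open)
    have U: "\<Union>\<T> \<in> sets borel" using grid_union_compact[OF fin grid] by (intro borel_closed compact_imp_closed)
    have G: "0 \<le> G_weight p w" using w by (rule G_weight_nonneg)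
    have L: "0 < L_weight C\<^sub>1 p w"
      using C1_ge sum_nonneg[of "{1..p}" "\<lambda>k. 1 / w k"] w by (auto simp: L_weight_def less_imp_le add_pos_nonneg)
    have qM: "quad_form (stab_mass_matrix \<Omega> h \<T> \<gamma>\<^sub>M p w N \<phi>) N x
      = stab_mass_form \<Omega> h \<T> \<gamma>\<^sub>M p w (\<lambda>y. \<Sum>i<N. x i * \<phi> i y) (\<lambda>y. \<Sum>i<N. x i * \<phi> i y)" for x
      by (rule quad_form_stab_mass_matrix[OF fin grid h \<phi> \<Omega>m cover])
    have qB: "quad_form (background_mass_matrix \<T> N \<phi>) N x
      = l2_inner (\<Union>\<T>) (\<lambda>y. \<Sum>i<N. x i * \<phi> i y) (\<lambda>y. \<Sum>i<N. x i * \<phi> i y)" for x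
      by (rule quad_form_background_mass_matrix[OF fin grid \<phi>])
    show "stab_mass_matrix \<Omega> h \<T> \<gamma>\<^sub>M p w N \<phi> \<in> carrier_mat N N" by (simp add: stab_mass_matrix_def)
    show "background_mass_matrix \<T> N \<phi> \<in> carrier_mat N N" by (simp add: background_mass_matrix_def)
    show "stab_mass_matrix \<Omega> h \<T> \<gamma>\<^sub>M p w N \<phi> $$ (i, j) = stab_mass_matrix \<Omega> h \<T> \<gamma>\<^sub>M p w N \<phi> $$ (j, i)"
      if "i < N" "j < N" for i j
      using that l2_inner_commute[of \<Omega> "\<phi> i"] stab_form_commute[of \<Omega> h \<T> p w "\<phi> i"]
      by (simp add: stab_mass_matrix_def stab_mass_form_def)
    show "background_mass_matrix \<T> N \<phi> $$ (i, j) = background_mass_matrix \<T> N \<phi> $$ (j, i)"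
      if "i < N" "j < N" for i j
      using that l2_inner_commute[of "\<Union>\<T>" "\<phi> i"] by (simp add: background_mass_matrix_def)
    show "1 \<le> N"
    proof -
      have "\<T> \<noteq> {}" using \<Omega>(2) cover by blast
      then have "mesh_nodes p h \<T> \<noteq> {}" using mesh_nodes_nonempty grid by blast
      then show ?thesis using nb by (auto simp: nodal_basis_def bij_betw_def)
    qed
    show "0 < quad_form (background_mass_matrix \<T> N \<phi>) N x" if "0 < sq_norm N x" for x
      unfolding qB using that background_mass_pos[OF fin grid h nb] by (simp add: sq_norm_pos)
    show "0 < C\<^sub>l * L_weight C\<^sub>1 p w ^ N_J" using pos L by simp
    show "0 \<le> 1 + C\<^sub>g * G_weight p w" using pos G by simp
    fix x
    let ?v = "\<lambda>y. \<Sum>i<N. x i * \<phi> i y"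
    let ?J = "stab_form \<Omega> h \<T> p w ?v ?v"
    have v: "?v \<in> fe_space p \<T>" using \<phi> by (rule fe_space_lincomb)
    have "0 \<le> face_stab_form h p w F ?v" for F using w h by (rule face_stab_form_nonneg)
    then have J: "0 \<le> ?J" unfolding stab_form_self by (simp add: sum_nonneg)
    have m: "0 \<le> l2_inner \<Omega> ?v ?v" by (rule l2_inner_self_nonneg)
    show "quad_form (background_mass_matrix \<T> N \<phi>) N x
      \<le> C\<^sub>l * L_weight C\<^sub>1 p w ^ N_J * quad_form (stab_mass_matrix \<Omega> h \<T> \<gamma>\<^sub>M p w N \<phi>) N x"
    proof -
      have "l2_inner (\<Union>\<T>) ?v ?v \<le> (6 * K * L_weight C\<^sub>1 p w) ^ N_J * K * (l2_inner \<Omega> ?v ?v + ?J)"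
        unfolding K_def by (rule background_mass_le[where C\<^sub>1 = C\<^sub>1, OF mesh \<Omega>(1) h v w C1 C1_ge res])
      also have "\<dots> \<le> (6 * K * L_weight C\<^sub>1 p w) ^ N_J * K * ((1 + 1 / \<gamma>\<^sub>M) * (l2_inner \<Omega> ?v ?v + \<gamma>\<^sub>M * ?J))"
      proof (rule mult_left_mono)
        have "(1 + 1 / \<gamma>\<^sub>M) * (l2_inner \<Omega> ?v ?v + \<gamma>\<^sub>M * ?J)
          = (l2_inner \<Omega> ?v ?v + ?J) + (l2_inner \<Omega> ?v ?v / \<gamma>\<^sub>M + \<gamma>\<^sub>M * ?J)"
          using assms by (simp add: field_simps)
        moreover have "0 \<le> l2_inner \<Omega> ?v ?v / \<gamma>\<^sub>M + \<gamma>\<^sub>M * ?J" using assms m J by simp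
        ultimately show "l2_inner \<Omega> ?v ?v + ?J \<le> (1 + 1 / \<gamma>\<^sub>M) * (l2_inner \<Omega> ?v ?v + \<gamma>\<^sub>M * ?J)" by linarith
      qed (use K L in simp)
      finally show ?thesis
        unfolding qB qM stab_mass_form_def C\<^sub>l_def by (simp only: power_mult_distrib mult_ac)
    qed
    show "quad_form (stab_mass_matrix \<Omega> h \<T> \<gamma>\<^sub>M p w N \<phi>) N x
      \<le> (1 + C\<^sub>g * G_weight p w) * quad_form (background_mass_matrix \<T> N \<phi>) N x"
    proof -
      have "?J \<le> 64 * K\<^sup>2 * G_weight p w * l2_inner (\<Union>\<T>) ?v ?v"
        unfolding K_def by (rule stab_form_le[OF fin grid h v w])
      then have "\<gamma>\<^sub>M * ?J \<le> \<gamma>\<^sub>M * (64 * K\<^sup>2 * G_weight p w * l2_inner (\<Union>\<T>) ?v ?v)"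
        using assms by (intro mult_left_mono) auto
      moreover have "l2_inner \<Omega> ?v ?v \<le> l2_inner (\<Union>\<T>) ?v ?v"
        unfolding l2_inner_def set_lebesgue_integral_def
      proof (rule integral_mono)
        show "integrable lborel (\<lambda>y. indicat_real \<Omega> y *\<^sub>R (?v y * ?v y))"
          using fe_space_set_integrable[OF fin grid v v \<Omega>m cover] unfolding set_integrable_def .
        show "integrable lborel (\<lambda>y. indicat_real (\<Union>\<T>) y *\<^sub>R (?v y * ?v y))"
          using fe_space_set_integrable[OF fin grid v v U order_refl] unfolding set_integrable_def .
        show "indicat_real \<Omega> y *\<^sub>R (?v y * ?v y) \<le> indicat_real (\<Union>\<T>) y *\<^sub>R (?v y * ?v y)" for y
          using cover by (auto simp: indicator_def)
      qed
      ultimately show ?thesis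
        unfolding qB qM stab_mass_form_def C\<^sub>g_def by (simp add: algebra_simps)
    qed
  qed
  with pos show ?thesis by blast
qed

end
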